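(* The problem $\#\mathrm{kTrees}$ is $\mathsf{\#W[1]}$-hard when parameterized by $k$.
   Context: $\#\mathrm{kTrees}$: given a simple graph $G$ and a natural number $k$, count the subgraphs of $G$ that are isomorphic to a $k$-tree, where a $k$-tree is a connected acyclic graph with exactly $k$ edges. A parameterized counting problem $(F,\kappa)$ consists of a function $F:\{0,1\}^*\to\mathbb{N}$ and a polynomial-time computable parameterization $\kappa:\{0,1\}^*\to\mathbb{N}$. An fpt Turing reduction from $(F,\kappa)$ to $(F',\kappa')$ is an algorithm with oracle access to $F'$ that computes $F$ in time $f(\kappa(x))\cdot|x|^c$ for some computable $f$ and constant $c$, such that every oracle query $y$ made on input $x$ satisfies $\kappa'(y)\le g(\kappa(x))$ for some computable $g$. A problem is $\mathsf{\#W[1]}$-hard if there is an fpt Turing reduction from $\#k\text{-}\mathrm{Clique}$ (given a graph $G$ and $k$, count the $k$-cliques of $G$, parameterized by $k$) to it. *)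

theory Defs
  imports "HOL-Library.Discrete_Functions"
begin

section \<open>Algorithms with oracle access\<close>

text \<open>
  Algorithms are structured programs of a random access machine under the logarithmic cost
  criterion, which simulates and is simulated by multitape Turing machines with polynomial
  overhead. Registers and array cells hold natural numbers. A program mentions finitely many
  registers and arrays; both are identified by numbers.
\<close>

record state =
  reg :: "nat \<Rightarrow> nat"
  arr :: "nat \<Rightarrow> nat \<Rightarrow> nat"

datatype exp =
    Const nat
  | Reg nat
  | Cell nat exp
  | Add exp exp
  | Sub exp exp
  | Mult exp exp
  | Div exp exp

primrec val :: "state \<Rightarrow> exp \<Rightarrow> nat" where
  "val s (Const n) = n"
| "val s (Reg r) = reg s r"
| "val s (Cell a e) = arr s a (val s e)"
| "val s (Add e1 e2) = val s e1 + val s e2"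
| "val s (Sub e1 e2) = val s e1 - val s e2"
| "val s (Mult e1 e2) = val s e1 * val s e2"
| "val s (Div e1 e2) = val s e1 div val s e2"

definition num_digits :: "nat \<Rightarrow> nat" where
  "num_digits n = floor_log n + 1"  \<comment> \<open>binary digits; \<open>0\<close> has one digit\<close>

text \<open>
  Every node of an expression is charged the length of its value. In this way an operation pays
  for its result and, through its subexpressions, for its operands and for the addresses used.
\<close>

primrec cost :: "state \<Rightarrow> exp \<Rightarrow> nat" where
  "cost s (Const n) = num_digits n"
| "cost s (Reg r) = num_digits (reg s r)"
| "cost s (Cell a e) = cost s e + num_digits (val s (Cell a e))"
| "cost s (Add e1 e2) = cost s e1 + cost s e2 + num_digits (val s (Add e1 e2))"
| "cost s (Sub e1 e2) = cost s e1 + cost s e2 + num_digits (val s (Sub e1 e2))"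
| "cost s (Mult e1 e2) = cost s e1 + cost s e2 + num_digits (val s (Mult e1 e2))"
| "cost s (Div e1 e2) = cost s e1 + cost s e2 + num_digits (val s (Div e1 e2))"

text \<open>
  \<open>Query r a e\<close> sends the first \<open>e\<close> cells of array \<open>a\<close> to the oracle, as a bit string in which a
  cell stands for \<open>1\<close> iff it is nonzero, and puts the answer into register \<open>r\<close>.
  \<open>If\<close> and \<open>While\<close> test whether the value of the expression is nonzero.
\<close>

datatype prog =
    Skip
  | Assign nat exp
  | Store nat exp exp
  | Seq prog prog
  | If exp prog prog
  | While exp prog
  | Query nat nat exp

definition query_string :: "state \<Rightarrow> nat \<Rightarrow> nat \<Rightarrow> bool list" where
  "query_string s a l = map (\<lambda>i. arr s a i \<noteq> 0) [0..<l]"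

definition set_reg :: "nat \<Rightarrow> nat \<Rightarrow> state \<Rightarrow> state" where
  "set_reg r v s = s\<lparr>reg := (reg s)(r := v)\<rparr>"

definition set_cell :: "nat \<Rightarrow> nat \<Rightarrow> nat \<Rightarrow> state \<Rightarrow> state" where
  "set_cell a i v s = s\<lparr>arr := (arr s)(a := (arr s a)(i := v))\<rparr>"

text \<open>
  \<open>exec F p s t Q s'\<close>: with oracle \<open>F\<close>, program \<open>p\<close> started in state \<open>s\<close> halts in state \<open>s'\<close> after
  time \<open>t\<close>, and \<open>Q\<close> is the set of strings on which the oracle was queried. A query pays for the
  length of the string and of the answer.
\<close>

inductive exec ::
    "(bool list \<Rightarrow> nat) \<Rightarrow> prog \<Rightarrow> state \<Rightarrow> nat \<Rightarrow> bool list set \<Rightarrow> state \<Rightarrow> bool"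
  for F :: "bool list \<Rightarrow> nat" where
  Skip: "exec F Skip s 1 {} s"
| Assign: "exec F (Assign r e) s (1 + cost s e) {} (set_reg r (val s e) s)"
| Store: "exec F (Store a e1 e2) s (1 + cost s e1 + cost s e2) {}
            (set_cell a (val s e1) (val s e2) s)"
| Seq: "exec F p1 s t1 Q1 s1 \<Longrightarrow> exec F p2 s1 t2 Q2 s2 \<Longrightarrow>
          exec F (Seq p1 p2) s (t1 + t2) (Q1 \<union> Q2) s2"
| IfTrue: "val s e \<noteq> 0 \<Longrightarrow> exec F p1 s t Q s' \<Longrightarrow>
             exec F (If e p1 p2) s (1 + cost s e + t) Q s'"
| IfFalse: "val s e = 0 \<Longrightarrow> exec F p2 s t Q s' \<Longrightarrow>
              exec F (If e p1 p2) s (1 + cost s e + t) Q s'"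
| WhileFalse: "val s e = 0 \<Longrightarrow> exec F (While e p) s (1 + cost s e) {} s"
| WhileTrue: "val s e \<noteq> 0 \<Longrightarrow> exec F p s t1 Q1 s1 \<Longrightarrow> exec F (While e p) s1 t2 Q2 s2 \<Longrightarrow>
                exec F (While e p) s (1 + cost s e + t1 + t2) (Q1 \<union> Q2) s2"
| Query: "y = query_string s a (val s e) \<Longrightarrow>
            exec F (Query r a e) s (1 + cost s e + length y + num_digits (F y)) {y}
              (set_reg r (F y) s)"

inductive_cases exec_SkipE: "exec F Skip s t Q s'"
inductive_cases exec_AssignE: "exec F (Assign r e) s t Q s'"
inductive_cases exec_StoreE: "exec F (Store a e1 e2) s t Q s'"
inductive_cases exec_SeqE: "exec F (Seq p1 p2) s t Q s'"
inductive_cases exec_IfE: "exec F (If e p1 p2) s t Q s'"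
inductive_cases exec_WhileE: "exec F (While e p) s t Q s'"
inductive_cases exec_QueryE: "exec F (Query r a e) s t Q s'"

lemma exec_deterministic:
  "exec F p s t Q s' \<Longrightarrow> exec F p s t2 Q2 s2 \<Longrightarrow> t2 = t \<and> Q2 = Q \<and> s2 = s'"
proof (induction arbitrary: t2 Q2 s2 rule: exec.induct)
  case Skip then show ?case by (auto elim: exec_SkipE)
next
  case Assign then show ?case by (auto elim: exec_AssignE)
next
  case Store then show ?case by (auto elim: exec_StoreE)
next
  case Seq
  from Seq.prems show ?case by (rule exec_SeqE) (use Seq.IH in fastforce)
next
  case (IfTrue s e p1 t Q s' p2)
  from IfTrue.prems show ?case
  proof (rule exec_IfE)
    fix u assume "t2 = Suc (cost s e + u)" "exec F p1 s u Q2 s2"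
    then show ?thesis using IfTrue.IH[of u Q2 s2] by simp
  qed (use IfTrue.hyps in simp)
next
  case (IfFalse s e p2 t Q s' p1)
  from IfFalse.prems show ?case
  proof (rule exec_IfE)
    fix u assume "t2 = Suc (cost s e + u)" "exec F p2 s u Q2 s2"
    then show ?thesis using IfFalse.IH[of u Q2 s2] by simp
  qed (use IfFalse.hyps in simp)
next
  case (WhileFalse s e p)
  from WhileFalse.prems show ?case by (rule exec_WhileE) (use WhileFalse.hyps in simp_all)
next
  case (WhileTrue s e p t1 Q1 s1 t3 Q3 s3)
  from WhileTrue.prems show ?case
  proof (rule exec_WhileE)
    fix u1 R1 r u2 R2
    assume *: "t2 = Suc (cost s e + u1 + u2)" "Q2 = R1 \<union> R2"
      "exec F p s u1 R1 r" "exec F (While e p) r u2 R2 s2"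
    have "u1 = t1 \<and> R1 = Q1 \<and> r = s1" by (rule WhileTrue.IH(1)) (rule *)
    moreover from this have "u2 = t3 \<and> R2 = Q3 \<and> s2 = s3" using *(4) WhileTrue.IH(2) by blast
    ultimately show ?thesis using * by simp
  qed (use WhileTrue.hyps in simp)
next
  case Query then show ?case by (auto elim: exec_QueryE)
qed

primrec query_free :: "prog \<Rightarrow> bool" where
  "query_free Skip \<longleftrightarrow> True"
| "query_free (Assign r e) \<longleftrightarrow> True"
| "query_free (Store a e1 e2) \<longleftrightarrow> True"
| "query_free (Seq p1 p2) \<longleftrightarrow> query_free p1 \<and> query_free p2"
| "query_free (If e p1 p2) \<longleftrightarrow> query_free p1 \<and> query_free p2"
| "query_free (While e p) \<longleftrightarrow> query_free p"
| "query_free (Query r a e) \<longleftrightarrow> False"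

text \<open>
  A string is passed in array \<open>0\<close>, its length in register \<open>0\<close>; a number is passed in
  register \<open>0\<close>. Everything else is initially \<open>0\<close>. The output is found in register \<open>0\<close>.
\<close>

definition init_string :: "bool list \<Rightarrow> state" where
  "init_string x = \<lparr>reg = (\<lambda>_. 0)(0 := length x),
     arr = (\<lambda>_ _. 0)(0 := (\<lambda>i. if i < length x \<and> x ! i then 1 else 0))\<rparr>"

definition init_number :: "nat \<Rightarrow> state" where
  "init_number n = \<lparr>reg = (\<lambda>_. 0)(0 := n), arr = (\<lambda>_ _. 0)\<rparr>"

text \<open>
  For query-free programs the oracle is irrelevant; the constant \<open>0\<close> is a placeholder.
\<close>

definition computable :: "(nat \<Rightarrow> nat) \<Rightarrow> bool" where
  "computable f \<longleftrightarrow> (\<exists>p. query_free p \<and>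
     (\<forall>n. \<exists>t Q s. exec (\<lambda>_. 0) p (init_number n) t Q s \<and> reg s 0 = f n))"

text \<open>
  In time bounds \<open>|x|\<close> is replaced by \<open>max 1 |x|\<close>, since no program runs in time \<open>0\<close> on the
  empty string.
\<close>

definition poly_time_computable :: "(bool list \<Rightarrow> nat) \<Rightarrow> bool" where
  "poly_time_computable F \<longleftrightarrow> (\<exists>p a c. query_free p \<and>
     (\<forall>x. \<exists>t Q s. exec (\<lambda>_. 0) p (init_string x) t Q s \<and> reg s 0 = F x \<and>
        t \<le> a * max 1 (length x) ^ c))"


section \<open>Parameterized counting problems\<close>

type_synonym counting_problem = "(bool list \<Rightarrow> nat) \<times> (bool list \<Rightarrow> nat)"

definition parameterized_counting_problem :: "counting_problem \<Rightarrow> bool" where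
  "parameterized_counting_problem = (\<lambda>(F, \<kappa>). poly_time_computable \<kappa>)"

definition fpt_turing_reduction ::
    "prog \<Rightarrow> counting_problem \<Rightarrow> counting_problem \<Rightarrow> bool" where
  "fpt_turing_reduction p = (\<lambda>(F, \<kappa>) (F', \<kappa>').
     \<exists>f g c. computable f \<and> computable g \<and>
       (\<forall>x. \<exists>t Q s. exec F' p (init_string x) t Q s \<and> reg s 0 = F x \<and>
          t \<le> f (\<kappa> x) * max 1 (length x) ^ c \<and>
          (\<forall>y\<in>Q. \<kappa>' y \<le> g (\<kappa> x))))"

definition fpt_turing_reducible :: "counting_problem \<Rightarrow> counting_problem \<Rightarrow> bool" where
  "fpt_turing_reducible P P' \<longleftrightarrow>
     parameterized_counting_problem P \<and> parameterized_counting_problem P' \<and>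
     (\<exists>p. fpt_turing_reduction p P P')"


section \<open>Graphs\<close>

type_synonym 'a graph = "'a set \<times> 'a set set"

abbreviation verts :: "'a graph \<Rightarrow> 'a set" where "verts \<equiv> fst"
abbreviation edges :: "'a graph \<Rightarrow> 'a set set" where "edges \<equiv> snd"

definition simple_graph :: "'a graph \<Rightarrow> bool" where
  "simple_graph G \<longleftrightarrow> finite (verts G) \<and> (\<forall>e\<in>edges G. e \<subseteq> verts G \<and> card e = 2)"

definition subgraph :: "'a graph \<Rightarrow> 'a graph \<Rightarrow> bool" where
  "subgraph H G \<longleftrightarrow> simple_graph H \<and> verts H \<subseteq> verts G \<and> edges H \<subseteq> edges G"

definition isomorphic :: "'a graph \<Rightarrow> 'b graph \<Rightarrow> bool" where
  "isomorphic G H \<longleftrightarrow> (\<exists>\<phi>. bij_betw \<phi> (verts G) (verts H) \<and>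
     (\<forall>u\<in>verts G. \<forall>v\<in>verts G. {u, v} \<in> edges G \<longleftrightarrow> {\<phi> u, \<phi> v} \<in> edges H))"

definition connected_graph :: "'a graph \<Rightarrow> bool" where
  "connected_graph G \<longleftrightarrow> verts G \<noteq> {} \<and>
     (\<forall>u\<in>verts G. \<forall>v\<in>verts G. (u, v) \<in> {(a, b). {a, b} \<in> edges G}\<^sup>*)"

definition cycle :: "'a graph \<Rightarrow> 'a list \<Rightarrow> bool" where
  "cycle G vs \<longleftrightarrow> length vs \<ge> 3 \<and> distinct vs \<and>
     (\<forall>i<length vs. {vs ! i, vs ! (Suc i mod length vs)} \<in> edges G)"

definition acyclic_graph :: "'a graph \<Rightarrow> bool" where
  "acyclic_graph G \<longleftrightarrow> (\<nexists>vs. cycle G vs)"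

definition k_tree :: "nat \<Rightarrow> 'a graph \<Rightarrow> bool" where
  "k_tree k T \<longleftrightarrow>
     simple_graph T \<and> connected_graph T \<and> acyclic_graph T \<and> card (edges T) = k"

definition count_k_trees :: "nat \<Rightarrow> nat graph \<Rightarrow> nat" where
  "count_k_trees k G =
     card {H. subgraph H G \<and> (\<exists>T :: nat graph. k_tree k T \<and> isomorphic H T)}"

definition k_clique :: "nat \<Rightarrow> 'a graph \<Rightarrow> 'a set \<Rightarrow> bool" where
  "k_clique k G S \<longleftrightarrow>
     S \<subseteq> verts G \<and> card S = k \<and> (\<forall>u\<in>S. \<forall>v\<in>S. u \<noteq> v \<longrightarrow> {u, v} \<in> edges G)"

definition count_k_cliques :: "nat \<Rightarrow> nat graph \<Rightarrow> nat" where
  "count_k_cliques k G = card {S. k_clique k G S}"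


section \<open>Instances as bit strings\<close>

text \<open>
  A graph on \<open>{..<n}\<close> together with a number \<open>k\<close> is written as \<open>1\<^sup>k 0 1\<^sup>n 0\<close> followed by the
  lower triangle of the adjacency matrix, row by row. In the decoding, missing bits count as \<open>0\<close>
  and superfluous ones are ignored, so that every string denotes an instance. Since the
  parameter is \<open>k\<close>, writing \<open>k\<close> in binary instead would change running times only by a factor
  depending on the parameter.
\<close>

definition encode :: "nat \<Rightarrow> nat \<Rightarrow> nat set set \<Rightarrow> bool list" where
  "encode k n E = replicate k True @ [False] @ replicate n True @ [False] @
     concat (map (\<lambda>i. map (\<lambda>j. {i, j} \<in> E) [0..<i]) [0..<n])"

definition decode :: "bool list \<Rightarrow> nat \<times> nat graph" where
  "decode x =
    (let k = length (takeWhile id x);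
         x' = drop (Suc k) x;
         n = length (takeWhile id x');
         bits = drop (Suc n) x'
     in (k, ({..<n}, {{i, j} | i j. j < i \<and> i < n \<and>
           i * (i - 1) div 2 + j < length bits \<and> bits ! (i * (i - 1) div 2 + j)})))"

lemma takeWhile_id_replicate:
  "takeWhile id (replicate k True @ False # xs) = replicate k True"
  by (induction k) auto

lemma length_triangle:
  "length (concat (map (\<lambda>i. map (f i) [0..<i]) [0..<n])) = n * (n - 1) div 2"
proof (induction n)
  case (Suc n)
  have "Suc n * n = n * (n - 1) + 2 * n" by (cases n) (auto simp: algebra_simps)
  then show ?case using Suc by simp
qed simp

lemma nth_triangle:
  assumes "j < i" "i < n"
  shows "i * (i - 1) div 2 + j < length (concat (map (\<lambda>i. map (f i) [0..<i]) [0..<n]))"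
    and "concat (map (\<lambda>i. map (f i) [0..<i]) [0..<n]) ! (i * (i - 1) div 2 + j) = f i j"
proof -
  let ?T = "\<lambda>n. concat (map (\<lambda>i. map (f i) [0..<i]) [0..<n])"
  have "i * (i - 1) div 2 + j < length (?T n) \<and> ?T n ! (i * (i - 1) div 2 + j) = f i j"
    using \<open>i < n\<close>
  proof (induction n)
    case (Suc n)
    show ?case
    proof (cases "i = n")
      case True
      then show ?thesis
        using \<open>j < i\<close> length_triangle[of f n] by (simp add: nth_append)
    next
      case False
      then show ?thesis using Suc by (simp add: nth_append)
    qed
  qed simp
  then show "i * (i - 1) div 2 + j < length (?T n)" "?T n ! (i * (i - 1) div 2 + j) = f i j"
    by auto
qed

lemma decode_encode:
  assumes "simple_graph ({..<n}, E)"
  shows "decode (encode k n E) = (k, ({..<n}, E))"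
proof -
  let ?bits = "concat (map (\<lambda>i. map (\<lambda>j. {i, j} \<in> E) [0..<i]) [0..<n])"
  have E: "E = {{i, j} | i j. j < i \<and> i < n \<and> {i, j} \<in> E}" (is "_ = ?E")
  proof
    show "E \<subseteq> ?E"
    proof
      fix e assume e: "e \<in> E"
      then obtain a b where ab: "e = {a, b}" "a \<noteq> b"
        using assms by (auto simp: simple_graph_def card_2_iff)
      then have "a < n" "b < n" using e assms by (auto simp: simple_graph_def)
      then show "e \<in> ?E"
      proof (cases "a < b")
        case True
        then have "e = {b, a} \<and> a < b \<and> b < n \<and> {b, a} \<in> E"
          using ab e \<open>b < n\<close> by (simp add: insert_commute)
        then show ?thesis by blast
      next
        case False
        then have "e = {a, b} \<and> b < a \<and> a < n \<and> {a, b} \<in> E"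
          using ab e \<open>a < n\<close> by simp
        then show ?thesis by blast
      qed
    qed
  qed blast
  have "decode (encode k n E) = (k, ({..<n}, {{i, j} | i j. j < i \<and> i < n \<and>
          i * (i - 1) div 2 + j < length ?bits \<and> ?bits ! (i * (i - 1) div 2 + j)}))"
    by (simp add: decode_def encode_def Let_def takeWhile_id_replicate)
  also have "{{i, j} | i j. j < i \<and> i < n \<and>
          i * (i - 1) div 2 + j < length ?bits \<and> ?bits ! (i * (i - 1) div 2 + j)} = ?E"
  proof -
    have "(j < i \<and> i < n \<and> i * (i - 1) div 2 + j < length ?bits \<and>
             ?bits ! (i * (i - 1) div 2 + j)) \<longleftrightarrow> (j < i \<and> i < n \<and> {i, j} \<in> E)" for i j
      using nth_triangle[of j i n "\<lambda>i j. {i, j} \<in> E"] by blast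
    then show ?thesis by (simp only:)
  qed
  finally show ?thesis using E by simp
qed

lemma simple_graph_decode: "simple_graph (snd (decode x))"
  by (auto simp: decode_def Let_def simple_graph_def)


section \<open>The counting problems\<close>

definition parameter :: "bool list \<Rightarrow> nat" where
  "parameter x = fst (decode x)"

definition kTrees :: counting_problem where
  "kTrees = (\<lambda>x. case decode x of (k, G) \<Rightarrow> count_k_trees k G, parameter)"

definition kClique :: counting_problem where
  "kClique = (\<lambda>x. case decode x of (k, G) \<Rightarrow> count_k_cliques k G, parameter)"

definition sharp_W1_hard :: "counting_problem \<Rightarrow> bool" where
  "sharp_W1_hard P \<longleftrightarrow> fpt_turing_reducible kClique P"

end

theory Submission
  imports Defs "HOL-Library.FuncSet" "HOL-Library.Nat_Bijection"
begin

text \<open>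
  Let \<open>k = r (r - 1) / 2\<close>, and replace the graph \<open>G\<close> by the tensor product of \<open>G\<close> with the complete
  graph on \<open>r\<close> colours, every vertex being copied \<open>t\<close> times. Inclusion--exclusion over the pairs of
  colours that are allowed at an edge turns numbers of \<open>k\<close>-trees into the number of those \<open>k\<close>-trees
  that use every pair of colours exactly once. Such a tree maps every half-edge \<open>(i, j)\<close> of the
  complete graph to a copy of a vertex of \<open>G\<close>, and whether such a map yields a tree depends only on
  which half-edges of the same colour get the same image. For a fixed map \<open>h\<close> to the vertices of
  \<open>G\<close>, the number of choices of copies is therefore a sum of products of falling factorials of \<open>t\<close>,
  one factor for each value of \<open>h\<close> in a colour class. So the total is \<open>t^r q(t)\<close> with a polynomial
  \<open>q\<close>, and only the \<open>h\<close> that are constant on each colour class, which are the embedded \<open>r\<close>-cliques,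
  contribute to \<open>q(0)\<close>. All contributions have the same sign, since a tree with \<open>k\<close> edges has
  \<open>k + 1\<close> vertices. Hence \<open>q(0)\<close> is the number of \<open>r\<close>-cliques times a nonzero number depending only
  on \<open>r\<close>; \<open>q(0)\<close> is found by extrapolation from \<open>t = 1, \<dots>, k + 1\<close>, and the unknown factor is
  cancelled by doing the same for the complete graph on \<open>r\<close> vertices.
\<close>

section \<open>Trees\<close>

text \<open>With \<open>k = num_pairs r\<close> edges and \<open>k\<close> pairs of colours, using
  every pair at least once, which is what inclusion-exclusion isolates, means using each exactly
  once. The obstacle is that a colour class of such a tree may meet copies of several vertices of
  \<open>G\<close>, so rainbow trees alone do not detect cliques. The copy number \<open>t\<close>
  separates the cases: the falling factorials are indexed by the pairs of a colour and a vertex of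
  \<open>G\<close> that occur, each has a simple zero at \<open>t = 0\<close>, and there are exactly
  \<open>r\<close> of them when each colour meets one vertex, otherwise more. With \<open>r\<close>
  factors and \<open>k + 1\<close> classes the lowest coefficient has sign
  \<open>(-1) ^ (k + 1 - r)\<close> for every gluing pattern, so nothing cancels and a single tree
  pattern suffices for a nonzero total. The normalising factor is a sum over all gluing patterns of
  trees; querying the complete graph spares the program from enumerating them. At most
  \<open>k + 1\<close> copies keep the queried graphs polynomial in size, and the
  \<open>2 ^ k\<close> colour sets cost a factor that depends on \<open>r\<close> only. For
  \<open>r < 2\<close> there are no pairs of colours, and the count is written down
  directly.\<close>

abbreviation adj :: "'a graph \<Rightarrow> ('a \<times> 'a) set" where
  "adj G \<equiv> {(a, b). {a, b} \<in> edges G}"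

lemma simple_graph_edgeD:
  assumes "simple_graph G" "{a, b} \<in> edges G"
  shows "a \<in> verts G" "b \<in> verts G" "a \<noteq> b"
  using assms by (fastforce simp: simple_graph_def card_2_iff)+

lemma simple_graph_edgeE:
  assumes "simple_graph G" "e \<in> edges G"
  obtains a b where "e = {a, b}" "a \<noteq> b" "a \<in> verts G" "b \<in> verts G"
proof -
  from assms obtain a b where "e = {a, b}" "a \<noteq> b"
    by (auto simp: simple_graph_def card_2_iff)
  then show thesis using that simple_graph_edgeD[OF assms(1), of a b] assms(2) by auto
qed

lemma isomorphic_sym:
  assumes "isomorphic G H"
  shows "isomorphic H G"
proof -
  from assms obtain \<phi> where bij: "bij_betw \<phi> (verts G) (verts H)"
    and e: "\<And>u v. u \<in> verts G \<Longrightarrow> v \<in> verts G \<Longrightarrow> {u, v} \<in> edges G \<longleftrightarrow> {\<phi> u, \<phi> v} \<in> edges H"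
    by (auto simp: isomorphic_def)
  let ?\<psi> = "inv_into (verts G) \<phi>"
  have "bij_betw ?\<psi> (verts H) (verts G)" by (rule bij_betw_inv_into[OF bij])
  moreover have "?\<psi> u \<in> verts G" "\<phi> (?\<psi> u) = u" if "u \<in> verts H" for u
    using that bij by (auto simp: bij_betw_def inv_into_into f_inv_into_f)
  ultimately show ?thesis unfolding isomorphic_def using e by metis
qed

lemma isomorphic_refl: "isomorphic G G"
  unfolding isomorphic_def by (intro exI[of _ id]) auto

text \<open>Paths are pushed forward along the bijection and cycles pulled back along its inverse.
  This lets \<open>count_k_trees\<close> test the subgraph itself instead of an isomorphic copy, and
  later identifies trees with equal gluing patterns.\<close>

lemma k_tree_isomorphic:
  assumes T: "k_tree k G" and H: "simple_graph H" and iso: "isomorphic G H"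
  shows "k_tree k H"
proof -
  have G: "simple_graph G" and con: "connected_graph G" and acy: "acyclic_graph G"
    and k: "card (edges G) = k"
    using T by (auto simp: k_tree_def)
  obtain \<phi> where bij: "bij_betw \<phi> (verts G) (verts H)"
    and e: "\<And>u v. u \<in> verts G \<Longrightarrow> v \<in> verts G \<Longrightarrow> {u, v} \<in> edges G \<longleftrightarrow> {\<phi> u, \<phi> v} \<in> edges H"
    using iso by (auto simp: isomorphic_def)
  have inj: "inj_on \<phi> (verts G)" and im: "\<phi> ` verts G = verts H"
    using bij by (auto simp: bij_betw_def)
  have path: "(\<phi> u, \<phi> v) \<in> (adj H)\<^sup>*" if "(u, v) \<in> (adj G)\<^sup>*" for u v
    using that
  proof induction
    case (step y z)
    then have "(\<phi> y, \<phi> z) \<in> adj H" using e[of y z] simple_graph_edgeD[OF G, of y z] by simp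
    with step.IH show ?case by (rule rtrancl.rtrancl_into_rtrancl)
  qed simp
  have conH: "connected_graph H"
    using con path im[symmetric] by (auto simp: connected_graph_def)
  have edges: "edges H = (`) \<phi> ` edges G"
  proof (intro equalityI subsetI)
    fix x assume x: "x \<in> edges H"
    then obtain a b where ab: "x = {a, b}" "a \<in> verts H" "b \<in> verts H"
      by (rule simple_graph_edgeE[OF H])
    then obtain u v where "u \<in> verts G" "v \<in> verts G" "a = \<phi> u" "b = \<phi> v"
      using im by (metis imageE)
    then show "x \<in> (`) \<phi> ` edges G" using e[of u v] x ab by (intro image_eqI[of _ _ "{u, v}"]) auto
  next
    fix x assume "x \<in> (`) \<phi> ` edges G"
    then obtain y where y: "y \<in> edges G" "x = \<phi> ` y" by auto
    then obtain a b where "y = {a, b}" "a \<in> verts G" "b \<in> verts G"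
      by (meson simple_graph_edgeE[OF G])
    then show "x \<in> edges H" using y e[of a b] by simp
  qed
  have "inj_on ((`) \<phi>) (edges G)"
    by (rule inj_on_subset[OF inj_on_image_Pow[OF inj]]) (use G in \<open>auto simp: simple_graph_def\<close>)
  then have cardH: "card (edges H) = k" using k edges by (simp add: card_image)
  have "\<not> cycle H vs" for vs
  proof
    assume c: "cycle H vs"
    let ?\<psi> = "inv_into (verts G) \<phi>"
    have in_H: "x \<in> verts H" if "x \<in> set vs" for x
    proof -
      from that obtain i where "i < length vs" "x = vs ! i" by (auto simp: in_set_conv_nth)
      then show ?thesis using c simple_graph_edgeD[OF H] by (auto simp: cycle_def)
    qed
    have psi: "?\<psi> x \<in> verts G" "\<phi> (?\<psi> x) = x" if "x \<in> set vs" for x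
      using in_H[OF that] im by (auto simp: inv_into_into f_inv_into_f)
    have "inj_on ?\<psi> (set vs)" using psi(2) by (metis inj_onI)
    moreover have "{?\<psi> (vs ! i), ?\<psi> (vs ! (Suc i mod length vs))} \<in> edges G"
      if "i < length vs" for i
    proof -
      have "Suc i mod length vs < length vs" using that by (intro mod_less_divisor) auto
      then have "vs ! i \<in> set vs" "vs ! (Suc i mod length vs) \<in> set vs" using that by auto
      then show ?thesis using e psi c that by (simp add: cycle_def)
    qed
    moreover have "Suc i mod length vs < length vs" if "i < length vs" for i
      using that by (intro mod_less_divisor) auto
    ultimately have "cycle G (map ?\<psi> vs)"
      using c unfolding cycle_def by (auto simp: distinct_map)
    then show False using acy by (auto simp: acyclic_graph_def)
  qed
  then show ?thesis using H conH cardH by (auto simp: k_tree_def acyclic_graph_def)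
qed

section \<open>Paths, cycles and connected components\<close>

lemma rtrancl_distinct_path:
  assumes "(u, v) \<in> r\<^sup>*"
  shows "\<exists>vs. vs \<noteq> [] \<and> hd vs = u \<and> last vs = v \<and> distinct vs \<and>
    (\<forall>i. Suc i < length vs \<longrightarrow> (vs ! i, vs ! Suc i) \<in> r)"
  using assms
proof induction
  case base
  show ?case by (intro exI[of _ "[u]"]) auto
next
  case (step y z)
  then obtain vs where vs: "vs \<noteq> []" "hd vs = u" "last vs = y" "distinct vs"
    "\<And>i. Suc i < length vs \<Longrightarrow> (vs ! i, vs ! Suc i) \<in> r" by blast
  show ?case
  proof (cases "z \<in> set vs")
    case True
    then obtain i where i: "i < length vs" "vs ! i = z" by (auto simp: in_set_conv_nth)
    \<comment> \<open>The walk returns to a vertex already visited; it is cut there, so the list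
      stays distinct.\<close>
    let ?ws = "take (Suc i) vs"
    have "hd ?ws = u" using vs by (simp add: hd_take)
    moreover have "last ?ws = z" using i by (simp add: take_Suc_conv_app_nth)
    ultimately show ?thesis using vs i by (intro exI[of _ ?ws]) auto
  next
    case False
    let ?ws = "vs @ [z]"
    have "(?ws ! i, ?ws ! Suc i) \<in> r" if "Suc i < length ?ws" for i
    proof (cases "Suc i = length vs")
      case True
      then have "vs ! i = y" using vs(1,3) by (metis diff_Suc_1 last_conv_nth)
      then show ?thesis using True step.hyps(2) by (simp add: nth_append)
    next
      case False
      then show ?thesis using that vs(5)[of i] by (auto simp: nth_append)
    qed
    then show ?thesis using vs False by (intro exI[of _ ?ws]) auto
  qed
qed

text \<open>A distinct path from \<open>a\<close> to \<open>b\<close> in \<open>E\<close> would be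
  closed to a cycle by the new edge. Its length is at least 3, since a path of two vertices would be
  that edge itself.\<close>

lemma acyclic_edge_bridge:
  assumes sg: "simple_graph (V, insert {a, b} E)" and new: "{a, b} \<notin> E"
    and acy: "acyclic_graph (V, insert {a, b} E)"
  shows "(a, b) \<notin> (adj (V, E))\<^sup>*"
proof
  assume "(a, b) \<in> (adj (V, E))\<^sup>*"
  then obtain vs where vs: "vs \<noteq> []" "hd vs = a" "last vs = b" "distinct vs"
    "\<And>i. Suc i < length vs \<Longrightarrow> {vs ! i, vs ! Suc i} \<in> E"
    using rtrancl_distinct_path[of a b "adj (V, E)"] by auto
  have "a \<noteq> b" using simple_graph_edgeD(3)[OF sg, of a b] by simp
  have a: "vs ! 0 = a" using vs(1,2) by (simp add: hd_conv_nth)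
  have b: "vs ! (length vs - 1) = b" using vs(1,3) by (simp add: last_conv_nth)
  have len: "length vs \<ge> 3"
  proof (rule ccontr)
    assume "\<not> 3 \<le> length vs"
    moreover have "length vs \<noteq> 0" "length vs \<noteq> 1" using vs(1) a b \<open>a \<noteq> b\<close> by auto
    ultimately have "length vs = 2" by linarith
    then show False using vs(5)[of 0] a b new by simp
  qed
  have "{vs ! i, vs ! (Suc i mod length vs)} \<in> insert {a, b} E" if "i < length vs" for i
  proof (cases "Suc i = length vs")
    case True
    then have "vs ! i = b" using b by (metis diff_Suc_1)
    then show ?thesis using True a by (simp add: insert_commute)
  next
    case False
    then show ?thesis using that vs(5)[of i] by simp
  qed
  then have "cycle (V, insert {a, b} E) vs" using len vs(4) by (auto simp: cycle_def)
  then show False using acy by (auto simp: acyclic_graph_def)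
qed

lemma acyclic_graph_mono:
  assumes "acyclic_graph (V, E')" "E \<subseteq> E'"
  shows "acyclic_graph (V, E)"
proof -
  have "cycle (V, E') vs" if "cycle (V, E) vs" for vs
    using that assms(2) by (auto simp: cycle_def)
  then show ?thesis using assms(1) unfolding acyclic_graph_def by blast
qed

definition is_component_labelling :: "'a graph \<Rightarrow> ('a \<Rightarrow> 'b) \<Rightarrow> bool" where
  "is_component_labelling G c \<longleftrightarrow>
    (\<forall>u\<in>verts G. \<forall>v\<in>verts G. (u, v) \<in> (adj G)\<^sup>* \<longleftrightarrow> c u = c v)"

text \<open>Inserting the edges one by one, \<open>c\<close> labels the vertices by their connected component.\<close>

lemma component_labelling:
  fixes V :: "'a set"
  assumes "finite E" "simple_graph (V, E)" "acyclic_graph (V, E)"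
  shows "\<exists>c :: 'a \<Rightarrow> 'a. is_component_labelling (V, E) c \<and> card (c ` V) + card E = card V"
  using assms
proof (induction E rule: finite_induct)
  case empty
  have "adj (V, {}) = {}" by auto
  then show ?case
    by (intro exI[of _ "\<lambda>v. v"]) (auto simp: is_component_labelling_def)
next
  case (insert e E)
  note sg = insert.prems(1)
  obtain a b where e: "e = {a, b}" "a \<noteq> b" "a \<in> V" "b \<in> V"
    using simple_graph_edgeE[OF sg, of e] by auto
  have sgE: "simple_graph (V, E)" using sg by (auto simp: simple_graph_def)
  have "acyclic_graph (V, E)" by (rule acyclic_graph_mono[OF insert.prems(2)]) auto
  from insert.IH[OF sgE this] obtain c :: "'a \<Rightarrow> 'a"
    where c: "is_component_labelling (V, E) c" and card: "card (c ` V) + card E = card V" by blast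
  have c1: "\<forall>u\<in>V. \<forall>v\<in>V. (u, v) \<in> (adj (V, E))\<^sup>* \<longrightarrow> c u = c v"
    and c2: "\<forall>u\<in>V. \<forall>v\<in>V. c u = c v \<longrightarrow> (u, v) \<in> (adj (V, E))\<^sup>*"
    using c by (simp_all add: is_component_labelling_def)
  have "(a, b) \<notin> (adj (V, E))\<^sup>*"
    using acyclic_edge_bridge[of V a b E] sg insert.prems(2) insert.hyps(2) e(1) by simp
  then have ne: "c a \<noteq> c b" using c2 e by blast
  \<comment> \<open>The component of \<open>b\<close> takes over the label of \<open>a\<close>;
    exactly one label disappears because \<open>c a \<noteq> c b\<close>.\<close>
  define c' where "c' v = (if c v = c b then c a else c v)" for v
  let ?E = "insert e E"
  have "adj (V, E) \<subseteq> adj (V, ?E)" by auto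
  then have mono: "(adj (V, E))\<^sup>* \<subseteq> (adj (V, ?E))\<^sup>*" by (rule rtrancl_mono)
  have ab: "(a, b) \<in> (adj (V, ?E))\<^sup>*" "(b, a) \<in> (adj (V, ?E))\<^sup>*"
    by (rule r_into_rtrancl, simp add: e insert_commute)+
  have c'1: "c' u = c' v" if "(u, v) \<in> (adj (V, ?E))\<^sup>*" "u \<in> V" for u v
    using that
  proof induction
    case (step y z)
    have yz: "y \<in> V" "z \<in> V" using simple_graph_edgeD[OF sg, of y z] step.hyps by auto
    have "c' y = c' z"
    proof (cases "{y, z} = e")
      case True
      then show ?thesis using e ne by (auto simp: c'_def doubleton_eq_iff)
    next
      case False
      then have "(y, z) \<in> (adj (V, E))\<^sup>*" using step.hyps by (intro r_into_rtrancl) auto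
      then have "c y = c z" using c1 yz by blast
      then show ?thesis by (simp add: c'_def)
    qed
    with step show ?case by simp
  qed simp
  have c'2: "(u, v) \<in> (adj (V, ?E))\<^sup>*" if "u \<in> V" "v \<in> V" "c' u = c' v" for u v
  proof -
    consider "c u = c v" | "c u = c b" "c v = c a" | "c u = c a" "c v = c b"
      using \<open>c' u = c' v\<close> by (auto simp: c'_def split: if_splits)
    then show ?thesis
    proof cases
      case 1
      then have "(u, v) \<in> (adj (V, E))\<^sup>*" using c2 that(1,2) by blast
      then show ?thesis by (rule subsetD[OF mono])
    next
      case 2
      then have "(u, b) \<in> (adj (V, E))\<^sup>*" "(a, v) \<in> (adj (V, E))\<^sup>*"
        using c2[rule_format, OF that(1) e(4)] c2[rule_format, OF e(3) that(2)] by metis+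
      then have "(u, b) \<in> (adj (V, ?E))\<^sup>*" "(a, v) \<in> (adj (V, ?E))\<^sup>*"
        by (blast intro: subsetD[OF mono])+
      then show ?thesis using ab(2) by (meson rtrancl_trans)
    next
      case 3
      then have "(u, a) \<in> (adj (V, E))\<^sup>*" "(b, v) \<in> (adj (V, E))\<^sup>*"
        using c2[rule_format, OF that(1) e(3)] c2[rule_format, OF e(4) that(2)] by metis+
      then have "(u, a) \<in> (adj (V, ?E))\<^sup>*" "(b, v) \<in> (adj (V, ?E))\<^sup>*"
        by (blast intro: subsetD[OF mono])+
      then show ?thesis using ab(1) by (meson rtrancl_trans)
    qed
  qed
  have "card (c' ` V) + card ?E = card V"
  proof -
    have "finite V" using sg by (simp add: simple_graph_def)
    have "c' ` V = c ` V - {c b}"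
      using ne e by (auto simp: c'_def image_iff)
    then have "card (c' ` V) = card (c ` V) - 1" using e \<open>finite V\<close> by simp
    moreover have "card (c ` V) > 0" using e \<open>finite V\<close> by (auto simp: card_gt_0_iff)
    ultimately show ?thesis using card insert.hyps by simp
  qed
  moreover have "is_component_labelling (V, ?E) c'"
    unfolding is_component_labelling_def fst_conv
  proof (intro ballI iffI)
    fix u v assume "u \<in> V" "v \<in> V"
    show "c' u = c' v" if "(u, v) \<in> (adj (V, ?E))\<^sup>*" by (rule c'1) fact+
    show "(u, v) \<in> (adj (V, ?E))\<^sup>*" if "c' u = c' v" by (rule c'2) fact+
  qed
  ultimately show ?case by blast
qed

text \<open>Connectedness leaves a single label in the component labelling, so components plus edges
  amount to \<open>1 + k\<close>.\<close>

lemma card_verts_k_tree: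
  fixes T :: "'a graph"
  assumes "k_tree k T"
  shows "card (verts T) = Suc k"
proof -
  obtain V E where T: "T = (V, E)" by (cases T)
  have sg: "simple_graph (V, E)" and con: "connected_graph (V, E)" and "acyclic_graph (V, E)"
    and k: "card E = k" using assms by (auto simp: k_tree_def T)
  have "finite V" "E \<subseteq> Pow V" using sg by (auto simp: simple_graph_def)
  then have "finite E" by (meson finite_Pow_iff finite_subset)
  from component_labelling[OF this sg \<open>acyclic_graph (V, E)\<close>]
  obtain c :: "'a \<Rightarrow> 'a" where "is_component_labelling (V, E) c"
    and card: "card (c ` V) + card E = card V" by blast
  then have c1: "\<forall>u\<in>V. \<forall>v\<in>V. (u, v) \<in> (adj (V, E))\<^sup>* \<longrightarrow> c u = c v"
    by (simp add: is_component_labelling_def)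
  obtain v where v: "v \<in> V" using con by (auto simp: connected_graph_def)
  have "c u = c v" if "u \<in> V" for u
  proof -
    have "(u, v) \<in> (adj (V, E))\<^sup>*" using con v that by (simp add: connected_graph_def)
    then show ?thesis using c1 v that by blast
  qed
  then have "c ` V = (\<lambda>_. c v) ` V" by (intro image_cong refl)
  then have "c ` V = {c v}" using v by auto
  then show ?thesis using card k T by simp
qed

text \<open>Take a vertex of maximal rank on a cycle: each of its two neighbours on the cycle must
  be its parent, but these neighbours are distinct.\<close>

lemma acyclic_parent_graph:
  fixes rank :: "'a \<Rightarrow> nat"
  assumes "\<And>e. e \<in> edges G \<Longrightarrow> \<exists>v. e = {v, par v} \<and> rank (par v) < rank v"
  shows "acyclic_graph G"
proof -
  have False if c: "cycle G vs" for vs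
  proof -
    let ?n = "length vs"
    have n: "?n \<ge> 3" and dist: "distinct vs"
      and e: "\<And>i. i < ?n \<Longrightarrow> {vs ! i, vs ! (Suc i mod ?n)} \<in> edges G"
      using c by (auto simp: cycle_def)
    let ?R = "(\<lambda>i. rank (vs ! i)) ` {..<?n}"
    have "Max ?R \<in> ?R" using n by (intro Max_in) (auto simp: lessThan_empty_iff)
    then obtain i where i: "i < ?n" "rank (vs ! i) = Max ?R" by auto
    have max: "rank (vs ! j) \<le> rank (vs ! i)" if "j < ?n" for j
      using that unfolding i(2) by (intro Max_ge) auto
    have par: "x = par (vs ! i)"
      if x: "{vs ! i, x} \<in> edges G" "x = vs ! j" "j < ?n" for x j
    proof -
      obtain v where v: "{vs ! i, x} = {v, par v}" "rank (par v) < rank v"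
        using assms[OF x(1)] by blast
      then show ?thesis using max[OF x(3)] x(2) by (auto simp: doubleton_eq_iff)
    qed
    let ?s = "Suc i mod ?n"
    \<comment> \<open>\<open>p\<close> is the cyclic predecessor of \<open>i\<close>; length at
      least 3 keeps it apart from the successor \<open>?s\<close>.\<close>
    define p where "p = (if i = 0 then ?n - 1 else i - 1)"
    have s: "?s < ?n" using n by (intro mod_less_divisor) auto
    have p: "p < ?n" "Suc p mod ?n = i" using i n by (auto simp: p_def)
    have "vs ! ?s = par (vs ! i)" using par[OF e[OF i(1)] refl s] .
    moreover have "vs ! p = par (vs ! i)"
      using par[of "vs ! p" p] e[OF p(1)] p by (simp add: insert_commute)
    ultimately have "p = ?s" using dist s p(1) by (metis nth_eq_iff_index_eq)
    then show False using i n by (cases "Suc i = ?n") (auto simp: p_def split: if_splits)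
  qed
  then show ?thesis by (auto simp: acyclic_graph_def)
qed

lemma connected_edges_Union:
  assumes sg: "simple_graph G" and con: "connected_graph G" and ne: "edges G \<noteq> {}"
  shows "\<Union>(edges G) = verts G"
proof
  show "\<Union>(edges G) \<subseteq> verts G" using sg by (auto simp: simple_graph_def)
  show "verts G \<subseteq> \<Union>(edges G)"
  proof
    fix v assume v: "v \<in> verts G"
    obtain e where e: "e \<in> edges G" using ne by auto
    then obtain a b where ab: "e = {a, b}" "a \<noteq> b" "a \<in> verts G" "b \<in> verts G"
      by (rule simple_graph_edgeE[OF sg])
    obtain w where w: "w \<in> verts G" "w \<noteq> v" using ab by metis
    have "(v, w) \<in> (adj G)\<^sup>*" using con v w by (auto simp: connected_graph_def)
    then obtain y where "(v, y) \<in> adj G" using w(2) by (metis converse_rtranclE)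
    then show "v \<in> \<Union>(edges G)" by auto
  qed
qed

text \<open>A connected graph with an edge has no isolated vertex, so its edge set determines it.
  For \<open>k = 0\<close> this fails: single vertices are counted, but leave no trace in the edge
  set.\<close>

lemma count_k_trees_edge_sets:
  assumes sg: "simple_graph G" and k: "k \<ge> 1"
  shows "count_k_trees k G = card {F. F \<subseteq> edges G \<and> k_tree k (\<Union>F, F)}"
proof -
  have verts: "verts H = \<Union>(edges H)" if "k_tree k H" for H :: "nat graph"
  proof -
    have "edges H \<noteq> {}" using that k by (auto simp: k_tree_def)
    then show ?thesis using that connected_edges_Union[of H] by (simp add: k_tree_def)
  qed
  have eq: "{H. subgraph H G \<and> (\<exists>T :: nat graph. k_tree k T \<and> isomorphic H T)} =
      {H. subgraph H G \<and> k_tree k H}" (is "?A = ?B")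
  proof -
    have "(\<exists>T :: nat graph. k_tree k T \<and> isomorphic H T) \<longleftrightarrow> k_tree k H" if "subgraph H G" for H
      using that k_tree_isomorphic[of k _ H] isomorphic_sym[of H] isomorphic_refl[of H]
      unfolding subgraph_def by blast
    then show ?thesis by blast
  qed
  have "bij_betw edges ?B {F. F \<subseteq> edges G \<and> k_tree k (\<Union>F, F)}"
    unfolding bij_betw_def
  proof (intro conjI equalityI subsetI)
    show "inj_on edges ?B" by (auto simp: inj_on_def dest!: verts intro: prod_eqI)
  next
    fix F assume "F \<in> edges ` ?B"
    then obtain H where H: "subgraph H G" "k_tree k H" "F = edges H" by blast
    have "H = (verts H, edges H)" by simp
    also have "\<dots> = (\<Union>F, F)" using verts[OF H(2)] H(3) by simp
    finally have "k_tree k (\<Union>F, F)" using H(2) by (rule subst)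
    then show "F \<in> {F. F \<subseteq> edges G \<and> k_tree k (\<Union>F, F)}"
      using H by (simp add: subgraph_def)
  next
    fix F assume F: "F \<in> {F. F \<subseteq> edges G \<and> k_tree k (\<Union>F, F)}"
    then have "\<Union>F \<subseteq> verts G" using sg by (auto simp: simple_graph_def)
    then have "(\<Union>F, F) \<in> ?B" using F by (auto simp: subgraph_def k_tree_def)
    then show "F \<in> edges ` ?B" by force
  qed
  then show ?thesis unfolding count_k_trees_def eq by (rule bij_betw_same_card)
qed

section \<open>Polynomial functions and finite differences\<close>

text \<open>\<open>poly_below d f\<close>: the \<open>d\<close>-th finite difference of \<open>f\<close> vanishes, that is, \<open>f\<close> is a polynomial
  function of degree less than \<open>d\<close>.\<close>

primrec poly_below :: "nat \<Rightarrow> (int \<Rightarrow> int) \<Rightarrow> bool" where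
  "poly_below 0 f \<longleftrightarrow> (\<forall>x. f x = 0)"
| "poly_below (Suc d) f \<longleftrightarrow> poly_below d (\<lambda>x. f (x + 1) - f x)"

lemma poly_below_zero: "poly_below d (\<lambda>x. 0)"
  by (induction d) auto

lemma poly_below_add: "poly_below d f \<Longrightarrow> poly_below d g \<Longrightarrow> poly_below d (\<lambda>x. f x + g x)"
proof (induction d arbitrary: f g)
  case (Suc d)
  then have "poly_below d (\<lambda>x. (f (x + 1) - f x) + (g (x + 1) - g x))" by simp
  then show ?case by (simp add: algebra_simps)
qed auto

lemma poly_below_sum:
  "(\<And>i. i \<in> I \<Longrightarrow> poly_below d (f i)) \<Longrightarrow> poly_below d (\<lambda>x. \<Sum>i\<in>I. f i x)"
  by (induction I rule: infinite_finite_induct) (auto simp: poly_below_zero poly_below_add)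

lemma poly_below_Suc: "poly_below d f \<Longrightarrow> poly_below (Suc d) f"
proof (induction d arbitrary: f)
  case (Suc d)
  then show ?case by (simp only: poly_below.simps(2)[of "Suc d"] poly_below.simps(2)[of d])
qed simp

lemma poly_below_mono: "d \<le> d' \<Longrightarrow> poly_below d f \<Longrightarrow> poly_below d' f"
  by (induction rule: dec_induct) (auto simp del: poly_below.simps intro: poly_below_Suc)

text \<open>Discrete product rule: the difference of \<open>(x - m) * f x\<close> is
  \<open>(x - (m - 1)) * (f (x + 1) - f x) + f x\<close>. The shift of \<open>m\<close> is why it is
  arbitrary in the induction.\<close>

lemma poly_below_mult: "poly_below d f \<Longrightarrow> poly_below (Suc d) (\<lambda>x. (x - m) * f x)"
proof (induction d arbitrary: f m)
  case (Suc d)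
  have "poly_below d (\<lambda>x. f (x + 1) - f x)" using Suc.prems by simp
  from poly_below_add[OF Suc.IH[OF this, of "m - 1"] Suc.prems]
  have "poly_below (Suc d) (\<lambda>x. (x - (m - 1)) * (f (x + 1) - f x) + f x)" .
  moreover have "(\<lambda>x. (x - (m - 1)) * (f (x + 1) - f x) + f x) =
      (\<lambda>x. (x + 1 - m) * f (x + 1) - (x - m) * f x)"
    by (auto simp: algebra_simps)
  ultimately show ?case by (simp only: poly_below.simps(2)[of "Suc d"])
qed simp

lemma poly_below_mult_power: "poly_below d f \<Longrightarrow> poly_below (d + e) (\<lambda>x. x ^ e * f x)"
proof (induction e)
  case (Suc e)
  then show ?case using poly_below_mult[of "d + e" "\<lambda>x. x ^ e * f x" 0]
    by (simp add: mult.assoc del: poly_below.simps)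
qed simp

text \<open>Up to sign the sum is the \<open>d\<close>-th finite difference of \<open>f\<close> at
  \<open>x\<close>; Pascal's rule carries the induction.\<close>

lemma poly_below_alternating_sum:
  "poly_below d f \<Longrightarrow> (\<Sum>j\<le>d. (-1) ^ j * int (d choose j) * f (x + int j)) = 0"
proof (induction d arbitrary: f)
  case (Suc d)
  define g where "g j = (-1) ^ j * int (d choose j)" for j
  have IH: "(\<Sum>j\<le>d. g j * (f (x + int j + 1) - f (x + int j))) = 0"
    using Suc.IH[of "\<lambda>x. f (x + 1) - f x"] Suc.prems by (simp add: g_def)
  have "(\<Sum>j\<le>Suc d. (-1) ^ j * int (Suc d choose j) * f (x + int j)) =
      f x + (\<Sum>j\<le>d. (-1) ^ Suc j * int (Suc d choose Suc j) * f (x + int (Suc j)))"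
    by (subst sum.atMost_Suc_shift) simp
  also have "(\<Sum>j\<le>d. (-1) ^ Suc j * int (Suc d choose Suc j) * f (x + int (Suc j))) =
      - (\<Sum>j\<le>d. g j * f (x + int j + 1)) + (\<Sum>j\<le>d. g (Suc j) * f (x + int (Suc j)))"
    by (simp add: g_def algebra_simps sum.distrib sum_negf sum_subtractf)
  also have "f x + (- (\<Sum>j\<le>d. g j * f (x + int j + 1)) + (\<Sum>j\<le>d. g (Suc j) * f (x + int (Suc j))))
     = - (\<Sum>j\<le>d. g j * f (x + int j + 1)) + (\<Sum>j\<le>Suc d. g j * f (x + int j))"
    by (subst sum.atMost_Suc_shift) (simp add: g_def)
  also have "(\<Sum>j\<le>Suc d. g j * f (x + int j)) = (\<Sum>j\<le>d. g j * f (x + int j))"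
    by (simp add: g_def)
  finally show ?case using IH by (simp add: algebra_simps sum_subtractf)
qed simp

text \<open>The term \<open>j = 0\<close> is isolated. With no copies the queried graph is empty, so
  the value at \<open>0\<close> can only be reached through the values at
  \<open>1..d\<close>.\<close>

lemma poly_below_extrapolate:
  assumes "poly_below d f"
  shows "(\<Sum>j = 1..d. (-1) ^ (j + 1) * int (d choose j) * f (int j)) = f 0"
proof -
  have "(\<Sum>j\<le>d. (-1) ^ j * int (d choose j) * f (int j)) = 0"
    using poly_below_alternating_sum[OF assms, of 0] by simp
  also have "{..d} = insert 0 {1..d}" by auto
  finally show ?thesis by (simp add: sum_negf)
qed


section \<open>Functions with a prescribed kernel\<close>

text \<open>The condition says that \<open>d \<mapsto> (\<tau> d, l d)\<close> has the same kernel
  as \<open>\<kappa>\<close>. In the application \<open>\<tau>\<close> gives colour and vertex,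
  \<open>l\<close> the copy, and \<open>\<kappa>\<close> the prescribed gluing.\<close>

definition copies :: "'d set \<Rightarrow> ('d \<Rightarrow> 'c) \<Rightarrow> ('d \<Rightarrow> 'k) \<Rightarrow> nat \<Rightarrow> ('d \<Rightarrow> nat) set" where
  "copies D \<tau> \<kappa> t =
    {l \<in> D \<rightarrow>\<^sub>E {..<t}. \<forall>d\<in>D. \<forall>d'\<in>D. \<tau> d = \<tau> d' \<and> l d = l d' \<longleftrightarrow> \<kappa> d = \<kappa> d'}"

lemma copiesI:
  assumes "l \<in> D \<rightarrow>\<^sub>E {..<t}"
    and "\<And>d d'. d \<in> D \<Longrightarrow> d' \<in> D \<Longrightarrow> \<tau> d = \<tau> d' \<and> l d = l d' \<longleftrightarrow> \<kappa> d = \<kappa> d'"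
  shows "l \<in> copies D \<tau> \<kappa> t"
  using assms by (simp add: copies_def)

lemma copiesD:
  "l \<in> copies D \<tau> \<kappa> t \<Longrightarrow> d \<in> D \<Longrightarrow> d' \<in> D \<Longrightarrow> \<tau> d = \<tau> d' \<and> l d = l d' \<longleftrightarrow> \<kappa> d = \<kappa> d'"
  by (simp add: copies_def)

lemma copies_undefined: "l \<in> copies D \<tau> \<kappa> t \<Longrightarrow> x \<notin> D \<Longrightarrow> l x = undefined"
  by (simp only: copies_def mem_Collect_eq) (blast dest: PiE_arb)

lemma finite_copies: "finite D \<Longrightarrow> finite (copies D \<tau> \<kappa> t)"
  by (simp add: copies_def finite_PiE)

lemma card_image_eq_kernel:
  assumes "\<And>d d'. d \<in> A \<Longrightarrow> d' \<in> A \<Longrightarrow> f d = f d' \<longleftrightarrow> g d = g d'"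
  shows "card (f ` A) = card (g ` A)"
proof -
  have f: "f (inv_into A g (g d)) = f d" if "d \<in> A" for d
    using assms[of "inv_into A g (g d)" d] that by (simp add: inv_into_into f_inv_into_f)
  have "bij_betw (\<lambda>y. f (inv_into A g y)) (g ` A) (f ` A)"
    unfolding bij_betw_def
  proof
    show "inj_on (\<lambda>y. f (inv_into A g y)) (g ` A)"
      using f assms by (auto simp: inj_on_def)
    show "(\<lambda>y. f (inv_into A g y)) ` g ` A = f ` A"
      using f by (force simp: image_image)
  qed
  then show ?thesis by (metis bij_betw_same_card)
qed

text \<open>The new point joins the class of \<open>y\<close>, so its value is forced to be
  \<open>l y\<close>.\<close>

lemma card_copies_insert_old:
  assumes D: "finite D" "x \<notin> D" and y: "y \<in> D" "\<kappa> x = \<kappa> y"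
    and ref: "\<And>d d'. d \<in> insert x D \<Longrightarrow> d' \<in> insert x D \<Longrightarrow> \<kappa> d = \<kappa> d' \<Longrightarrow> \<tau> d = \<tau> d'"
  shows "card (copies (insert x D) \<tau> \<kappa> t) = card (copies D \<tau> \<kappa> t)"
proof -
  have ty: "\<tau> x = \<tau> y" using ref y by auto
  have "bij_betw (\<lambda>l. l(x := l y)) (copies D \<tau> \<kappa> t) (copies (insert x D) \<tau> \<kappa> t)"
  proof (rule bij_betwI[where g = "\<lambda>l. l(x := undefined)"])
    show "(\<lambda>l. l(x := l y)) \<in> copies D \<tau> \<kappa> t \<rightarrow> copies (insert x D) \<tau> \<kappa> t"
    proof
      fix l assume l: "l \<in> copies D \<tau> \<kappa> t"
      then have k: "\<tau> d = \<tau> d' \<and> l d = l d' \<longleftrightarrow> \<kappa> d = \<kappa> d'" if "d \<in> D" "d' \<in> D" for d d'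
        using that by (simp add: copies_def)
      have "l(x := l y) \<in> insert x D \<rightarrow>\<^sub>E {..<t}"
        using l y by (auto simp: copies_def PiE_iff extensional_def)
      moreover have "\<tau> d = \<tau> d' \<and> (l(x := l y)) d = (l(x := l y)) d' \<longleftrightarrow> \<kappa> d = \<kappa> d'"
        if "d \<in> insert x D" "d' \<in> insert x D" for d d'
        using that k[of d d'] k[of y d'] k[of d y] y ty D(2) by auto
      ultimately show "l(x := l y) \<in> copies (insert x D) \<tau> \<kappa> t" by (rule copiesI)
    qed
    show "(\<lambda>l. l(x := undefined)) \<in> copies (insert x D) \<tau> \<kappa> t \<rightarrow> copies D \<tau> \<kappa> t"
    proof
      fix l assume l: "l \<in> copies (insert x D) \<tau> \<kappa> t"
      have "l(x := undefined) \<in> D \<rightarrow>\<^sub>E {..<t}"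
        using l D(2) by (auto simp: copies_def PiE_iff extensional_def)
      moreover have "\<tau> d = \<tau> d' \<and> (l(x := undefined)) d = (l(x := undefined)) d' \<longleftrightarrow> \<kappa> d = \<kappa> d'"
        if "d \<in> D" "d' \<in> D" for d d'
        using that l D(2) by (auto simp: copies_def)
      ultimately show "l(x := undefined) \<in> copies D \<tau> \<kappa> t" by (rule copiesI)
    qed
  next
    fix l assume "l \<in> copies D \<tau> \<kappa> t"
    from copies_undefined[OF this D(2)] have "l x = undefined" .
    then show "(l(x := l y))(x := undefined) = l" by (metis fun_upd_triv fun_upd_upd)
  next
    fix l assume "l \<in> copies (insert x D) \<tau> \<kappa> t"
    then have "\<tau> x = \<tau> y \<and> l x = l y \<longleftrightarrow> \<kappa> x = \<kappa> y" using y by (simp add: copies_def)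
    then have "l x = l y" using y by simp
    moreover have "y \<noteq> x" using D(2) y(1) by blast
    ultimately show "(l(x := undefined))(x := (l(x := undefined)) y) = l"
      by (metis fun_upd_other fun_upd_triv fun_upd_upd)
  qed
  then show ?thesis by (metis bij_betw_same_card)
qed

text \<open>The new point opens a class and must avoid the values taken inside its own fibre of
  \<open>\<tau>\<close>, which are as many as the \<open>\<kappa>\<close>-classes there. If these
  exceed \<open>t\<close>, no \<open>l\<close> exists on \<open>D\<close>, so the identity survives
  a negative factor.\<close>

lemma card_copies_insert_new:
  assumes D: "finite D" "x \<notin> D" and new: "\<kappa> x \<notin> \<kappa> ` D"
  shows "int (card (copies (insert x D) \<tau> \<kappa> t)) =
    (int t - int (card (\<kappa> ` {d \<in> D. \<tau> d = \<tau> x}))) * int (card (copies D \<tau> \<kappa> t))"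
proof -
  let ?B = "{d \<in> D. \<tau> d = \<tau> x}"
  let ?S = "SIGMA l:copies D \<tau> \<kappa> t. {..<t} - l ` ?B"
  have "bij_betw (\<lambda>(l, v). l(x := v)) ?S (copies (insert x D) \<tau> \<kappa> t)"
  proof (rule bij_betwI[where g = "\<lambda>l. (l(x := undefined), l x)"])
    show "(\<lambda>(l, v). l(x := v)) \<in> ?S \<rightarrow> copies (insert x D) \<tau> \<kappa> t"
    proof (clarify)
      fix l v assume l: "l \<in> copies D \<tau> \<kappa> t" and v: "v < t" "v \<notin> l ` ?B"
      then have k: "\<tau> d = \<tau> d' \<and> l d = l d' \<longleftrightarrow> \<kappa> d = \<kappa> d'" if "d \<in> D" "d' \<in> D" for d d'
        using that by (simp add: copies_def)
      have "l(x := v) \<in> insert x D \<rightarrow>\<^sub>E {..<t}"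
        using l v by (auto simp: copies_def PiE_iff extensional_def)
      moreover have "\<tau> d = \<tau> d' \<and> (l(x := v)) d = (l(x := v)) d' \<longleftrightarrow> \<kappa> d = \<kappa> d'"
        if "d \<in> insert x D" "d' \<in> insert x D" for d d'
      proof (cases "d = x \<or> d' = x")
        case True
        then show ?thesis using that v(2) new D(2) by (cases "d = d'") (auto simp: image_iff)
      next
        case False
        then show ?thesis using that k[of d d'] by auto
      qed
      ultimately show "l(x := v) \<in> copies (insert x D) \<tau> \<kappa> t" by (rule copiesI)
    qed
    show "(\<lambda>l. (l(x := undefined), l x)) \<in> copies (insert x D) \<tau> \<kappa> t \<rightarrow> ?S"
    proof
      fix l assume l: "l \<in> copies (insert x D) \<tau> \<kappa> t"
      have "l(x := undefined) \<in> D \<rightarrow>\<^sub>E {..<t}" "l x < t"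
        using l D(2) by (auto simp: copies_def PiE_iff extensional_def)
      moreover have "\<tau> d = \<tau> d' \<and> (l(x := undefined)) d = (l(x := undefined)) d' \<longleftrightarrow> \<kappa> d = \<kappa> d'"
        if "d \<in> D" "d' \<in> D" for d d'
        using that l D(2) by (auto simp: copies_def)
      moreover have "l x \<notin> (l(x := undefined)) ` ?B"
      proof
        assume "l x \<in> (l(x := undefined)) ` ?B"
        then obtain d where "d \<in> D" "\<tau> d = \<tau> x" and eq: "l x = (l(x := undefined)) d" by blast
        then have d: "d \<in> D" "\<tau> x = \<tau> d" "d \<noteq> x" using D(2) by auto
        then have "l x = l d" using eq by simp
        moreover have "\<tau> x = \<tau> d \<and> l x = l d \<longleftrightarrow> \<kappa> x = \<kappa> d"
          using l d(1) by (simp add: copies_def)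
        ultimately show False using new d by blast
      qed
      ultimately show "(l(x := undefined), l x) \<in> ?S" by (blast intro: copiesI)
    qed
  next
    fix y assume "y \<in> ?S"
    then obtain l v where "y = (l, v)" "l x = undefined"
      using D(2) by (blast dest: copies_undefined)
    then show "((case y of (l, v) \<Rightarrow> l(x := v))(x := undefined), (case y of (l, v) \<Rightarrow> l(x := v)) x) = y"
      by auto
  next
    fix l assume "l \<in> copies (insert x D) \<tau> \<kappa> t"
    show "(case (l(x := undefined), l x) of (l, v) \<Rightarrow> l(x := v)) = l" by simp
  qed
  from bij_betw_same_card[OF this] have "int (card (copies (insert x D) \<tau> \<kappa> t)) = int (card ?S)"
    by simp
  also have "card ?S = (\<Sum>l\<in>copies D \<tau> \<kappa> t. card ({..<t} - l ` ?B))"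
    using finite_copies[OF D(1)] by (intro card_SigmaI) auto
  also have "int \<dots> = (\<Sum>l\<in>copies D \<tau> \<kappa> t. int t - int (card (\<kappa> ` ?B)))"
    unfolding of_nat_sum
  proof (intro sum.cong refl)
    fix l assume l: "l \<in> copies D \<tau> \<kappa> t"
    have "card (l ` ?B) = card (\<kappa> ` ?B)"
    proof (rule card_image_eq_kernel)
      fix d d' assume "d \<in> ?B" "d' \<in> ?B"
      then show "l d = l d' \<longleftrightarrow> \<kappa> d = \<kappa> d'" using copiesD[OF l, of d d'] by simp
    qed
    moreover have "l ` ?B \<subseteq> {..<t}" using l by (auto simp: copies_def)
    ultimately show "int (card ({..<t} - l ` ?B)) = int t - int (card (\<kappa> ` ?B))"
      using D(1) card_mono[of "{..<t}" "l ` ?B"]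
      by (simp add: card_Diff_subset of_nat_diff)
  qed
  finally show ?thesis by simp
qed

text \<open>\<open>card (copies D \<tau> \<kappa> t)\<close> is a product of falling factorials of \<open>t\<close>, one for each value of \<open>\<tau>\<close>.
  Each of them is divisible by \<open>t\<close> exactly once, and its linear coefficient has the sign
  \<open>(-1) ^ (m - 1)\<close> if \<open>m\<close> is the number of factors.\<close>

lemma card_copies_poly:
  assumes "finite D"
    and "\<And>d d'. d \<in> D \<Longrightarrow> d' \<in> D \<Longrightarrow> \<kappa> d = \<kappa> d' \<Longrightarrow> \<tau> d = \<tau> d'"
  shows "\<exists>Q c. card (\<tau> ` D) \<le> card (\<kappa> ` D) \<and>
    poly_below (Suc (card (\<kappa> ` D) - card (\<tau> ` D))) Q \<and>
    c > 0 \<and> Q 0 = (-1) ^ (card (\<kappa> ` D) - card (\<tau> ` D)) * c \<and>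
    (\<forall>t. int (card (copies D \<tau> \<kappa> t)) = int t ^ card (\<tau> ` D) * Q (int t))"
  using assms
proof (induction D rule: finite_induct)
  case empty
  have "copies {} \<tau> \<kappa> t = {\<lambda>_. undefined}" for t by (auto simp: copies_def)
  then show ?case by (intro exI[of _ "\<lambda>_. 1"] exI[of _ 1]) simp
next
  case (insert x D)
  let ?k = "card (\<kappa> ` D)" and ?t = "card (\<tau> ` D)"
  obtain Q c where Q: "?t \<le> ?k" "poly_below (Suc (?k - ?t)) Q" "c > 0"
    "Q 0 = (-1) ^ (?k - ?t) * c"
    and cnt: "\<And>t. int (card (copies D \<tau> \<kappa> t)) = int t ^ ?t * Q (int t)"
    using insert.IH insert.prems by (metis insertI2)
  show ?case
  proof (cases "\<kappa> x \<in> \<kappa> ` D")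
    case True
    then obtain y where y: "y \<in> D" "\<kappa> x = \<kappa> y" by auto
    then have "\<tau> x = \<tau> y" using insert.prems[of x y] by simp
    then have "\<kappa> ` insert x D = \<kappa> ` D" "\<tau> ` insert x D = \<tau> ` D" using y by auto
    moreover have "card (copies (insert x D) \<tau> \<kappa> t) = card (copies D \<tau> \<kappa> t)" for t
      using card_copies_insert_old[of D x y \<kappa> \<tau> t] insert.hyps y insert.prems by blast
    ultimately show ?thesis using Q cnt by (intro exI[of _ Q] exI[of _ c]) simp
  next
    case new: False
    let ?m = "card (\<kappa> ` {d \<in> D. \<tau> d = \<tau> x})"
    have k: "card (\<kappa> ` insert x D) = Suc ?k" using new insert.hyps(1) by simp
    note step = card_copies_insert_new[OF insert.hyps new, of \<tau>]
    show ?thesis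
    proof (cases "\<tau> x \<in> \<tau> ` D")
      case True
      then have t: "\<tau> ` insert x D = \<tau> ` D" by auto
      \<comment> \<open>A further class over an old value of \<open>\<tau>\<close>: the factor
        \<open>x - m\<close> with \<open>m > 0\<close> raises the degree by one and flips the sign
        at \<open>0\<close>.\<close>
      have m: "?m > 0" using True insert.hyps(1) by (auto simp: card_gt_0_iff image_iff)
      have d: "Suc ?k - ?t = Suc (?k - ?t)" using Q(1) by simp
      show ?thesis
        unfolding k t d
      proof (intro exI conjI allI)
        show "poly_below (Suc (Suc (?k - ?t))) (\<lambda>x. (x - int ?m) * Q x)"
          by (rule poly_below_mult[OF Q(2)])
        show "0 < int ?m * c" using m Q(3) by simp
      qed (use Q step cnt in auto)
    next
      case False
      then have t: "card (\<tau> ` insert x D) = Suc ?t" using insert.hyps(1) by simp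
      \<comment> \<open>The first class over a new value of \<open>\<tau>\<close>: the factor is
        \<open>t\<close> itself and goes into the power of \<open>t\<close>.\<close>
      have "{d \<in> D. \<tau> d = \<tau> x} = {}" using False by (auto simp: image_iff)
      then have m: "?m = 0" by (simp only: image_empty card.empty)
      show ?thesis
        unfolding k t using Q step m cnt
        by (intro exI[of _ Q] exI[of _ c]) (simp del: poly_below.simps)
    qed
  qed
qed

section \<open>Splitting the vertices of a complete graph\<close>

definition half_edges :: "nat \<Rightarrow> (nat \<times> nat) set" where
  "half_edges r = {(i, j). i < r \<and> j < r \<and> i \<noteq> j}"

abbreviation num_pairs :: "nat \<Rightarrow> nat" where
  "num_pairs r \<equiv> r * (r - 1) div 2"

text \<open>The half-edge \<open>(i, j)\<close> of the edge \<open>{i, j}\<close> of the complete graph is attached to the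
  vertex \<open>\<phi> (i, j)\<close>.\<close>

definition split_graph :: "nat \<Rightarrow> (nat \<times> nat \<Rightarrow> 'v) \<Rightarrow> 'v graph" where
  "split_graph r \<phi> =
    (\<phi> ` half_edges r, (\<lambda>(i, j). {\<phi> (i, j), \<phi> (j, i)}) ` half_edges r)"

text \<open>Gluing only half-edges at the same vertex of the complete graph excludes loops and keeps
  different pairs of colours on different edges.\<close>

definition colour_respecting :: "nat \<Rightarrow> (nat \<times> nat \<Rightarrow> 'v) \<Rightarrow> bool" where
  "colour_respecting r \<phi> \<longleftrightarrow>
    (\<forall>d\<in>half_edges r. \<forall>d'\<in>half_edges r. \<phi> d = \<phi> d' \<longrightarrow> fst d = fst d')"

definition tree_split :: "nat \<Rightarrow> (nat \<times> nat \<Rightarrow> 'v) \<Rightarrow> bool" where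
  "tree_split r \<phi> \<longleftrightarrow> k_tree (num_pairs r) (split_graph r \<phi>)"

lemma half_edges_swap: "(i, j) \<in> half_edges r \<longleftrightarrow> (j, i) \<in> half_edges r"
  by (auto simp: half_edges_def)

lemma finite_half_edges: "finite (half_edges r)"
  by (rule finite_subset[of _ "{..<r} \<times> {..<r}"]) (auto simp: half_edges_def)

lemma fst_half_edges: "r \<ge> 2 \<Longrightarrow> fst ` half_edges r = {..<r}"
proof (intro equalityI subsetI)
  fix i assume "r \<ge> 2" "i \<in> {..<r}"
  then have "(i, if i = 0 then 1 else 0) \<in> half_edges r" by (auto simp: half_edges_def)
  then show "i \<in> fst ` half_edges r" by force
qed (auto simp: half_edges_def)

lemma split_graph_edge_iff:
  "e \<in> edges (split_graph r \<phi>) \<longleftrightarrow> (\<exists>i j. (i, j) \<in> half_edges r \<and> e = {\<phi> (i, j), \<phi> (j, i)})"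
  by (auto simp: split_graph_def)

lemma colour_respectingI:
  "(\<And>d d'. d \<in> half_edges r \<Longrightarrow> d' \<in> half_edges r \<Longrightarrow> \<phi> d = \<phi> d' \<Longrightarrow> fst d = fst d') \<Longrightarrow>
    colour_respecting r \<phi>"
  unfolding colour_respecting_def by blast

lemma colour_respectingD:
  "colour_respecting r \<phi> \<Longrightarrow> d \<in> half_edges r \<Longrightarrow> d' \<in> half_edges r \<Longrightarrow> \<phi> d = \<phi> d' \<Longrightarrow> fst d = fst d'"
  unfolding colour_respecting_def by blast

lemma edges_split_graph:
  "edges (split_graph r \<phi>) = (\<lambda>(i, j). {\<phi> (i, j), \<phi> (j, i)}) ` (SIGMA i:{..<r}. {..<i})"
proof (intro equalityI subsetI)
  fix e assume "e \<in> edges (split_graph r \<phi>)"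
  then obtain i j where ij: "i < r" "j < r" "i \<noteq> j" "e = {\<phi> (i, j), \<phi> (j, i)}"
    by (auto simp: split_graph_def half_edges_def)
  show "e \<in> (\<lambda>(i, j). {\<phi> (i, j), \<phi> (j, i)}) ` (SIGMA i:{..<r}. {..<i})"
  proof (cases "j < i")
    case True
    then show ?thesis using ij by (intro image_eqI[of _ _ "(i, j)"]) auto
  next
    case False
    then show ?thesis using ij by (intro image_eqI[of _ _ "(j, i)"]) auto
  qed
next
  fix e assume "e \<in> (\<lambda>(i, j). {\<phi> (i, j), \<phi> (j, i)}) ` (SIGMA i:{..<r}. {..<i})"
  then obtain i j where "i < r" "j < i" "e = {\<phi> (i, j), \<phi> (j, i)}" by auto
  then show "e \<in> edges (split_graph r \<phi>)"
    unfolding split_graph_def snd_conv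
    by (intro image_eqI[of _ _ "(i, j)"]) (auto simp: half_edges_def)
qed

lemma card_triangle: "card (SIGMA i:{..<r}. {..<i}) = num_pairs r"
  using Sum_Ico_nat[of 0 r] by (simp add: atLeast0LessThan)

text \<open>The colours of its two ends tell from which pair an edge comes.\<close>

lemma card_edges_split_graph:
  assumes "colour_respecting r \<phi>"
  shows "card (edges (split_graph r \<phi>)) = num_pairs r"
proof -
  have col: "\<phi> d = \<phi> d' \<Longrightarrow> fst d = fst d'" if "d \<in> half_edges r" "d' \<in> half_edges r" for d d'
    using colour_respectingD[OF assms that] .
  have "inj_on (\<lambda>(i, j). {\<phi> (i, j), \<phi> (j, i)}) (SIGMA i:{..<r}. {..<i})"
  proof (rule inj_onI, clarify)
    fix i j i' j' assume r: "i < r" "j < i" "i' < r" "j' < i'"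
      and eq: "{\<phi> (i, j), \<phi> (j, i)} = {\<phi> (i', j'), \<phi> (j', i')}"
    have h: "(i, j) \<in> half_edges r" "(j, i) \<in> half_edges r"
      "(i', j') \<in> half_edges r" "(j', i') \<in> half_edges r"
      using r by (auto simp: half_edges_def)
    from eq consider "\<phi> (i, j) = \<phi> (i', j')" "\<phi> (j, i) = \<phi> (j', i')"
      | "\<phi> (i, j) = \<phi> (j', i')" "\<phi> (j, i) = \<phi> (i', j')" by (auto simp: doubleton_eq_iff)
    then show "i = i' \<and> j = j'"
    proof cases
      case 1
      then show ?thesis using col[OF h(1,3)] col[OF h(2,4)] by simp
    next
      case 2
      then show ?thesis using col[OF h(1,4)] col[OF h(2,3)] r by simp
    qed
  qed
  then show ?thesis by (simp only: edges_split_graph card_image card_triangle)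
qed

lemma simple_split_graph:
  assumes "colour_respecting r \<phi>"
  shows "simple_graph (split_graph r \<phi>)"
proof -
  have "\<phi> (i, j) \<noteq> \<phi> (j, i)" if "(i, j) \<in> half_edges r" for i j
  proof
    assume "\<phi> (i, j) = \<phi> (j, i)"
    moreover have "(j, i) \<in> half_edges r" using that half_edges_swap by blast
    ultimately have "i = j" using colour_respectingD[OF assms that] by fastforce
    then show False using that by (simp add: half_edges_def)
  qed
  then show ?thesis
    using half_edges_swap finite_half_edges by (fastforce simp: simple_graph_def split_graph_def)
qed

text \<open>Up to isomorphism the graph depends only on which half-edges are glued.\<close>

lemma tree_split_kernel:
  assumes T: "tree_split r \<phi>" and "colour_respecting r \<psi>"
    and ker: "\<And>d d'. d \<in> half_edges r \<Longrightarrow> d' \<in> half_edges r \<Longrightarrow> \<phi> d = \<phi> d' \<longleftrightarrow> \<psi> d = \<psi> d'"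
  shows "tree_split r \<psi>"
proof -
  let ?D = "half_edges r"
  define f where "f v = \<psi> (inv_into ?D \<phi> v)" for v
  have f: "f (\<phi> d) = \<psi> d" if "d \<in> ?D" for d
    using ker[of "inv_into ?D \<phi> (\<phi> d)" d] that
    by (simp add: f_def inv_into_into f_inv_into_f)
  have "bij_betw f (\<phi> ` ?D) (\<psi> ` ?D)"
    unfolding bij_betw_def
  proof
    show "inj_on f (\<phi> ` ?D)" using f ker by (auto simp: inj_on_def)
    show "f ` \<phi> ` ?D = \<psi> ` ?D" using f by (force simp: image_image)
  qed
  moreover have "{\<phi> d, \<phi> d'} \<in> edges (split_graph r \<phi>) \<longleftrightarrow> {\<psi> d, \<psi> d'} \<in> edges (split_graph r \<psi>)"
    if d: "d \<in> ?D" "d' \<in> ?D" for d d'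
  proof -
    have "{\<phi> d, \<phi> d'} = {\<phi> (i, j), \<phi> (j, i)} \<longleftrightarrow> {\<psi> d, \<psi> d'} = {\<psi> (i, j), \<psi> (j, i)}"
      if "(i, j) \<in> ?D" for i j
    proof -
      have "(j, i) \<in> ?D" using that half_edges_swap by blast
      then show ?thesis using that d ker by (simp add: doubleton_eq_iff)
    qed
    then show ?thesis unfolding split_graph_edge_iff by blast
  qed
  ultimately have "isomorphic (split_graph r \<phi>) (split_graph r \<psi>)"
    unfolding isomorphic_def using f
    by (intro exI[of _ f]) (auto simp: split_graph_def)
  then show ?thesis
    using T simple_split_graph[OF assms(2)] k_tree_isomorphic unfolding tree_split_def by blast
qed

text \<open>The star with centre \<open>(0, 0)\<close> and leaves \<open>(i, 0)\<close>, together with a pendant vertex \<open>(j, i)\<close>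
  attached to \<open>(i, 0)\<close> for each pair \<open>0 < i < j\<close>.\<close>

lemma tree_split_exists:
  assumes "r \<ge> 2"
  shows "\<exists>\<kappa> :: nat \<times> nat \<Rightarrow> nat \<times> nat. colour_respecting r \<kappa> \<and> tree_split r \<kappa>"
proof -
  let ?D = "half_edges r"
  define \<kappa> :: "nat \<times> nat \<Rightarrow> nat \<times> nat" where "\<kappa> = (\<lambda>(i, j). if i < j then (i, 0) else (i, j))"
  let ?G = "split_graph r \<kappa>"
  have res: "colour_respecting r \<kappa>" by (auto simp: colour_respecting_def \<kappa>_def split: if_splits)
  have edge: "{(j, i), (i, 0)} \<in> edges ?G" if "i < j" "j < r" for i j
  proof -
    have "(j, i) \<in> ?D" "{\<kappa> (j, i), \<kappa> (i, j)} = {(j, i), (i, 0)}"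
      using that by (auto simp: half_edges_def \<kappa>_def)
    then show ?thesis unfolding split_graph_edge_iff by metis
  qed
  have edgeD: "\<exists>i j. e = {(j, i), (i, 0)} \<and> i < j" if e_in: "e \<in> edges ?G" for e
  proof -
    obtain i j where "(i, j) \<in> ?D" and e: "e = {\<kappa> (i, j), \<kappa> (j, i)}"
      using e_in unfolding split_graph_edge_iff by blast
    then have ij: "i \<noteq> j" "e = {\<kappa> (i, j), \<kappa> (j, i)}" by (simp_all add: half_edges_def)
    show ?thesis
    proof (cases "i < j")
      case True
      then show ?thesis using ij by (intro exI[of _ i] exI[of _ j]) (auto simp: \<kappa>_def)
    next
      case False
      then show ?thesis using ij by (intro exI[of _ j] exI[of _ i]) (auto simp: \<kappa>_def)
    qed
  qed
  have vert: "v = (0, 0) \<or> (\<exists>i j. v = (j, i) \<and> i < j \<and> j < r)" if v: "v \<in> verts ?G" for v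
  proof -
    obtain a b where ab: "a < r" "b < r" "a \<noteq> b" "v = \<kappa> (a, b)"
      using v by (auto simp: split_graph_def half_edges_def)
    show ?thesis
    proof (cases "a < b")
      case True
      then have "v = (a, 0)" using ab by (simp add: \<kappa>_def)
      then show ?thesis using ab by (cases "a = 0") auto
    next
      case False
      then have "v = (a, b)" "b < a" using ab by (simp_all add: \<kappa>_def)
      then show ?thesis using ab by blast
    qed
  qed
  have acy: "acyclic_graph ?G"
  \<comment> \<open>The parent of \<open>(j, i)\<close> is \<open>(i, 0)\<close>: along every edge
    the first component strictly decreases towards the centre.\<close>
  proof (rule acyclic_parent_graph[where par = "\<lambda>(j, i). (i, 0)" and rank = fst])
    fix e assume "e \<in> edges ?G"
    then obtain i j where "e = {(j, i), (i, 0)}" "i < j" using edgeD by blast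
    then show "\<exists>v. e = {v, case v of (j, i) \<Rightarrow> (i, 0)} \<and> fst (case v of (j, i) \<Rightarrow> (i, 0)) < fst v"
      by (intro exI[of _ "(j, i)"]) simp
  qed
  have to0: "(v, (0, 0)) \<in> (adj ?G)\<^sup>* \<and> ((0, 0), v) \<in> (adj ?G)\<^sup>*" if v: "v \<in> verts ?G" for v
  proof (cases "v = (0, 0)")
    case False
    then obtain i j where ij: "v = (j, i)" "i < j" "j < r" using vert v by blast
    have step: "(v, (i, 0)) \<in> adj ?G" "((i, 0), v) \<in> adj ?G"
      using edge[OF ij(2,3)] ij(1) by (auto simp: insert_commute)
    show ?thesis
    proof (cases "i = 0")
      case True
      then show ?thesis using step by auto
    next
      case False
      then have "((i, 0), (0, 0)) \<in> adj ?G" "((0, 0), (i, 0)) \<in> adj ?G"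
        using edge[of 0 i] ij by (auto simp: insert_commute)
      then show ?thesis using step by (meson converse_rtrancl_into_rtrancl r_into_rtrancl)
    qed
  qed simp
  have "verts ?G \<noteq> {}"
  proof -
    have "0 \<in> fst ` ?D" using fst_half_edges[OF assms] assms by simp
    then show ?thesis by (auto simp: split_graph_def)
  qed
  moreover have "(u, v) \<in> (adj ?G)\<^sup>*" if "u \<in> verts ?G" "v \<in> verts ?G" for u v
    using to0[OF that(1)] to0[OF that(2)] by (meson rtrancl_trans)
  ultimately have "connected_graph ?G" unfolding connected_graph_def by blast
  then show ?thesis
    using res acy simple_split_graph[OF res] card_edges_split_graph[OF res]
    by (auto simp: tree_split_def k_tree_def)
qed

text \<open>Canonical form of a gluing pattern: a half-edge is sent to its own class. Patterns of
  maps into any vertex type thus become elements of one finite set.\<close>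

definition kernel_rep :: "nat \<Rightarrow> (nat \<times> nat \<Rightarrow> 'v) \<Rightarrow> nat \<times> nat \<Rightarrow> (nat \<times> nat) set" where
  "kernel_rep r \<phi> = restrict (\<lambda>d. {d' \<in> half_edges r. \<phi> d' = \<phi> d}) (half_edges r)"

text \<open>The fixed-point condition keeps one representative of each gluing pattern, so that sums
  over this set count every pattern once.\<close>

definition tree_kernels :: "nat \<Rightarrow> (nat \<times> nat \<Rightarrow> (nat \<times> nat) set) set" where
  "tree_kernels r = {\<kappa> \<in> half_edges r \<rightarrow>\<^sub>E Pow (half_edges r).
     kernel_rep r \<kappa> = \<kappa> \<and> colour_respecting r \<kappa> \<and> tree_split r \<kappa>}"

lemma finite_tree_kernels: "finite (tree_kernels r)"
  by (rule finite_subset[of _ "half_edges r \<rightarrow>\<^sub>E Pow (half_edges r)"])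
    (auto simp: tree_kernels_def finite_PiE finite_half_edges)

lemma kernel_rep_eq_iff:
  "d \<in> half_edges r \<Longrightarrow> d' \<in> half_edges r \<Longrightarrow> kernel_rep r \<phi> d = kernel_rep r \<phi> d' \<longleftrightarrow> \<phi> d = \<phi> d'"
  by (auto simp: kernel_rep_def)

lemma kernel_rep_cong:
  assumes "\<And>d d'. d \<in> half_edges r \<Longrightarrow> d' \<in> half_edges r \<Longrightarrow> \<phi> d = \<phi> d' \<longleftrightarrow> \<psi> d = \<psi> d'"
  shows "kernel_rep r \<phi> = kernel_rep r \<psi>"
  unfolding kernel_rep_def using assms by (intro restrict_ext) auto

lemma kernel_rep_tree_kernels:
  assumes "colour_respecting r \<phi>" "tree_split r \<phi>"
  shows "kernel_rep r \<phi> \<in> tree_kernels r"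
proof -
  have "colour_respecting r (kernel_rep r \<phi>)"
    by (rule colour_respectingI) (metis kernel_rep_eq_iff colour_respectingD[OF assms(1)])
  moreover from this have "tree_split r (kernel_rep r \<phi>)"
    by (rule tree_split_kernel[OF assms(2)]) (simp add: kernel_rep_eq_iff)
  moreover have "kernel_rep r (kernel_rep r \<phi>) = kernel_rep r \<phi>"
    by (rule kernel_rep_cong) (simp add: kernel_rep_eq_iff)
  moreover have "kernel_rep r \<phi> \<in> half_edges r \<rightarrow>\<^sub>E Pow (half_edges r)"
    by (auto simp: kernel_rep_def)
  ultimately show ?thesis by (simp add: tree_kernels_def)
qed

text \<open>One tree pattern is enough to make the normalising factor nonzero.\<close>

lemma tree_kernels_nonempty: "r \<ge> 2 \<Longrightarrow> tree_kernels r \<noteq> {}"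
  using tree_split_exists[of r] kernel_rep_tree_kernels by blast

text \<open>The classes are the vertices of a tree with \<open>num_pairs r\<close> edges. That their
  number is the same for all patterns gives the counting polynomials a common sign at
  \<open>0\<close>.\<close>

lemma card_tree_kernel_image:
  assumes "\<kappa> \<in> tree_kernels r"
  shows "card (\<kappa> ` half_edges r) = Suc (num_pairs r)"
  using assms card_verts_k_tree[of "num_pairs r" "split_graph r \<kappa>"]
  by (simp add: tree_kernels_def tree_split_def split_graph_def)

text \<open>The copy assignments \<open>l\<close> are sorted by the gluing pattern of the vertices
  \<open>(fst d, h d, l d)\<close>.\<close>

lemma card_tree_splits:
  "card {l \<in> half_edges r \<rightarrow>\<^sub>E {..<t}. tree_split r (\<lambda>d. (fst d, h d, l d))} =
    (\<Sum>\<kappa>\<in>tree_kernels r. card (copies (half_edges r) (\<lambda>d. (fst d, h d)) \<kappa> t))"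
  (is "card ?L = _")
proof -
  let ?D = "half_edges r"
  let ?\<phi> = "\<lambda>l d. (fst d, h d, l d)"
  let ?C = "\<lambda>\<kappa>. copies ?D (\<lambda>d. (fst d, h d)) \<kappa> t"
  have res: "colour_respecting r (?\<phi> l)" for l :: "nat \<times> nat \<Rightarrow> nat"
    by (simp add: colour_respecting_def)
  have C: "l \<in> ?C \<kappa> \<longleftrightarrow> l \<in> ?D \<rightarrow>\<^sub>E {..<t} \<and> kernel_rep r (?\<phi> l) = \<kappa>" if "\<kappa> \<in> tree_kernels r" for l \<kappa>
  proof
    assume l: "l \<in> ?C \<kappa>"
    have "kernel_rep r (?\<phi> l) = kernel_rep r \<kappa>"
      by (rule kernel_rep_cong) (use l in \<open>auto simp: copies_def\<close>)
    then show "l \<in> ?D \<rightarrow>\<^sub>E {..<t} \<and> kernel_rep r (?\<phi> l) = \<kappa>"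
      using l that by (simp add: copies_def tree_kernels_def)
  next
    assume l: "l \<in> ?D \<rightarrow>\<^sub>E {..<t} \<and> kernel_rep r (?\<phi> l) = \<kappa>"
    then show "l \<in> ?C \<kappa>"
      using kernel_rep_eq_iff[of _ r _ "?\<phi> l"] by (intro copiesI) auto
  qed
  have L: "?L = (\<Union>\<kappa>\<in>tree_kernels r. ?C \<kappa>)"
  proof (intro equalityI subsetI)
    fix l assume "l \<in> ?L"
    then show "l \<in> (\<Union>\<kappa>\<in>tree_kernels r. ?C \<kappa>)"
      using kernel_rep_tree_kernels[OF res, of l] C by auto
  next
    fix l assume "l \<in> (\<Union>\<kappa>\<in>tree_kernels r. ?C \<kappa>)"
    then obtain \<kappa> where k: "\<kappa> \<in> tree_kernels r" "l \<in> ?C \<kappa>" by blast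
    then have l: "l \<in> ?D \<rightarrow>\<^sub>E {..<t}" "kernel_rep r (?\<phi> l) = \<kappa>" using C by auto
    have "tree_split r \<kappa>" using k(1) by (simp add: tree_kernels_def)
    moreover have "\<kappa> d = \<kappa> d' \<longleftrightarrow> ?\<phi> l d = ?\<phi> l d'" if "d \<in> ?D" "d' \<in> ?D" for d d'
      using kernel_rep_eq_iff[OF that, of "?\<phi> l"] unfolding l(2) .
    ultimately have "tree_split r (?\<phi> l)" by (rule tree_split_kernel[OF _ res])
    then show "l \<in> ?L" using l by simp
  qed
  have "?C \<kappa> \<inter> ?C \<kappa>' = {}" if "\<kappa> \<in> tree_kernels r" "\<kappa>' \<in> tree_kernels r" "\<kappa> \<noteq> \<kappa>'" for \<kappa> \<kappa>'
  proof (rule ccontr)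
    assume "?C \<kappa> \<inter> ?C \<kappa>' \<noteq> {}"
    then obtain l where "l \<in> ?C \<kappa>" "l \<in> ?C \<kappa>'" by blast
    then have "kernel_rep r (?\<phi> l) = \<kappa>" "kernel_rep r (?\<phi> l) = \<kappa>'"
      by (simp_all only: C[OF that(1)] C[OF that(2)])
    then show False using that(3) by simp
  qed
  then show ?thesis
    unfolding L using finite_tree_kernels finite_copies[OF finite_half_edges]
    by (intro card_UN_disjoint) blast+
qed

section \<open>Extracting the number of cliques\<close>

text \<open>Adjacency is a predicate so that the input graph and the complete graph, where it is
  \<open>(\<noteq>)\<close>, are treated alike.\<close>

definition cliques :: "nat \<Rightarrow> nat \<Rightarrow> (nat \<Rightarrow> nat \<Rightarrow> bool) \<Rightarrow> nat set set" where
  "cliques r n A =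
    {S. S \<subseteq> {..<n} \<and> card S = r \<and> (\<forall>u\<in>S. \<forall>v\<in>S. u \<noteq> v \<longrightarrow> A u v)}"

text \<open>Every pair of colours chooses an edge on its own; half-edges of one colour may still
  land on different vertices.\<close>

definition half_edge_maps :: "nat \<Rightarrow> nat \<Rightarrow> (nat \<Rightarrow> nat \<Rightarrow> bool) \<Rightarrow> (nat \<times> nat \<Rightarrow> nat) set" where
  "half_edge_maps r n A =
    {h \<in> half_edges r \<rightarrow>\<^sub>E {..<n}. \<forall>(i, j)\<in>half_edges r. A (h (i, j)) (h (j, i))}"

text \<open>Within \<open>half_edge_maps\<close> these are the homomorphisms of the complete graph
  on the colours.\<close>

definition vertex_map :: "nat \<Rightarrow> (nat \<times> nat \<Rightarrow> nat) \<Rightarrow> bool" where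
  "vertex_map r h \<longleftrightarrow> (\<forall>d\<in>half_edges r. \<forall>d'\<in>half_edges r. fst d = fst d' \<longrightarrow> h d = h d')"

lemma finite_half_edge_maps: "finite (half_edge_maps r n A)"
  by (rule finite_subset[of _ "half_edges r \<rightarrow>\<^sub>E {..<n}"])
    (auto simp: half_edge_maps_def finite_PiE finite_half_edges)

lemma finite_cliques: "finite (cliques r n A)"
  by (rule finite_subset[of _ "Pow {..<n}"]) (auto simp: cliques_def)

lemma card_distinct_lists_onto:
  assumes "finite S"
  shows "card {xs. distinct xs \<and> set xs = S} = fact (card S)"
proof -
  have "{xs. distinct xs \<and> set xs = S} = {xs. length xs = card S \<and> distinct xs \<and> set xs \<subseteq> S}"
    by (auto simp: distinct_card[symmetric] dest: card_subset_eq[OF assms])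
  then show ?thesis
    using card_lists_distinct_length_eq[OF assms, of "card S"] by (simp add: fact_prod)
qed

text \<open>Irreflexivity makes the images of different colours distinct, so the maps are the
  orderings of \<open>r\<close>-cliques.\<close>

lemma card_vertex_maps:
  assumes r: "r \<ge> 2" and irr: "\<And>u. \<not> A u u"
  shows "card {h \<in> half_edge_maps r n A. vertex_map r h} = fact r * card (cliques r n A)"
proof -
  let ?D = "half_edges r"
  let ?X = "\<Union>S\<in>cliques r n A. {xs. distinct xs \<and> set xs = S}"
  let ?f = "\<lambda>xs. restrict (\<lambda>(i, j). xs ! i) ?D"
  \<comment> \<open>The vertex of colour \<open>i\<close> is read off at one half-edge of that
    colour. The second index only has to differ from \<open>i\<close> and lie below
    \<open>r\<close>, which is possible as \<open>r \<ge> 2\<close>.\<close>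
  define g where "g h = map (\<lambda>i. h (i, if i = 0 then 1 else 0)) [0..<r]" for h :: "nat \<times> nat \<Rightarrow> nat"
  have g_nth: "g h ! i = h (i, j)" if "vertex_map r h" "(i, j) \<in> ?D" for h i j
  proof -
    have i: "i < r" using that by (simp add: half_edges_def)
    then have "(i, if i = 0 then 1 else 0) \<in> ?D" using r by (simp add: half_edges_def)
    then have "h (i, if i = 0 then 1 else 0) = h (i, j)"
      using that unfolding vertex_map_def by (metis fst_conv)
    then show ?thesis using i by (simp add: g_def)
  qed
  have "bij_betw ?f ?X {h \<in> half_edge_maps r n A. vertex_map r h}"
  proof (rule bij_betwI[where g = g])
    show "?f \<in> ?X \<rightarrow> {h \<in> half_edge_maps r n A. vertex_map r h}"
    proof
      fix xs assume "xs \<in> ?X"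
      then have xs: "distinct xs" "set xs \<subseteq> {..<n}" "card (set xs) = r"
        "\<And>u v. u \<in> set xs \<Longrightarrow> v \<in> set xs \<Longrightarrow> u \<noteq> v \<Longrightarrow> A u v"
        by (auto simp: cliques_def)
      have len: "length xs = r" using xs distinct_card by metis
      have "?f xs \<in> ?D \<rightarrow>\<^sub>E {..<n}"
        using len xs(2) by (auto simp: half_edges_def subset_iff)
      moreover have "A (?f xs (i, j)) (?f xs (j, i))" if "(i, j) \<in> ?D" for i j
      proof -
        have "(j, i) \<in> ?D" "i < r" "j < r" "i \<noteq> j" using that by (auto simp: half_edges_def)
        then show ?thesis using that len xs(1) by (simp add: xs(4) nth_eq_iff_index_eq)
      qed
      moreover have "vertex_map r (?f xs)" by (auto simp: vertex_map_def)
      ultimately show "?f xs \<in> {h \<in> half_edge_maps r n A. vertex_map r h}"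
        unfolding half_edge_maps_def by blast
    qed
    show "g \<in> {h \<in> half_edge_maps r n A. vertex_map r h} \<rightarrow> ?X"
    proof
      fix h assume "h \<in> {h \<in> half_edge_maps r n A. vertex_map r h}"
      then have h: "h \<in> ?D \<rightarrow>\<^sub>E {..<n}" "\<And>i j. (i, j) \<in> ?D \<Longrightarrow> A (h (i, j)) (h (j, i))"
        and v: "vertex_map r h" by (auto simp: half_edge_maps_def)
      have A: "A (g h ! i) (g h ! j)" if "i < r" "j < r" "i \<noteq> j" for i j
      proof -
        have "(i, j) \<in> ?D" "(j, i) \<in> ?D" using that by (auto simp: half_edges_def)
        then show ?thesis using h(2) by (simp add: g_nth[OF v])
      qed
      have len: "length (g h) = r" by (simp add: g_def)
      have "distinct (g h)" unfolding distinct_conv_nth len using A irr by metis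
      moreover from this have "card (set (g h)) = r" using distinct_card len by metis
      moreover have "A u v" if "u \<in> set (g h)" "v \<in> set (g h)" "u \<noteq> v" for u v
        using that A len by (metis in_set_conv_nth)
      moreover have "set (g h) \<subseteq> {..<n}"
      proof
        fix u assume "u \<in> set (g h)"
        then obtain i where i: "i < r" "u = g h ! i" using len by (auto simp: in_set_conv_nth)
        have "(i, if i = 0 then 1 else 0) \<in> ?D" using r i by (simp add: half_edges_def)
        then show "u \<in> {..<n}" using h(1) g_nth[OF v] i by (metis PiE_mem)
      qed
      ultimately show "g h \<in> ?X" by (auto simp: cliques_def)
    qed
  next
    fix xs assume "xs \<in> ?X"
    then have "length xs = r" by (auto simp: cliques_def dest: distinct_card)
    then show "g (?f xs) = xs"
      using r by (intro nth_equalityI) (auto simp: g_def half_edges_def)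
  next
    fix h assume "h \<in> {h \<in> half_edge_maps r n A. vertex_map r h}"
    then have h: "h \<in> ?D \<rightarrow>\<^sub>E {..<n}" and v: "vertex_map r h" by (auto simp: half_edge_maps_def)
    show "?f (g h) = h"
    proof
      fix d show "?f (g h) d = h d"
        using g_nth[OF v] PiE_arb[OF h] by (cases d) (auto simp: restrict_def)
    qed
  qed
  then have "card {h \<in> half_edge_maps r n A. vertex_map r h} = card ?X"
    by (rule bij_betw_same_card[symmetric])
  also have "\<dots> = (\<Sum>S\<in>cliques r n A. card {xs. distinct xs \<and> set xs = S})"
  proof (rule card_UN_disjoint[OF finite_cliques])
    show "\<forall>S\<in>cliques r n A. finite {xs. distinct xs \<and> set xs = S}"
    proof
      fix S assume "S \<in> cliques r n A"
      then have "finite S" by (auto simp: cliques_def intro: finite_subset)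
      then have "finite {xs. set xs \<subseteq> S \<and> distinct xs}" by (rule finite_subset_distinct)
      then show "finite {xs. distinct xs \<and> set xs = S}" by (rule rev_finite_subset) auto
    qed
  qed auto
  also have "\<dots> = (\<Sum>S\<in>cliques r n A. fact r)"
  proof (intro sum.cong refl)
    fix S assume "S \<in> cliques r n A"
    then have "finite S" "card S = r" by (auto simp: cliques_def intro: finite_subset)
    then show "card {xs. distinct xs \<and> set xs = S} = fact r"
      using card_distinct_lists_onto by metis
  qed
  finally show ?thesis by simp
qed

text \<open>A rainbow tree is recorded by the vertex and the copy at each half-edge;
  \<open>card_rainbow_tree_sets\<close> relates these pairs to subtrees of the queried
  graph.\<close>

definition num_rainbow_trees :: "nat \<Rightarrow> nat \<Rightarrow> (nat \<Rightarrow> nat \<Rightarrow> bool) \<Rightarrow> nat \<Rightarrow> nat" where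
  "num_rainbow_trees r n A t = card {(h, l). h \<in> half_edge_maps r n A \<and>
     l \<in> half_edges r \<rightarrow>\<^sub>E {..<t} \<and> tree_split r (\<lambda>d. (fst d, h d, l d))}"

lemma num_rainbow_trees_eq:
  "num_rainbow_trees r n A t = (\<Sum>h\<in>half_edge_maps r n A. \<Sum>\<kappa>\<in>tree_kernels r.
     card (copies (half_edges r) (\<lambda>d. (fst d, h d)) \<kappa> t))"
proof -
  have eq: "{(h, l). h \<in> half_edge_maps r n A \<and> l \<in> half_edges r \<rightarrow>\<^sub>E {..<t} \<and>
      tree_split r (\<lambda>d. (fst d, h d, l d))} = (SIGMA h:half_edge_maps r n A.
      {l \<in> half_edges r \<rightarrow>\<^sub>E {..<t}. tree_split r (\<lambda>d. (fst d, h d, l d))})" by auto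
  have "finite {l \<in> half_edges r \<rightarrow>\<^sub>E {..<t}. tree_split r (\<lambda>d. (fst d, h d, l d))}" for h
    by (simp add: finite_PiE finite_half_edges)
  then have "num_rainbow_trees r n A t = (\<Sum>h\<in>half_edge_maps r n A.
      card {l \<in> half_edges r \<rightarrow>\<^sub>E {..<t}. tree_split r (\<lambda>d. (fst d, h d, l d))})"
    unfolding num_rainbow_trees_def eq using finite_half_edge_maps by (intro card_SigmaI) blast+
  then show ?thesis by (simp only: card_tree_splits)
qed

text \<open>Here \<open>\<tau> = fst\<close> takes \<open>r\<close> values: \<open>r\<close> of the
  \<open>num_pairs r + 1\<close> linear factors go into \<open>t ^ r\<close>, and the others fix the
  sign at \<open>0\<close>.\<close>

lemma card_copies_vertex_map:
  assumes r: "r \<ge> 2" and k: "\<kappa> \<in> tree_kernels r"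
  shows "\<exists>Q c. poly_below (Suc (num_pairs r)) Q \<and> c > 0 \<and>
    Q 0 = (-1) ^ (Suc (num_pairs r) - r) * c \<and>
    (\<forall>t. int (card (copies (half_edges r) fst \<kappa> t)) = int t ^ r * Q (int t))"
proof -
  have "colour_respecting r \<kappa>" using k by (simp add: tree_kernels_def)
  then obtain Q c where Q: "poly_below (Suc (Suc (num_pairs r) - r)) Q" "c > 0"
    "Q 0 = (-1) ^ (Suc (num_pairs r) - r) * c"
    "\<forall>t. int (card (copies (half_edges r) fst \<kappa> t)) = int t ^ r * Q (int t)"
    using card_copies_poly[OF finite_half_edges, of r \<kappa> fst] colour_respectingD[of r \<kappa>]
    unfolding fst_half_edges[OF r] card_tree_kernel_image[OF k] card_lessThan by blast
  have "Suc (Suc (num_pairs r) - r) \<le> Suc (num_pairs r)" using r by simp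
  from poly_below_mono[OF this Q(1)] Q(2-4) show ?thesis by blast
qed

text \<open>More than \<open>r\<close> pairs of colour and vertex occur, so beyond
  \<open>t ^ r\<close> a factor \<open>t\<close> remains and kills the value at
  \<open>0\<close>.\<close>

lemma card_copies_non_vertex_map:
  assumes r: "r \<ge> 2" and k: "\<kappa> \<in> tree_kernels r" and h: "\<not> vertex_map r h"
  shows "\<exists>Q. poly_below (Suc (num_pairs r)) Q \<and> Q 0 = 0 \<and>
    (\<forall>t. int (card (copies (half_edges r) (\<lambda>d. (fst d, h d)) \<kappa> t)) = int t ^ r * Q (int t))"
proof (cases "\<exists>d\<in>half_edges r. \<exists>d'\<in>half_edges r. \<kappa> d = \<kappa> d' \<and> (fst d, h d) \<noteq> (fst d', h d')")
  case True
  then obtain d d' where d: "d \<in> half_edges r" "d' \<in> half_edges r" "\<kappa> d = \<kappa> d'"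
    "(fst d, h d) \<noteq> (fst d', h d')" by blast
  \<comment> \<open>\<open>\<kappa>\<close> glues half-edges that sit at different vertices, so
    nothing is counted and the zero polynomial serves.\<close>
  have "copies (half_edges r) (\<lambda>d. (fst d, h d)) \<kappa> t = {}" for t
    using copiesD[of _ _ _ \<kappa> t, OF _ d(1,2)] d(3,4) by blast
  then show ?thesis by (intro exI[of _ "\<lambda>x. 0"]) (simp add: poly_below_zero del: poly_below.simps)
next
  case False
  let ?D = "half_edges r"
  let ?\<tau> = "\<lambda>d. (fst d, h d)"
  define m where "m = card (?\<tau> ` ?D)"
  have ref: "\<kappa> d = \<kappa> d' \<Longrightarrow> ?\<tau> d = ?\<tau> d'" if "d \<in> ?D" "d' \<in> ?D" for d d'
    using False that by blast
  obtain Q where Q: "m \<le> Suc (num_pairs r)" "poly_below (Suc (Suc (num_pairs r) - m)) Q"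
    "\<forall>t. int (card (copies ?D ?\<tau> \<kappa> t)) = int t ^ m * Q (int t)"
    using card_copies_poly[OF finite_half_edges, of r \<kappa> ?\<tau>] ref
    unfolding card_tree_kernel_image[OF k] m_def by blast
  have "m \<ge> r"
    using card_image_le[of "?\<tau> ` ?D" fst] finite_half_edges[of r] fst_half_edges[OF r]
    by (simp add: image_image m_def)
  moreover have "m \<noteq> r"
  proof
    \<comment> \<open>Only \<open>r\<close> pairs over \<open>r\<close> colours would mean one
      vertex for each colour, against the choice of \<open>h\<close>.\<close>
    assume "m = r"
    then have "card (fst ` ?\<tau> ` ?D) = card (?\<tau> ` ?D)"
      using fst_half_edges[OF r] by (simp add: image_image m_def)
    then have inj: "inj_on fst (?\<tau> ` ?D)"
      using finite_half_edges by (intro eq_card_imp_inj_on) auto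
    have "h d = h d'" if "d \<in> ?D" "d' \<in> ?D" "fst d = fst d'" for d d'
      using inj_onD[OF inj _ imageI[OF that(1)] imageI[OF that(2)]] that(3) by simp
    then show False using h unfolding vertex_map_def by blast
  qed
  ultimately have m: "m > r" by simp
  have "poly_below (Suc (Suc (num_pairs r) - m) + (m - r)) (\<lambda>x. x ^ (m - r) * Q x)"
    by (rule poly_below_mult_power[OF Q(2)])
  moreover have "Suc (Suc (num_pairs r) - m) + (m - r) \<le> Suc (num_pairs r)" using Q(1) m r by simp
  ultimately have "poly_below (Suc (num_pairs r)) (\<lambda>x. x ^ (m - r) * Q x)"
    using poly_below_mono by blast
  moreover have "int t ^ m = int t ^ r * int t ^ (m - r)" for t
    using m by (simp flip: power_add)
  ultimately show ?thesis
    using Q(3) m by (intro exI[of _ "\<lambda>x. x ^ (m - r) * Q x"]) (simp del: poly_below.simps)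
qed

text \<open>\<open>w\<close> is \<open>fact r\<close> times the sum, over all tree patterns, of the
  values at \<open>0\<close> of the polynomials for vertex maps. It depends neither on
  \<open>n\<close> nor on \<open>A\<close>, which is what allows it to be cancelled later.\<close>

lemma cliques_from_rainbow_trees:
  assumes r: "r \<ge> 2"
  shows "\<exists>w :: int. w \<noteq> 0 \<and> (\<forall>n A. (\<forall>u. \<not> A u u) \<longrightarrow>
    (\<Sum>j = 1..Suc (num_pairs r). (-1) ^ (j + 1) * int (Suc (num_pairs r) choose j) *
      int (num_rainbow_trees r n A j div j ^ r)) = w * int (card (cliques r n A)))"
proof -
  let ?D = "half_edges r"
  let ?d = "Suc (num_pairs r)"
  let ?s = "(-1 :: int) ^ (Suc (num_pairs r) - r)"
  obtain Q c where Q: "\<And>\<kappa>. \<kappa> \<in> tree_kernels r \<Longrightarrow> poly_below ?d (Q \<kappa>)"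
    "\<And>\<kappa>. \<kappa> \<in> tree_kernels r \<Longrightarrow> c \<kappa> > 0" "\<And>\<kappa>. \<kappa> \<in> tree_kernels r \<Longrightarrow> Q \<kappa> 0 = ?s * c \<kappa>"
    "\<And>\<kappa> t. \<kappa> \<in> tree_kernels r \<Longrightarrow> int (card (copies ?D fst \<kappa> t)) = int t ^ r * Q \<kappa> (int t)"
    using card_copies_vertex_map[OF r] by metis
  define w where "w = fact r * (\<Sum>\<kappa>\<in>tree_kernels r. Q \<kappa> 0)"
  have "(\<Sum>\<kappa>\<in>tree_kernels r. c \<kappa>) > 0"
    using Q(2) tree_kernels_nonempty[OF r] finite_tree_kernels by (intro sum_pos) auto
  \<comment> \<open>All summands carry the common sign \<open>?s\<close>, so the sum cannot
    vanish.\<close>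
  moreover have "(\<Sum>\<kappa>\<in>tree_kernels r. Q \<kappa> 0) = ?s * (\<Sum>\<kappa>\<in>tree_kernels r. c \<kappa>)"
    using Q(3) by (simp add: sum_distrib_left)
  ultimately have "w \<noteq> 0" by (simp add: w_def)
  moreover have "(\<Sum>j = 1..?d. (-1) ^ (j + 1) * int (?d choose j) *
      int (num_rainbow_trees r n A j div j ^ r)) = w * int (card (cliques r n A))"
    if irr: "\<And>u. \<not> A u u" for n A
  proof -
    define P where "P h \<kappa> R \<longleftrightarrow> poly_below ?d R \<and> R 0 = (if vertex_map r h then Q \<kappa> 0 else 0) \<and>
        (\<forall>t. int (card (copies ?D (\<lambda>d. (fst d, h d)) \<kappa> t)) = int t ^ r * R (int t))" for h \<kappa> R
    have ex_P: "\<exists>R. P h \<kappa> R" if k: "\<kappa> \<in> tree_kernels r" for h \<kappa>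
    proof (cases "vertex_map r h")
      case True
      have "copies ?D (\<lambda>d. (fst d, h d)) \<kappa> t = copies ?D fst \<kappa> t" for t
      proof -
        have "(fst d, h d) = (fst d', h d') \<longleftrightarrow> fst d = fst d'" if "d \<in> ?D" "d' \<in> ?D" for d d'
          using True that unfolding vertex_map_def by (metis prod.inject)
        then show ?thesis unfolding copies_def by (intro Collect_cong conj_cong ball_cong refl) simp
      qed
      then show ?thesis using Q[OF k] True by (intro exI[of _ "Q \<kappa>"]) (simp add: P_def)
    next
      case False
      then show ?thesis using card_copies_non_vertex_map[OF r k] by (simp add: P_def)
    qed
    define R where "R h \<kappa> = (SOME R. P h \<kappa> R)" for h \<kappa>
    have "P h \<kappa> (R h \<kappa>)" if "\<kappa> \<in> tree_kernels r" for h \<kappa>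
      unfolding R_def by (rule someI_ex[OF ex_P[OF that]])
    then have R: "\<And>h \<kappa>. \<kappa> \<in> tree_kernels r \<Longrightarrow> poly_below ?d (R h \<kappa>)"
      "\<And>h \<kappa>. \<kappa> \<in> tree_kernels r \<Longrightarrow> R h \<kappa> 0 = (if vertex_map r h then Q \<kappa> 0 else 0)"
      "\<And>h \<kappa> t. \<kappa> \<in> tree_kernels r \<Longrightarrow>
        int (card (copies ?D (\<lambda>d. (fst d, h d)) \<kappa> t)) = int t ^ r * R h \<kappa> (int t)"
      by (simp_all add: P_def)
    define S where "S x = (\<Sum>h\<in>half_edge_maps r n A. \<Sum>\<kappa>\<in>tree_kernels r. R h \<kappa> x)" for x
    have "poly_below ?d S"
      unfolding S_def using R(1) by (intro poly_below_sum) simp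
    from poly_below_extrapolate[OF this]
    have ex: "(\<Sum>j = 1..?d. (-1) ^ (j + 1) * int (?d choose j) * S (int j)) = S 0" .
    have num: "int (num_rainbow_trees r n A t) = int t ^ r * S (int t)" for t
      by (simp add: num_rainbow_trees_eq S_def sum_distrib_left R(3))
    \<comment> \<open>The division is exact, and \<open>j \<ge> 1\<close> keeps the divisor
      positive.\<close>
    have "int (num_rainbow_trees r n A j div j ^ r) = S (int j)" if "j \<ge> 1" for j
      using that num[of j] by (simp add: zdiv_int)
    then have "(\<Sum>j = 1..?d. (-1) ^ (j + 1) * int (?d choose j) *
        int (num_rainbow_trees r n A j div j ^ r)) = S 0"
      unfolding ex[symmetric] by (intro sum.cong refl) simp
    also have "S 0 = (\<Sum>h\<in>half_edge_maps r n A.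
        if vertex_map r h then (\<Sum>\<kappa>\<in>tree_kernels r. Q \<kappa> 0) else 0)"
      unfolding S_def by (intro sum.cong refl) (simp add: R(2))
    also have "\<dots> = w * int (card (cliques r n A))"
      using card_vertex_maps[of r A n, OF r irr] finite_half_edge_maps
      by (simp add: w_def sum.If_cases Int_def)
    finally show ?thesis .
  qed
  ultimately show ?thesis by blast
qed

section \<open>The queried graphs\<close>

text \<open>Position of a pair in the lower triangle of an adjacency matrix, as in
  \<open>decode\<close>. It serves for pairs of colours as well as for pairs of input
  vertices.\<close>

definition pair_index :: "nat \<Rightarrow> nat \<Rightarrow> nat" where
  "pair_index a b = max a b * (max a b - 1) div 2 + min a b"

text \<open>The vertex \<open>i + r * (u + n * c)\<close> stands for the \<open>c\<close>-th copy of \<open>u\<close> in colour class \<open>i\<close>;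
  the number \<open>S\<close> encodes a set of pairs of colours.\<close>

definition query_graph ::
    "nat \<Rightarrow> nat \<Rightarrow> (nat \<Rightarrow> nat \<Rightarrow> bool) \<Rightarrow> nat \<Rightarrow> nat \<Rightarrow> nat graph" where
  "query_graph r n A t S = ({..<r * n * t}, {{I, J} | I J. J < I \<and> I < r * n * t \<and>
     I mod r \<noteq> J mod r \<and> pair_index (I mod r) (J mod r) \<in> set_decode S \<and>
     A (I div r mod n) (J div r mod n)})"

lemma pair_index_commute: "pair_index a b = pair_index b a"
  by (simp add: pair_index_def max.commute min.commute)

text \<open>Listing all pairs in triangle order and reading the list at an index recovers the
  pair.\<close>

lemma triangle_index_inject:
  fixes i j i' j' :: nat
  assumes "i < r" "j < i" "i' < r" "j' < i'"
    and "i * (i - 1) div 2 + j = i' * (i' - 1) div 2 + j'"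
  shows "i = i' \<and> j = j'"
proof -
  have "(i, j) = (i', j')"
    using nth_triangle(2)[OF assms(2,1), of Pair] nth_triangle(2)[OF assms(4,3), of Pair]
    unfolding assms(5) by (rule trans[OF sym])
  then show ?thesis by simp
qed

lemma pair_index_inject:
  assumes "a < r" "b < r" "a \<noteq> b" "a' < r" "b' < r" "a' \<noteq> b'"
    and "pair_index a b = pair_index a' b'"
  shows "{a, b} = {a', b'}"
proof -
  have "max a b = max a' b' \<and> min a b = min a' b'"
  proof (rule triangle_index_inject)
    show "max a b < r" "max a' b' < r" using assms by simp_all
    show "min a b < max a b" "min a' b' < max a' b'" using assms by (simp_all add: min_def max_def)
  qed (use assms in \<open>simp add: pair_index_def\<close>)
  then show ?thesis by (auto simp: max_def min_def split: if_splits)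
qed

lemma pair_index_less:
  assumes "a < r" "b < r" "a \<noteq> b"
  shows "pair_index a b < num_pairs r"
  using nth_triangle(1)[of "min a b" "max a b" r Pair] assms
  unfolding length_triangle pair_index_def by auto

lemma pair_index_image:
  "(\<lambda>(i, j). pair_index i j) ` (SIGMA i:{..<r}. {..<i}) = {..<num_pairs r}"
proof (rule card_subset_eq)
  show "(\<lambda>(i, j). pair_index i j) ` (SIGMA i:{..<r}. {..<i}) \<subseteq> {..<num_pairs r}"
    using pair_index_less by auto
  have "inj_on (\<lambda>(i, j). pair_index i j) (SIGMA i:{..<r}. {..<i})"
  proof (rule inj_onI, clarify)
    fix i j i' j' assume "i < r" "j < i" "i' < r" "j' < i'" "pair_index i j = pair_index i' j'"
    then show "i = i' \<and> j = j'"
      using triangle_index_inject[of i r j i' j'] by (simp add: pair_index_def max_def min_def)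
  qed
  then show "card ((\<lambda>(i, j). pair_index i j) ` (SIGMA i:{..<r}. {..<i})) = card {..<num_pairs r}"
    by (simp only: card_image card_triangle card_lessThan)
qed simp

lemma set_decode_subset_iff: "set_decode S \<subseteq> {..<k} \<longleftrightarrow> S < 2 ^ k"
proof
  assume "set_decode S \<subseteq> {..<k}"
  then have "(\<Sum>i\<in>set_decode S. 2 ^ i) \<le> (\<Sum>i<k. (2 :: nat) ^ i)" by (intro sum_mono2) auto
  also have "\<dots> < 2 ^ k" by (induction k) auto
  finally show "S < 2 ^ k" using set_decode_inverse[of S] by (simp add: set_encode_def)
next
  assume S: "S < 2 ^ k"
  show "set_decode S \<subseteq> {..<k}"
  proof
    fix i assume "i \<in> set_decode S"
    then have "odd (S div 2 ^ i)" by (simp add: set_decode_def)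
    then have "S div 2 ^ i \<noteq> 0" by (metis even_zero)
    then have "2 ^ i \<le> S" by (simp add: div_eq_0_iff not_less)
    then have "(2 :: nat) ^ i < 2 ^ k" using S by linarith
    then show "i \<in> {..<k}" by simp
  qed
qed

lemma bij_betw_set_decode: "bij_betw set_decode {..<2 ^ k} (Pow {..<k})"
proof (rule bij_betwI[where g = set_encode])
  show "set_decode \<in> {..<2 ^ k} \<rightarrow> Pow {..<k}" using set_decode_subset_iff by blast
  show "set_encode \<in> Pow {..<k} \<rightarrow> {..<2 ^ k}"
  proof
    fix B assume "B \<in> Pow {..<k}"
    moreover from this have "finite B" by (auto intro: finite_subset)
    ultimately show "set_encode B \<in> {..<2 ^ k}"
      using set_decode_subset_iff[of "set_encode B" k] by simp
  qed
next
  fix B assume "B \<in> Pow {..<k}"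
  then have "finite B" by (auto intro: finite_subset)
  then show "set_decode (set_encode B) = B" by simp
qed simp

section \<open>Rainbow trees in the blown-up graph and inclusion-exclusion\<close>

context
  fixes r n t :: nat and A :: "nat \<Rightarrow> nat \<Rightarrow> bool"
  assumes r: "r \<ge> 2" and A_sym: "\<And>u v. A u v \<Longrightarrow> A v u"
begin

private abbreviation "D \<equiv> half_edges r"
private abbreviation "k \<equiv> num_pairs r"

private definition all_edges :: "nat set set" where
  "all_edges = {{I, J} | I J. I < r * n * t \<and> J < r * n * t \<and> I mod r \<noteq> J mod r \<and>
     A (I div r mod n) (J div r mod n)}"

text \<open>Maximum and minimum of the end colours make this a function of the edge as an unordered
  set.\<close>

private definition edge_colour :: "nat set \<Rightarrow> nat" where
  "edge_colour e = pair_index (Max ((\<lambda>I. I mod r) ` e)) (Min ((\<lambda>I. I mod r) ` e))"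

private lemma edge_colour: "edge_colour {I, J} = pair_index (I mod r) (J mod r)"
  by (auto simp: edge_colour_def pair_index_def max_def min_def)

private lemma all_edgesE:
  assumes "e \<in> all_edges"
  obtains I J where "e = {I, J}" "J < I" "I < r * n * t" "I mod r \<noteq> J mod r"
    "A (I div r mod n) (J div r mod n)"
proof -
  from assms obtain I J where IJ: "e = {I, J}" "I < r * n * t" "J < r * n * t" "I mod r \<noteq> J mod r"
     "A (I div r mod n) (J div r mod n)" by (auto simp: all_edges_def)
  show thesis
  proof (cases "J < I")
    case True
    then show ?thesis using that[of I J] IJ by simp
  next
    case False
    then have "I < J" using IJ(4) by (metis linorder_neqE_nat)
    then show ?thesis using that[of J I] IJ A_sym by (simp add: insert_commute)
  qed
qed

private lemma edges_query_graph:
  "edges (query_graph r n A t S) = {e \<in> all_edges. edge_colour e \<in> set_decode S}"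
proof (intro equalityI subsetI)
  fix e assume "e \<in> edges (query_graph r n A t S)"
  then obtain I J where e: "e = {I, J}" "J < I" "I < r * n * t" "I mod r \<noteq> J mod r"
    "pair_index (I mod r) (J mod r) \<in> set_decode S" "A (I div r mod n) (J div r mod n)"
    by (auto simp: query_graph_def)
  then have "e \<in> all_edges"
    unfolding all_edges_def by (intro CollectI exI[of _ I] exI[of _ J]) simp
  then show "e \<in> {e \<in> all_edges. edge_colour e \<in> set_decode S}" using e by (simp add: edge_colour)
next
  fix e assume e: "e \<in> {e \<in> all_edges. edge_colour e \<in> set_decode S}"
  then obtain I J where IJ: "e = {I, J}" "J < I" "I < r * n * t" "I mod r \<noteq> J mod r"
    "A (I div r mod n) (J div r mod n)" using all_edgesE by blast
  then have "pair_index (I mod r) (J mod r) \<in> set_decode S" using e by (simp add: edge_colour)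
  then show "e \<in> edges (query_graph r n A t S)" using IJ unfolding query_graph_def by auto
qed

private lemma simple_query_graph: "simple_graph (query_graph r n A t S)"
  by (auto simp: query_graph_def simple_graph_def)

private definition tree_sets :: "nat set set set" where
  "tree_sets = {F. F \<subseteq> all_edges \<and> k_tree k (\<Union>F, F)}"

private lemma finite_tree_sets: "finite tree_sets"
proof (rule finite_subset)
  show "tree_sets \<subseteq> Pow (Pow {..<r * n * t})" by (auto simp: tree_sets_def all_edges_def)
qed simp

private lemma count_query_graph:
  "count_k_trees k (query_graph r n A t S) = card {F \<in> tree_sets. edge_colour ` F \<subseteq> set_decode S}"
proof -
  have "1 * 2 \<le> r * (r - 1)" using r
    by (intro mult_le_mono[of 1 "r - 1" 2 r, simplified mult.commute]) auto
  then have "k \<ge> 1" by simp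
  have "{F. F \<subseteq> edges (query_graph r n A t S) \<and> k_tree k (\<Union>F, F)} =
      {F \<in> tree_sets. edge_colour ` F \<subseteq> set_decode S}"
    unfolding edges_query_graph tree_sets_def by blast
  then show ?thesis by (simp only: count_k_trees_edge_sets[OF simple_query_graph \<open>k \<ge> 1\<close>])
qed

private lemma sum_query_graphs:
  "(\<Sum>S<2 ^ k. (-1) ^ card (set_decode S) * int (count_k_trees k (query_graph r n A t S))) =
    (-1) ^ k * int (card {F \<in> tree_sets. edge_colour ` F = {..<k}})"
proof -
  define f where "f B = int (card {F \<in> tree_sets. edge_colour ` F = B})" for B
  define g where "g B = int (card {F \<in> tree_sets. edge_colour ` F \<subseteq> B})" for B
  have g: "g B = (\<Sum>C\<in>Pow B. f C)" if "finite B" for B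
  proof -
    have "{F \<in> tree_sets. edge_colour ` F \<subseteq> B} = (\<Union>C\<in>Pow B. {F \<in> tree_sets. edge_colour ` F = C})"
      by auto
    moreover have "card (\<Union>C\<in>Pow B. {F \<in> tree_sets. edge_colour ` F = C}) =
        (\<Sum>C\<in>Pow B. card {F \<in> tree_sets. edge_colour ` F = C})"
      by (rule card_UN_disjoint) (use finite_tree_sets that in auto)
    ultimately show ?thesis unfolding f_def g_def by simp
  qed
  have "(\<Sum>S<2 ^ k. (-1) ^ card (set_decode S) * int (count_k_trees k (query_graph r n A t S))) =
      (\<Sum>S<2 ^ k. (-1) ^ card (set_decode S) * g (set_decode S))"
    by (simp only: count_query_graph g_def)
  also have "\<dots> = (\<Sum>B\<in>Pow {..<k}. (-1) ^ card B * g B)"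
    by (rule sum.reindex_bij_betw[OF bij_betw_set_decode])
  also have "\<dots> = (-1) ^ card {..<k} * f {..<k}"
    \<comment> \<open>The signs put into the argument cancel those of the library formula, so its
      premise becomes that \<open>g\<close> sums \<open>f\<close> over all subsets.\<close>
    by (rule inclusion_exclusion_symmetric[symmetric, of g "\<lambda>B. (-1) ^ card B * f B"])
      (simp_all add: g flip: power_add mult.assoc)
  finally show ?thesis by (simp add: f_def)
qed

text \<open>Mixed radix with the digits colour, vertex and copy, matching \<open>mod\<close> and
  \<open>div\<close> in \<open>query_graph\<close>.\<close>

private definition vertex_code :: "(nat \<times> nat \<Rightarrow> nat) \<Rightarrow> (nat \<times> nat \<Rightarrow> nat) \<Rightarrow> nat \<times> nat \<Rightarrow> nat" where
  "vertex_code h l d = fst d + r * (h d + n * l d)"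

private lemma vertex_code_decode:
  assumes "d \<in> D" "h d < n"
  shows "vertex_code h l d mod r = fst d" "vertex_code h l d div r mod n = h d"
    "vertex_code h l d div r div n = l d"
  using assms by (auto simp: vertex_code_def half_edges_def)

private lemma vertex_code_less:
  assumes "d \<in> D" "h d < n" "l d < t"
  shows "vertex_code h l d < r * n * t"
proof -
  have "h d + n * l d < n * Suc (l d)" using assms by simp
  also have "\<dots> \<le> n * t" using assms by (intro mult_le_mono2) simp
  finally have "r * Suc (h d + n * l d) \<le> r * (n * t)" by (intro mult_le_mono2) simp
  moreover have "fst d < r" using assms by (auto simp: half_edges_def)
  ultimately show ?thesis by (simp add: vertex_code_def mult.assoc)
qed

text \<open>\<open>k\<close> edges take all \<open>k\<close> colours, so \<open>edge_colour\<close>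
  is injective on \<open>F\<close> and each pair of colours owns one edge;
  \<open>\<psi> (i, j)\<close> is the end of colour \<open>i\<close> on the edge of the
  pair.\<close>

private lemma rainbow_edge_map:
  assumes F: "F \<subseteq> all_edges" "edge_colour ` F = {..<k}" "card F = k"
  obtains \<psi> where "\<And>i j. (i, j) \<in> D \<Longrightarrow> {\<psi> (i, j), \<psi> (j, i)} \<in> F \<and> \<psi> (i, j) mod r = i"
    "F = edges (split_graph r \<psi>)"
proof -
  have "finite F"
  proof (rule finite_subset[OF F(1)])
    show "finite all_edges"
      by (rule finite_subset[of _ "Pow {..<r * n * t}"]) (auto simp: all_edges_def)
  qed
  then have inj: "inj_on edge_colour F" using F(2,3) by (intro eq_card_imp_inj_on) auto
  define P where "P d v \<longleftrightarrow> (\<exists>e\<in>F. v \<in> e \<and> v mod r = fst d \<and>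
    edge_colour e = pair_index (fst d) (snd d))" for d v
  define \<psi> where "\<psi> d = (SOME v. P d v)" for d
  have shape: "\<exists>I J. e = {I, J} \<and> I mod r = i \<and> J mod r = j"
    if e: "e \<in> F" "edge_colour e = pair_index i j" and d: "(i, j) \<in> D" for e i j
  proof -
    obtain I J where IJ: "e = {I, J}" "I mod r \<noteq> J mod r" using e F(1) all_edgesE by blast
    have "{I mod r, J mod r} = {i, j}"
      using e(2) d r IJ by (intro pair_index_inject[of _ r]) (auto simp: edge_colour half_edges_def)
    then show ?thesis using IJ by (auto simp: doubleton_eq_iff)
  qed
  have P: "P d (\<psi> d)" if d: "d \<in> D" for d
  proof -
    obtain i j where ij: "d = (i, j)" by (cases d)
    have "pair_index i j \<in> edge_colour ` F"
      using d pair_index_less unfolding F(2) ij half_edges_def by simp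
    then obtain e where e: "e \<in> F" "edge_colour e = pair_index i j" by auto
    then obtain I J where "e = {I, J}" "I mod r = i" using shape d ij by blast
    then have "P d I" unfolding P_def using e ij by auto
    then show ?thesis unfolding \<psi>_def by (rule someI)
  qed
  have edge: "{\<psi> (i, j), \<psi> (j, i)} \<in> F \<and> \<psi> (i, j) mod r = i \<and>
      edge_colour {\<psi> (i, j), \<psi> (j, i)} = pair_index i j" if d: "(i, j) \<in> D" for i j
  proof -
    have d': "(j, i) \<in> D" using d half_edges_swap by blast
    obtain e where e: "e \<in> F" "\<psi> (i, j) \<in> e" "\<psi> (i, j) mod r = i" "edge_colour e = pair_index i j"
      using P[OF d] by (auto simp: P_def)
    obtain e' where e': "e' \<in> F" "\<psi> (j, i) \<in> e'" "\<psi> (j, i) mod r = j"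
      "edge_colour e' = pair_index j i"
      using P[OF d'] by (auto simp: P_def)
    have "e' = e" using inj_onD[OF inj _ e'(1) e(1)] e(4) e'(4) by (simp add: pair_index_commute)
    obtain I J where IJ: "e = {I, J}" "I mod r = i" "J mod r = j" using shape[OF e(1,4) d] by blast
    have "i \<noteq> j" using d by (simp add: half_edges_def)
    then have "e = {\<psi> (i, j), \<psi> (j, i)}" using IJ e e' \<open>e' = e\<close> by auto
    then show ?thesis using e by simp
  qed
  have "F = edges (split_graph r \<psi>)"
  proof (intro equalityI subsetI)
    fix e assume e: "e \<in> F"
    then obtain I J where IJ: "e = {I, J}" "I mod r \<noteq> J mod r" using F(1) all_edgesE by blast
    then have d: "(I mod r, J mod r) \<in> D" using r by (simp add: half_edges_def)
    have "edge_colour e = pair_index (I mod r) (J mod r)" by (simp only: IJ(1) edge_colour)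
    also have "\<dots> = edge_colour {\<psi> (I mod r, J mod r), \<psi> (J mod r, I mod r)}"
      using edge[OF d] by (elim conjE) (rule sym)
    finally have "e = {\<psi> (I mod r, J mod r), \<psi> (J mod r, I mod r)}"
      using edge[OF d] inj_onD[OF inj _ e] by blast
    then show "e \<in> edges (split_graph r \<psi>)" using d unfolding split_graph_edge_iff by blast
  next
    fix e assume "e \<in> edges (split_graph r \<psi>)"
    then show "e \<in> F" using edge unfolding split_graph_edge_iff by blast
  qed
  then show thesis using that edge by blast
qed

text \<open>Every vertex of a split graph is an end of an edge, so passing to edge sets loses
  nothing.\<close>

private lemma tree_split_iff:
  assumes "colour_respecting r \<phi>"
  shows "tree_split r \<phi> \<longleftrightarrow> k_tree k (\<Union>(edges (split_graph r \<phi>)), edges (split_graph r \<phi>))"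
proof -
  have "\<Union>(edges (split_graph r \<phi>)) = \<phi> ` D"
    using half_edges_swap unfolding split_graph_def by fastforce
  then show ?thesis by (simp add: tree_split_def split_graph_def)
qed

text \<open>The bijection sends \<open>(h, l)\<close> to the edges of the split graph of
  \<open>vertex_code h l\<close>; the inverse decodes the ends supplied by
  \<open>rainbow_edge_map\<close>.\<close>

private lemma card_rainbow_tree_sets:
  "card {F \<in> tree_sets. edge_colour ` F = {..<k}} = num_rainbow_trees r n A t"
proof -
  let ?H = "{(h, l). h \<in> half_edge_maps r n A \<and> l \<in> D \<rightarrow>\<^sub>E {..<t} \<and>
    tree_split r (\<lambda>d. (fst d, h d, l d))}"
  let ?R = "{F \<in> tree_sets. edge_colour ` F = {..<k}}"
  let ?E = "\<lambda>h l. edges (split_graph r (vertex_code h l))"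
  let ?f = "\<lambda>(h, l). ?E h l"
  have H: "h d < n" "l d < t" if "(h, l) \<in> ?H" "d \<in> D" for h l d
    using that by (auto simp: half_edge_maps_def)
  have res: "colour_respecting r (vertex_code h l)" if "\<And>d. d \<in> D \<Longrightarrow> h d < n" for h l
    by (rule colour_respectingI) (metis vertex_code_decode(1) that)
  have tree: "tree_split r (\<lambda>d. (fst d, h d, l d)) \<longleftrightarrow> tree_split r (vertex_code h l)"
    if h: "\<And>d. d \<in> D \<Longrightarrow> h d < n" for h l
  proof -
    have ker: "(fst d, h d, l d) = (fst d', h d', l d') \<longleftrightarrow> vertex_code h l d = vertex_code h l d'"
      if "d \<in> D" "d' \<in> D" for d d'
      using vertex_code_decode[of d h l] vertex_code_decode[of d' h l] h that
      by (auto simp: vertex_code_def)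
    have "colour_respecting r (\<lambda>d. (fst d, h d, l d))" by (rule colour_respectingI) simp
    note res' = this
    show ?thesis
    proof
      assume "tree_split r (\<lambda>d. (fst d, h d, l d))"
      then show "tree_split r (vertex_code h l)"
        by (rule tree_split_kernel[OF _ res[OF h] ker])
    next
      assume "tree_split r (vertex_code h l)"
      then show "tree_split r (\<lambda>d. (fst d, h d, l d))"
        by (rule tree_split_kernel[OF _ res' ker[symmetric]])
    qed
  qed
  have "bij_betw ?f ?H ?R"
    unfolding bij_betw_def
  proof (intro conjI equalityI subsetI)
    show "inj_on ?f ?H"
    proof (rule inj_onI, clarify)
      fix h l h' l'
      let ?c = "vertex_code h l" and ?c' = "vertex_code h' l'"
      assume hl: "h \<in> half_edge_maps r n A" "l \<in> D \<rightarrow>\<^sub>E {..<t}"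
        "tree_split r (\<lambda>d. (fst d, h d, l d))"
        and hl': "h' \<in> half_edge_maps r n A" "l' \<in> D \<rightarrow>\<^sub>E {..<t}"
          "tree_split r (\<lambda>d. (fst d, h' d, l' d))"
        and eq: "?E h l = ?E h' l'"
      have dec: "?c d mod r = fst d" "?c d div r mod n = h d"
        "?c d div r div n = l d" if "d \<in> D" for d
        using vertex_code_decode[OF that] H(1)[of h l d] hl that by auto
      have dec': "?c' d mod r = fst d" "?c' d div r mod n = h' d"
        "?c' d div r div n = l' d" if "d \<in> D" for d
        using vertex_code_decode[OF that] H(1)[of h' l' d] hl' that by auto
      \<comment> \<open>The two end colours of an edge identify its pair, and the colour of an end
        identifies the half-edge; hence equal edge sets force equal codes.\<close>
      have code: "?c d = ?c' d" if d: "d \<in> D" for d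
      proof -
        obtain i j where ij: "d = (i, j)" by (cases d)
        then have "{?c (i, j), ?c (j, i)} \<in> ?E h' l'"
          unfolding eq[symmetric] split_graph_edge_iff using d by blast
        then obtain i' j' where d': "(i', j') \<in> D"
          "{?c (i, j), ?c (j, i)} = {?c' (i', j'), ?c' (j', i')}"
          unfolding split_graph_edge_iff by blast
        have sw: "(j, i) \<in> D" "(j', i') \<in> D" using d d' ij half_edges_swap by blast+
        from d'(2) consider "?c (i, j) = ?c' (i', j')" "?c (j, i) = ?c' (j', i')"
          | "?c (i, j) = ?c' (j', i')" "?c (j, i) = ?c' (i', j')"
          by (auto simp: doubleton_eq_iff)
        then show ?thesis
        proof cases
          case 1
          then have "i = i'" "j = j'" using dec(1) dec'(1) d d' sw ij by (metis fst_conv)+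
          then show ?thesis using 1 ij by simp
        next
          case 2
          then have "i = j'" "j = i'" using dec(1) dec'(1) d d' sw ij by (metis fst_conv)+
          then show ?thesis using 2 ij by simp
        qed
      qed
      have "h \<in> D \<rightarrow>\<^sub>E {..<n}" "h' \<in> D \<rightarrow>\<^sub>E {..<n}" using hl hl' by (auto simp: half_edge_maps_def)
      moreover have "h d = h' d" "l d = l' d" if "d \<in> D" for d
        using code[OF that] dec[OF that] dec'[OF that] by metis+
      ultimately show "h = h' \<and> l = l'" using hl(2) hl'(2) by (blast intro: PiE_ext)
    qed
  next
    fix F assume "F \<in> ?f ` ?H"
    then obtain h l where hl: "(h, l) \<in> ?H" and F: "F = edges (split_graph r (vertex_code h l))"
      by blast
    note dec = vertex_code_decode[OF _ H(1)[OF hl]]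
      and less = vertex_code_less[where l = l, OF _ H[OF hl]]
    have "F \<subseteq> all_edges"
    proof
      fix e assume "e \<in> F"
      then obtain i j where d: "(i, j) \<in> D" "e = {vertex_code h l (i, j), vertex_code h l (j, i)}"
        unfolding F split_graph_edge_iff by blast
      then have d': "(j, i) \<in> D" "i \<noteq> j" using half_edges_swap by (auto simp: half_edges_def)
      have "A (h (i, j)) (h (j, i))" using hl d(1) by (auto simp: half_edge_maps_def)
      then show "e \<in> all_edges"
        unfolding all_edges_def
          using d d' dec[of "(i, j)"] dec[of "(j, i)"] less[of "(i, j)"] less[of "(j, i)"]
        by (intro CollectI exI[of _ "vertex_code h l (i, j)"] exI[of _
          "vertex_code h l (j, i)"]) simp
    qed
    moreover have "k_tree k (\<Union>F, F)"
      using hl tree[of h l] tree_split_iff[OF res, of h l] H(1)[OF hl] unfolding F by blast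
    moreover have "edge_colour ` F = {..<k}"
    proof -
      have "edge_colour ` F = (\<lambda>(i, j). pair_index i j) ` (SIGMA i:{..<r}. {..<i})"
        unfolding F edges_split_graph image_image
      proof (intro image_cong refl, clarify)
        fix i j assume "i < r" "j < i"
        then have "(i, j) \<in> D" "(j, i) \<in> D" by (auto simp: half_edges_def)
        then show "edge_colour {vertex_code h l (i, j), vertex_code h l (j, i)} = pair_index i j"
          by (simp add: edge_colour dec)
      qed
      then show ?thesis by (simp only: pair_index_image)
    qed
    ultimately show "F \<in> ?R" by (simp add: tree_sets_def)
  next
    fix F assume F: "F \<in> ?R"
    then have F': "F \<subseteq> all_edges" "k_tree k (\<Union>F, F)" "edge_colour ` F = {..<k}" "card F = k"
      by (auto simp: tree_sets_def k_tree_def)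
    obtain \<psi> where psi: "\<And>i j. (i, j) \<in> D \<Longrightarrow> {\<psi> (i, j), \<psi> (j, i)} \<in> F \<and> \<psi> (i, j) mod r = i"
      and F_eq: "F = edges (split_graph r \<psi>)"
      using rainbow_edge_map[OF F'(1,3,4)] by blast
    define h where "h = restrict (\<lambda>d. \<psi> d div r mod n) D"
    define l where "l = restrict (\<lambda>d. \<psi> d div r div n) D"
    have psi_less: "\<psi> (i, j) < r * n * t"
      and psi_A: "A (\<psi> (i, j) div r mod n) (\<psi> (j, i) div r mod n)"
      if "(i, j) \<in> D" for i j
    proof -
      have "{\<psi> (i, j), \<psi> (j, i)} \<in> all_edges" using psi[OF that] F'(1) by blast
      then show "\<psi> (i, j) < r * n * t" "A (\<psi> (i, j) div r mod n) (\<psi> (j, i) div r mod n)"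
        using A_sym by (auto simp: all_edges_def doubleton_eq_iff)
    qed
    have code: "vertex_code h l d = \<psi> d" if "d \<in> D" for d
    proof -
      have "\<psi> d mod r = fst d" using psi that by (cases d) simp
      then have "vertex_code h l d = \<psi> d mod r + r * (\<psi> d div r)"
        using that by (simp add: vertex_code_def h_def l_def)
      then show ?thesis by (simp only: mod_mult_div_eq)
    qed
    have bounds: "h d < n \<and> l d < t" if "d \<in> D" for d
    proof -
      have "\<psi> d < r * n * t" using psi_less that by (cases d) simp
      moreover from this have "n > 0" "r > 0" by (auto intro: gr0I)
      ultimately show ?thesis
        using that by (simp add: h_def l_def less_mult_imp_div_less
          div_mult2_eq[symmetric] mult.commute mult.left_commute)
    qed
    have "h \<in> half_edge_maps r n A"
      using bounds psi_A half_edges_swap by (auto simp: half_edge_maps_def h_def)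
    moreover have "l \<in> D \<rightarrow>\<^sub>E {..<t}" using bounds by (auto simp: l_def)
    moreover have F_code: "F = edges (split_graph r (vertex_code h l))"
    proof -
      have "{\<psi> (i, j), \<psi> (j, i)} = {vertex_code h l (i, j), vertex_code h l (j, i)}" if "(i, j) \<in> D"
        for i j
        using that code half_edges_swap by metis
      then show ?thesis unfolding F_eq set_eq_iff split_graph_edge_iff by metis
    qed
    moreover have "tree_split r (\<lambda>d. (fst d, h d, l d))"
      using F'(2) tree_split_iff[OF res, of h l] tree[of h l] bounds unfolding F_code by blast
    ultimately have "(h, l) \<in> ?H" by blast
    then show "F \<in> ?f ` ?H" using F_code by (intro image_eqI[of _ _ "(h, l)"]) auto
  qed
  then show ?thesis unfolding num_rainbow_trees_def by (rule bij_betw_same_card[symmetric])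
qed

lemma inclusion_exclusion_query_graphs:
  "(\<Sum>S<2 ^ num_pairs r. (-1) ^ card (set_decode S) *
      int (count_k_trees (num_pairs r) (query_graph r n A t S))) =
    (-1) ^ num_pairs r * int (num_rainbow_trees r n A t)"
  using sum_query_graphs card_rainbow_tree_sets by simp

end

section \<open>A program logic with time bounds\<close>

primrec exp_size :: "exp \<Rightarrow> nat" where
  "exp_size (Const n) = 1"
| "exp_size (Reg r) = 1"
| "exp_size (Cell a e) = Suc (exp_size e)"
| "exp_size (Add e1 e2) = Suc (exp_size e1 + exp_size e2)"
| "exp_size (Sub e1 e2) = Suc (exp_size e1 + exp_size e2)"
| "exp_size (Mult e1 e2) = Suc (exp_size e1 + exp_size e2)"
| "exp_size (Div e1 e2) = Suc (exp_size e1 + exp_size e2)"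

text \<open>Constants below \<open>4\<close> have at most two binary digits and so fit whenever
  \<open>L \<ge> 2\<close>.\<close>

primrec small_consts :: "exp \<Rightarrow> bool" where
  "small_consts (Const n) \<longleftrightarrow> n < 4"
| "small_consts (Reg r) \<longleftrightarrow> True"
| "small_consts (Cell a e) \<longleftrightarrow> small_consts e"
| "small_consts (Add e1 e2) \<longleftrightarrow> small_consts e1 \<and> small_consts e2"
| "small_consts (Sub e1 e2) \<longleftrightarrow> small_consts e1 \<and> small_consts e2"
| "small_consts (Mult e1 e2) \<longleftrightarrow> small_consts e1 \<and> small_consts e2"
| "small_consts (Div e1 e2) \<longleftrightarrow> small_consts e1 \<and> small_consts e2"

text \<open>Size \<open>100\<close> leaves room for an adjacency test of size \<open>80\<close>
  inside the product of tests stored by \<open>write_entry\<close>.\<close>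

definition simple_exp :: "exp \<Rightarrow> bool" where
  "simple_exp e \<longleftrightarrow> exp_size e \<le> 100 \<and> small_consts e"

definition bounded :: "nat \<Rightarrow> state \<Rightarrow> bool" where
  "bounded L s \<longleftrightarrow> (\<forall>r. reg s r < 2 ^ L) \<and> (\<forall>a i. arr s a i < 2 ^ L)"

lemma exp_size_pos: "exp_size e \<ge> 1"
  by (cases e) auto

text \<open>Digit lengths at most add up along an operation; the extra node of a sum pays for the
  carry.\<close>

lemma val_less:
  assumes b: "bounded L s" and L: "L \<ge> 2"
  shows "small_consts e \<Longrightarrow> val s e < 2 ^ (L * exp_size e)"
proof (induction e)
  case (Const n)
  have "(2 :: nat) ^ 2 \<le> 2 ^ L" using L by (intro power_increasing) auto
  then show ?case using Const by simp
next
  case (Cell a e)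
  have "arr s a (val s e) < 2 ^ L" using b by (simp add: bounded_def)
  also have "(2 :: nat) ^ L \<le> 2 ^ (L * exp_size (Cell a e))"
    using L by (intro power_increasing) auto
  finally show ?case by simp
next
  case (Add e1 e2)
  let ?x = "L * exp_size e1" and ?y = "L * exp_size e2"
  have "(2 :: nat) ^ ?x \<le> 2 ^ (?x + ?y)" "(2 :: nat) ^ ?y \<le> 2 ^ (?x + ?y)"
    by (intro power_increasing; simp)+
  moreover have "val s e1 < 2 ^ ?x" "val s e2 < 2 ^ ?y" using Add by simp_all
  ultimately have "val s e1 + val s e2 < 2 ^ (?x + ?y) + 2 ^ (?x + ?y)" by linarith
  also have "\<dots> = 2 ^ Suc (?x + ?y)" by simp
  also have "\<dots> \<le> 2 ^ (L * exp_size (Add e1 e2))"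
    using L by (intro power_increasing) (auto simp: algebra_simps)
  finally show ?case by simp
next
  case (Mult e1 e2)
  have "val s e1 * val s e2 < 2 ^ (L * exp_size e1) * 2 ^ (L * exp_size e2)"
    using Mult by (intro mult_strict_mono') auto
  also have "\<dots> \<le> 2 ^ (L * exp_size (Mult e1 e2))"
    unfolding power_add[symmetric] by (intro power_increasing) (auto simp: algebra_simps)
  finally show ?case by simp
next
  case (Sub e1 e2)
  have "val s e1 - val s e2 < 2 ^ (L * exp_size e1)" using Sub by (simp add: less_imp_diff_less)
  also have "\<dots> \<le> 2 ^ (L * exp_size (Sub e1 e2))"
    by (intro power_increasing) (auto simp: algebra_simps)
  finally show ?case by simp
next
  case (Div e1 e2)
  have "val s e1 div val s e2 < 2 ^ (L * exp_size e1)"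
    using Div by (meson div_le_dividend le_less_trans small_consts.simps)
  also have "\<dots> \<le> 2 ^ (L * exp_size (Div e1 e2))"
    by (intro power_increasing) (auto simp: algebra_simps)
  finally show ?case by simp
qed (use b in \<open>simp add: bounded_def\<close>)

lemma num_digits_le: "v < 2 ^ m \<Longrightarrow> m \<ge> 1 \<Longrightarrow> num_digits v \<le> m"
proof (cases "v = 0")
  case False
  assume "v < 2 ^ m"
  have "(2 :: nat) ^ floor_log v \<le> v" using floor_log_exp2_le[of v] False by simp
  also note \<open>v < 2 ^ m\<close>
  finally have "floor_log v < m" by simp
  then show ?thesis by (simp add: num_digits_def)
qed (simp add: num_digits_def)

text \<open>There are \<open>exp_size e\<close> nodes, each with a value of at most
  \<open>L * exp_size e\<close> digits.\<close>

lemma cost_le: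
  assumes b: "bounded L s" and L: "L \<ge> 2"
  shows "small_consts e \<Longrightarrow> cost s e \<le> exp_size e * exp_size e * L"
proof -
  have d: "num_digits (val s e) \<le> L * exp_size e" if "small_consts e" for e
    using val_less[OF b L that] L exp_size_pos[of e] by (intro num_digits_le) auto
  show "small_consts e \<Longrightarrow> cost s e \<le> exp_size e * exp_size e * L"
  proof (induction e)
    case (Const n) then show ?case using d[of "Const n"] by simp
  next
    case (Reg r) then show ?case using d[of "Reg r"] by simp
  next
    case (Cell a e) then show ?case using d[of "Cell a e"] by (simp add: algebra_simps)
  next
    case (Add e1 e2) then show ?case using d[of "Add e1 e2"] by (simp add: algebra_simps)
  next
    case (Sub e1 e2) then show ?case using d[of "Sub e1 e2"] by (simp add: algebra_simps)
  next
    case (Mult e1 e2) then show ?case using d[of "Mult e1 e2"] by (simp add: algebra_simps)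
  next
    case (Div e1 e2) then show ?case using d[of "Div e1 e2"] by (simp add: algebra_simps)
  qed
qed

lemma cost_simple_exp:
  assumes "bounded L s" "L \<ge> 2" "simple_exp e"
  shows "cost s e \<le> 10000 * L"
proof -
  have "cost s e \<le> exp_size e * exp_size e * L"
    using cost_le assms by (simp add: simple_exp_def)
  also have "\<dots> \<le> 100 * 100 * L" using assms(3) by (intro mult_le_mono) (auto simp: simple_exp_def)
  finally show ?thesis by simp
qed

section \<open>Rules for time-bounded runs\<close>

lemma reg_set_reg: "reg (set_reg r v s) r' = (if r' = r then v else reg s r')"
  by (simp add: set_reg_def)

lemma arr_set_reg: "arr (set_reg r v s) = arr s"
  by (simp add: set_reg_def)

lemma reg_set_cell: "reg (set_cell a i v s) = reg s"
  by (simp add: set_cell_def)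

lemma arr_set_cell: "arr (set_cell a i v s) a' j = (if a' = a \<and> j = i then v else arr s a' j)"
  by (simp add: set_cell_def)

lemmas state_simps = reg_set_reg arr_set_reg reg_set_cell arr_set_cell

lemma bounded_set_reg: "bounded L s \<Longrightarrow> v < 2 ^ L \<Longrightarrow> bounded L (set_reg r v s)"
  by (simp add: bounded_def state_simps)

lemma bounded_set_cell: "bounded L s \<Longrightarrow> v < 2 ^ L \<Longrightarrow> bounded L (set_cell a i v s)"
  by (simp add: bounded_def state_simps)

text \<open>\<open>T\<close> is measured in units of \<open>30000 * L\<close>: by \<open>cost_simple_exp\<close> this pays for one statement
  with at most two expressions when all values have at most \<open>L\<close> binary digits.\<close>

definition runs :: "(bool list \<Rightarrow> nat) \<Rightarrow> bool list set \<Rightarrow> nat \<Rightarrow>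
    prog \<Rightarrow> nat \<Rightarrow> state \<Rightarrow> (state \<Rightarrow> bool) \<Rightarrow> bool" where
  "runs F Y L p T s Q \<longleftrightarrow> (bounded L s \<and> L \<ge> 2 \<longrightarrow>
    (\<exists>t Z s'. exec F p s t Z s' \<and> t \<le> T * (30000 * L) \<and> Z \<subseteq> Y \<and> bounded L s' \<and> Q s'))"

lemma runs_mono:
  assumes "runs F Y L p T s Q" "T \<le> T'" "\<And>s'. Q s' \<Longrightarrow> Q' s'"
  shows "runs F Y L p T' s Q'"
proof -
  have "T * (30000 * L) \<le> T' * (30000 * L)" using assms(2) by (rule mult_le_mono1)
  then show ?thesis using assms(1,3) unfolding runs_def by (meson order_trans)
qed

text \<open>Boundedness of the current state becomes available as an assumption; it bounds register
  contents that are not tracked otherwise.\<close>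

lemma runs_bounded: "(bounded L s \<Longrightarrow> runs F Y L p T s Q) \<Longrightarrow> runs F Y L p T s Q"
  by (simp add: runs_def)

lemma runs_Skip: "Q s \<Longrightarrow> runs F Y L Skip 1 s Q"
  unfolding runs_def by (intro impI exI conjI, rule exec.Skip) auto

lemma runs_Assign:
  assumes "simple_exp e" "val s e = v" "v < 2 ^ L" "Q (set_reg r v s)"
  shows "runs F Y L (Assign r e) 1 s Q"
  unfolding runs_def
proof (intro impI exI conjI)
  assume b: "bounded L s \<and> L \<ge> 2"
  show "exec F (Assign r e) s (1 + cost s e) {} (set_reg r (val s e) s)" by (rule exec.Assign)
  show "1 + cost s e \<le> 1 * (30000 * L)" using cost_simple_exp[of L s e] b assms(1) by simp
qed (use assms bounded_set_reg in auto)

lemma runs_Store: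
  assumes "simple_exp e1" "simple_exp e2" "val s e1 = i" "val s e2 = v" "v < 2 ^ L"
    "Q (set_cell a i v s)"
  shows "runs F Y L (Store a e1 e2) 1 s Q"
  unfolding runs_def
proof (intro impI exI conjI)
  assume b: "bounded L s \<and> L \<ge> 2"
  show "exec F (Store a e1 e2) s (1 + cost s e1 + cost s e2) {} (set_cell a (val s e1) (val s e2) s)"
    by (rule exec.Store)
  show "1 + cost s e1 + cost s e2 \<le> 1 * (30000 * L)"
    using cost_simple_exp[of L s e1] cost_simple_exp[of L s e2] b assms(1,2) by simp
qed (use assms bounded_set_cell in auto)

text \<open>The run of the second program is the postcondition of the first, in weakest-precondition
  style, so intermediate assertions are found by unification.\<close>

lemma runs_Seq:
  assumes "runs F Y L p1 T1 s (\<lambda>s'. runs F Y L p2 T2 s' Q)"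
  shows "runs F Y L (Seq p1 p2) (T1 + T2) s Q"
  unfolding runs_def
proof (intro impI)
  assume b: "bounded L s \<and> L \<ge> 2"
  then obtain t1 Z1 s1 where 1: "exec F p1 s t1 Z1 s1" "t1 \<le> T1 * (30000 * L)" "Z1 \<subseteq> Y"
    "bounded L s1" "runs F Y L p2 T2 s1 Q" using assms unfolding runs_def[of _ _ _ p1] by blast
  then obtain t2 Z2 s2 where 2: "exec F p2 s1 t2 Z2 s2" "t2 \<le> T2 * (30000 * L)" "Z2 \<subseteq> Y"
    "bounded L s2" "Q s2" using b unfolding runs_def by blast
  have "t1 + t2 \<le> (T1 + T2) * (30000 * L)" using 1 2 by (simp add: algebra_simps)
  then show "\<exists>t Z s'. exec F (Seq p1 p2) s t Z s' \<and> t \<le> (T1 + T2) * (30000 * L) \<and> Z \<subseteq> Y \<and>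
      bounded L s' \<and> Q s'" using exec.Seq[OF 1(1) 2(1)] 1 2 by blast
qed

text \<open>Charging \<open>T1 + T2\<close> instead of the maximum keeps time bounds plain
  sums.\<close>

lemma runs_If:
  assumes e: "simple_exp e"
    and 1: "val s e \<noteq> 0 \<Longrightarrow> runs F Y L p1 T1 s Q" and 2: "val s e = 0 \<Longrightarrow> runs F Y L p2 T2 s Q"
  shows "runs F Y L (If e p1 p2) (1 + (T1 + T2)) s Q"
  unfolding runs_def
proof (intro impI)
  assume b: "bounded L s \<and> L \<ge> 2"
  have c: "1 + cost s e \<le> 30000 * L" using cost_simple_exp[of L s e] b e by simp
  obtain t Z s' where t: "exec F (if val s e \<noteq> 0 then p1 else p2) s t Z s'"
    "t \<le> (if val s e \<noteq> 0 then T1 else T2) * (30000 * L)" "Z \<subseteq> Y" "bounded L s'" "Q s'"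
    using 1 2 b unfolding runs_def by (cases "val s e \<noteq> 0") (simp, metis)+
  have "exec F (If e p1 p2) s (1 + cost s e + t) Z s'"
    using t(1) exec.IfTrue[of s e] exec.IfFalse[of s e] by (cases "val s e \<noteq> 0") auto
  moreover have "t \<le> (T1 + T2) * (30000 * L)"
    using t(2) by (rule order_trans) (intro mult_le_mono1, simp)
  then have "1 + cost s e + t \<le> (1 + (T1 + T2)) * (30000 * L)" using c by (simp add: algebra_simps)
  ultimately show "\<exists>t Z s'. exec F (If e p1 p2) s t Z s' \<and> t \<le> (1 + (T1 + T2)) * (30000 * L) \<and>
      Z \<subseteq> Y \<and> bounded L s' \<and> Q s'" using t by blast
qed

text \<open>The number \<open>m\<close> of iterations is exact and indexes the invariant, so
  termination and time come together.\<close>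

lemma runs_While:
  assumes e: "simple_exp e" and I0: "I 0 s"
    and step: "\<And>i s'. i < m \<Longrightarrow> I i s' \<Longrightarrow> val s' e \<noteq> 0 \<and> runs F Y L p T s' (I (Suc i))"
    and exit: "\<And>s'. I m s' \<Longrightarrow> val s' e = 0 \<and> Q s'"
  shows "runs F Y L (While e p) (m * (T + 1) + 1) s Q"
proof -
  have "runs F Y L (While e p) (d * (T + 1) + 1) s' Q" if "i + d = m" "I i s'" for d i s'
    using that
  proof (induction d arbitrary: i s')
    case 0
    then have ex: "val s' e = 0" "Q s'" using exit[of s'] by auto
    show ?case
      unfolding runs_def
    proof (intro impI exI conjI)
      assume b: "bounded L s' \<and> L \<ge> 2"
      show "exec F (While e p) s' (1 + cost s' e) {} s'" using ex(1) by (rule exec.WhileFalse)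
      show "1 + cost s' e \<le> (0 * (T + 1) + 1) * (30000 * L)"
        using cost_simple_exp[of L s' e] b e by simp
    qed (use ex in auto)
  next
    case (Suc d)
    then have st: "val s' e \<noteq> 0" "runs F Y L p T s' (I (Suc i))" using step[of i s'] by auto
    show ?case
      unfolding runs_def
    proof (intro impI)
      assume b: "bounded L s' \<and> L \<ge> 2"
      then obtain t1 Z1 s1 where 1: "exec F p s' t1 Z1 s1" "t1 \<le> T * (30000 * L)" "Z1 \<subseteq> Y"
        "bounded L s1" "I (Suc i) s1" using st(2) unfolding runs_def by blast
      have "runs F Y L (While e p) (d * (T + 1) + 1) s1 Q"
        using Suc.IH[of "Suc i" s1] Suc.prems(1) 1(5) by simp
      then obtain t2 Z2 s2 where 2: "exec F (While e p) s1 t2 Z2 s2"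
        "t2 \<le> (d * (T + 1) + 1) * (30000 * L)" "Z2 \<subseteq> Y" "bounded L s2" "Q s2"
        using b 1(4) unfolding runs_def by blast
      have "1 + cost s' e \<le> 30000 * L" using cost_simple_exp[of L s' e] b e by simp
      then have "1 + cost s' e + t1 + t2 \<le> (Suc d * (T + 1) + 1) * (30000 * L)"
        using 1(2) 2(2) by (simp add: algebra_simps)
      then show "\<exists>t Z s''. exec F (While e p) s' t Z s'' \<and> t \<le> (Suc d * (T + 1) + 1) * (30000 * L) \<and>
          Z \<subseteq> Y \<and> bounded L s'' \<and> Q s''"
        using exec.WhileTrue[OF st(1) 1(1) 2(1)] 1 2 by blast
    qed
  qed
  from this[of 0 m s] I0 show ?thesis by simp
qed

lemma runs_Query:
  assumes e: "simple_exp e" "val s e = l" and y: "query_string s a l \<in> Y"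
    and v: "F (query_string s a l) = v" "v < 2 ^ L" and Q: "Q (set_reg r v s)"
  shows "runs F Y L (Query r a e) (1 + l) s Q"
  unfolding runs_def
proof (intro impI exI conjI)
  assume b: "bounded L s \<and> L \<ge> 2"
  let ?y = "query_string s a l"
  show "exec F (Query r a e) s (1 + cost s e + length ?y + num_digits (F ?y)) {?y} (set_reg r v s)"
    using exec.Query[of ?y s a e F r] e(2) v(1) by simp
  have "num_digits (F ?y) \<le> L" using num_digits_le v b by simp
  moreover have "length ?y = l" by (simp add: query_string_def)
  moreover have "l \<le> l * (30000 * L)" using b by simp
  moreover have "cost s e \<le> 10000 * L" "2 \<le> L" using cost_simple_exp[of L s e] b e by simp_all
  ultimately have "1 + cost s e + length ?y + num_digits (F ?y) \<le> 30000 * L + l * (30000 * L)"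
    by linarith
  then show "1 + cost s e + length ?y + num_digits (F ?y) \<le> (1 + l) * (30000 * L)" by simp
qed (use y v(2) Q bounded_set_reg in auto)

lemma runs_Assign_Seq:
  assumes "simple_exp e" "val s e = v" "v < 2 ^ L" "runs F Y L p T (set_reg r v s) Q"
  shows "runs F Y L (Seq (Assign r e) p) (1 + T) s Q"
  by (rule runs_Seq, rule runs_Assign) fact+

lemma runs_Store_Seq:
  assumes "simple_exp e1" "simple_exp e2" "val s e1 = i" "val s e2 = v" "v < 2 ^ L"
    "runs F Y L p T (set_cell a i v s) Q"
  shows "runs F Y L (Seq (Store a e1 e2) p) (1 + T) s Q"
  by (rule runs_Seq, rule runs_Store) fact+

text \<open>Frame condition, used to carry untouched registers and arrays through a
  subprogram.\<close>

definition same :: "nat set \<Rightarrow> nat set \<Rightarrow> state \<Rightarrow> state \<Rightarrow> bool" where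
  "same R B s s' \<longleftrightarrow> (\<forall>r. r \<notin> R \<longrightarrow> reg s' r = reg s r) \<and> (\<forall>a. a \<notin> B \<longrightarrow> arr s' a = arr s a)"

lemma same_refl: "same R B s s"
  by (simp add: same_def)

lemma same_trans:
  "same R B s s' \<Longrightarrow> same R' B' s' s'' \<Longrightarrow> R \<union> R' \<subseteq> R'' \<Longrightarrow> B \<union> B' \<subseteq> B'' \<Longrightarrow> same R'' B'' s s''"
  unfolding same_def subset_iff Un_iff by metis

lemma same_reg: "same R B s s' \<Longrightarrow> r \<notin> R \<Longrightarrow> reg s' r = reg s r"
  by (simp add: same_def)

lemma same_arr: "same R B s s' \<Longrightarrow> a \<notin> B \<Longrightarrow> arr s' a = arr s a"
  by (simp add: same_def)

lemma same_set_reg: "same R B s s' \<Longrightarrow> r \<in> R \<Longrightarrow> same R B s (set_reg r v s')"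
  by (auto simp: same_def state_simps)

lemma same_set_cell: "same R B s s' \<Longrightarrow> a \<in> B \<Longrightarrow> same R B s (set_cell a i v s')"
  by (auto simp: same_def state_simps fun_eq_iff)

lemmas same_intros = same_set_reg same_set_cell same_refl

section \<open>The oracle program\<close>

text \<open>Registers: \<open>1\<close> clique size \<open>r\<close>, \<open>2\<close> order \<open>n\<close> of the graph, \<open>3\<close> tree size \<open>k\<close>, \<open>4\<close> number \<open>t\<close> of
  copies, \<open>5\<close> code \<open>S\<close> of a set of colour pairs, \<open>6\<close> order of the queried graph, \<open>8\<close> and \<open>9\<close> two of
  its vertices, \<open>12\<close> and \<open>13\<close> the vertices of the original graph below them, \<open>16\<close> answers, \<open>18\<close>
  binomial coefficient; \<open>23\<close>, \<open>24\<close> and \<open>19\<close>, \<open>20\<close> positive and negative parts of alternating sums.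
  Arrays: \<open>1\<close> query, \<open>2\<close> powers of two, \<open>3\<close> number of ones in the binary representation.\<close>

definition mod_exp :: "exp \<Rightarrow> exp \<Rightarrow> exp" where
  "mod_exp a b = Sub a (Mult (Div a b) b)"

text \<open>Distance under truncated subtraction; as a test it is nonzero exactly for different
  values.\<close>

definition diff_exp :: "exp \<Rightarrow> exp \<Rightarrow> exp" where
  "diff_exp a b = Add (Sub a b) (Sub b a)"

definition triangle_exp :: "exp \<Rightarrow> exp" where
  "triangle_exp a = Div (Mult a (Sub a (Const 1))) (Const 2)"

text \<open>Under truncated subtraction \<open>a + (b - a)\<close> is the maximum and
  \<open>a - (a - b)\<close> the minimum.\<close>

definition pair_index_exp :: "exp \<Rightarrow> exp \<Rightarrow> exp" where
  "pair_index_exp a b = Add (triangle_exp (Add a (Sub b a))) (Sub a (Sub a b))"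

lemmas exp_defs = mod_exp_def diff_exp_def triangle_exp_def pair_index_exp_def

lemma val_exps:
  "val s (mod_exp a b) = val s a mod val s b"
  "val s (diff_exp a b) = (val s a - val s b) + (val s b - val s a)"
  "val s (triangle_exp a) = num_pairs (val s a)"
  "val s (pair_index_exp a b) = pair_index (val s a) (val s b)"
proof -
  have "val s a + (val s b - val s a) = max (val s a) (val s b)"
    "val s a - (val s a - val s b) = min (val s a) (val s b)" by auto
  then show "val s (pair_index_exp a b) = pair_index (val s a) (val s b)"
    by (simp only: pair_index_exp_def triangle_exp_def pair_index_def val.simps)
qed (simp_all add: mod_exp_def diff_exp_def triangle_exp_def minus_div_mult_eq_mod)

lemmas simple_simps = simple_exp_def exp_defs

text \<open>Within the prefix the product vanishes exactly at the two separators; every other cell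
  gets some nonzero number, which a query reads as \<open>1\<close>.\<close>

definition write_prefix :: prog where
  "write_prefix = Seq (Assign 7 (Const 0))
    (While (Sub (Add (Add (Reg 3) (Reg 6)) (Const 2)) (Reg 7))
      (Seq (Store 1 (Reg 7) (Mult (diff_exp (Reg 7) (Reg 3))
             (Sub (Add (Add (Reg 3) (Reg 6)) (Const 1)) (Reg 7))))
           (Assign 7 (Add (Reg 7) (Const 1)))))"

lemma runs_write_prefix:
  assumes kN: "reg s 3 = k" "reg s 6 = N" and L: "(k + N + 2) * (k + N + 2) \<le> L"
  shows "runs F Y L write_prefix (3 * (k + N + 3)) s (\<lambda>s'. same {7} {1} s s' \<and>
    (\<forall>i<k + N + 2. arr s' 1 i \<noteq> 0 \<longleftrightarrow> i \<noteq> k \<and> i \<noteq> k + N + 1))"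
proof -
  let ?I = "\<lambda>i s'. reg s' 7 = i \<and> same {7} {1} s s' \<and>
    (\<forall>j<i. arr s' 1 j \<noteq> 0 \<longleftrightarrow> j \<noteq> k \<and> j \<noteq> k + N + 1)"
  let ?e = "Sub (Add (Add (Reg 3) (Reg 6)) (Const 2)) (Reg 7)"
  let ?v = "Mult (diff_exp (Reg 7) (Reg 3)) (Sub (Add (Add (Reg 3) (Reg 6)) (Const 1)) (Reg 7))"
  let ?body = "Seq (Store 1 (Reg 7) ?v) (Assign 7 (Add (Reg 7) (Const 1)))"
  have small: "v < 2 ^ L" if "v \<le> (k + N + 2) * (k + N + 2)" for v
    using that L less_exp[of L] by linarith
  have "k + N + 2 \<le> (k + N + 2) * (k + N + 2)" by simp
  note small' = small[OF order_trans[OF _ this]]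
  have step: "val s' ?e \<noteq> 0 \<and>
      runs F Y L ?body 2 s' (?I (Suc i))"
    if i: "i < k + N + 2" and I: "?I i s'" for i s'
  proof
    from I have r7: "reg s' 7 = i" and sm: "same {7} {1} s s'"
      and cells: "\<And>j. j < i \<Longrightarrow> arr s' 1 j \<noteq> 0 \<longleftrightarrow> j \<noteq> k \<and> j \<noteq> k + N + 1" by auto
    have r: "reg s' 3 = k" "reg s' 6 = N" using kN same_reg[OF sm] by simp_all
    define v where "v = ((i - k) + (k - i)) * (k + N + 1 - i)"
    have v: "v \<noteq> 0 \<longleftrightarrow> i \<noteq> k \<and> i \<noteq> k + N + 1" using i by (auto simp: v_def)
    have "v \<le> (k + N + 2) * (k + N + 2)" unfolding v_def using i by (intro mult_le_mono) auto
    then have v_less: "v < 2 ^ L" by (rule small)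
    show "val s' ?e \<noteq> 0" using i r r7 by simp
    have cells': "arr (set_reg 7 (Suc i) (set_cell 1 i v s')) 1 j \<noteq> 0 \<longleftrightarrow> j \<noteq> k \<and> j \<noteq> k + N + 1"
      if "j < Suc i" for j
      using that cells[of j] v by (cases "j = i") (auto simp: state_simps)
    show "runs F Y L ?body 2 s' (?I (Suc i))"
    proof (rule runs_mono[OF runs_Store_Seq])
      show "val s' (Reg 7) = i" using r7 by simp
      show "val s' ?v = v"
        using r r7 by (simp add: val_exps v_def)
      show "runs F Y L (Assign 7 (Add (Reg 7) (Const 1))) 1 (set_cell 1 i v s') (?I (Suc i))"
      proof (rule runs_Assign)
        show "val (set_cell 1 i v s') (Add (Reg 7) (Const 1)) = Suc i" using r7
          by (simp add: state_simps)
        show "Suc i < 2 ^ L" using i by (intro small') simp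
        show "?I (Suc i) (set_reg 7 (Suc i) (set_cell 1 i v s'))"
          using cells' sm by (simp add: state_simps same_intros)
      qed (simp add: simple_simps)
    qed (use v_less in \<open>simp_all add: simple_simps\<close>)
  qed
  show ?thesis
    unfolding write_prefix_def
  proof (rule runs_mono[OF runs_Assign_Seq])
    show "val s (Const 0) = 0" by simp
    show "runs F Y L (While ?e
        ?body) ((k + N + 2) * (2 + 1) + 1) (set_reg 7 0 s)
        (?I (k + N + 2))"
    proof (rule runs_While[where I = ?I])
      show "?I 0 (set_reg 7 0 s)" by (simp add: state_simps same_intros)
    next
      fix s' assume I: "?I (k + N + 2) s'"
      then have sm: "same {7} {1} s s'" by simp
      have "reg s' 3 = k" "reg s' 6 = N" using kN same_reg[OF sm] by simp_all
      then show "val s' ?e = 0 \<and> ?I (k + N + 2) s'"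
        using I by simp
    next
      show "simple_exp ?e" by (simp add: simple_simps)
    qed (use step in blast)
  qed (auto simp: simple_simps)
qed

text \<open>One counter runs through all index pairs, and only those below the diagonal are written.
  The stored product tests three things: different colours, colour pair allowed by \<open>S\<close>,
  adjacency. A bit of \<open>S\<close> is the parity of its quotient by a tabulated power of
  two.\<close>

definition write_entry :: "exp \<Rightarrow> prog" where
  "write_entry ad =
    Seq (Assign 8 (Div (Reg 7) (Reg 6)))
   (Seq (Assign 9 (mod_exp (Reg 7) (Reg 6)))
   (Seq (If (Sub (Reg 8) (Reg 9))
      (Seq (Assign 10 (mod_exp (Reg 8) (Reg 1)))
      (Seq (Assign 11 (mod_exp (Reg 9) (Reg 1)))
      (Seq (Assign 12 (mod_exp (Div (Reg 8) (Reg 1)) (Reg 2)))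
      (Seq (Assign 13 (mod_exp (Div (Reg 9) (Reg 1)) (Reg 2)))
      (Seq (Assign 14 (pair_index_exp (Reg 10) (Reg 11)))
      (Seq (Assign 15 (Div (Reg 5) (Cell 2 (Reg 14))))
        (Store 1 (Add (Add (Add (Reg 3) (Reg 6)) (Const 2)) (Add (triangle_exp (Reg 8)) (Reg 9)))
          (Mult (Mult (diff_exp (Reg 10) (Reg 11)) (mod_exp (Reg 15) (Const 2))) ad))))))))
      Skip)
   (Assign 7 (Add (Reg 7) (Const 1)))))"

text \<open>The expression \<open>ad\<close> decides the adjacency of the vertices in registers \<open>12\<close> and \<open>13\<close>.\<close>

definition adjacency_exp :: "exp \<Rightarrow> (nat \<Rightarrow> nat \<Rightarrow> bool) \<Rightarrow> state \<Rightarrow> bool" where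
  "adjacency_exp ad A s \<longleftrightarrow> exp_size ad \<le> 80 \<and> small_consts ad \<and>
    (\<forall>s'. arr s' 0 = arr s 0 \<longrightarrow> reg s' 1 = reg s 1 \<longrightarrow> reg s' 2 = reg s 2 \<longrightarrow>
      reg s' 12 < reg s 2 \<longrightarrow> reg s' 13 < reg s 2 \<longrightarrow>
      (val s' ad \<noteq> 0 \<longleftrightarrow> A (reg s' 12) (reg s' 13)) \<and> val s' ad \<le> reg s 2)"

text \<open>The powers include the exponent \<open>num_pairs r\<close> itself, because that power
  bounds the loop over \<open>S\<close>.\<close>

definition prepared :: "nat \<Rightarrow> nat \<Rightarrow> (nat \<Rightarrow> nat \<Rightarrow> bool) \<Rightarrow> exp \<Rightarrow> state \<Rightarrow> bool" where
  "prepared r n A ad s \<longleftrightarrow> reg s 1 = r \<and> reg s 2 = n \<and> reg s 3 = num_pairs r \<and>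
    (\<forall>j\<le>num_pairs r. arr s 2 j = 2 ^ j) \<and>
    (\<forall>S<2 ^ num_pairs r. arr s 3 S = card (set_decode S)) \<and> adjacency_exp ad A s"

lemma prepared_same:
  assumes "prepared r n A ad s" "same R B s s'" "R \<inter> {1, 2, 3} = {}" "B \<inter> {0, 2, 3} = {}"
  shows "prepared r n A ad s'"
proof -
  have "reg s' 1 = reg s 1" "reg s' 2 = reg s 2" "reg s' 3 = reg s 3"
    "arr s' 0 = arr s 0" "arr s' 2 = arr s 2" "arr s' 3 = arr s 3"
    using assms by (auto simp: same_def)
  with assms(1) show ?thesis unfolding prepared_def adjacency_exp_def by metis
qed

abbreviation entry_regs :: "nat set" where
  "entry_regs \<equiv> {7, 8, 9, 10, 11, 12, 13, 14, 15}"

definition query_edge :: "nat \<Rightarrow> nat \<Rightarrow> (nat \<Rightarrow> nat \<Rightarrow> bool) \<Rightarrow> nat \<Rightarrow> nat \<Rightarrow> nat \<Rightarrow> bool" where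
  "query_edge r n A S I J \<longleftrightarrow> I mod r \<noteq> J mod r \<and> pair_index (I mod r) (J mod r) \<in> set_decode S \<and>
     A (I div r mod n) (J div r mod n)"

text \<open>The written number stays existential: a query only sees whether it is nonzero.\<close>

lemma runs_write_entry:
  assumes prep: "prepared r n A ad s" and r': "reg s 5 = S" "reg s 6 = N" "reg s 7 = i"
    and pos: "r > 0" "n > 0" "N > 0" and k: "k = num_pairs r"
    and L: "r * n + r * r + r \<le> L" "i + 1 < 2 ^ L"
    and I: "I = i div N" and J: "J = i mod N"
  shows "runs F Y L (write_entry ad) 12 s (\<lambda>s'. same entry_regs {1} s s' \<and> reg s' 7 = i + 1 \<and>
    (\<exists>v. (v \<noteq> 0 \<longleftrightarrow> query_edge r n A S I J) \<and>
      (\<forall>p. arr s' 1 p = (if J < I \<and> p = k + N + 2 + (I *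
        (I - 1) div 2 + J) then v else arr s 1 p))))"
    (is "runs F Y L _ _ s ?Q")
proof (rule runs_bounded)
  assume b: "bounded L s"
  have r: "reg s 1 = r" "reg s 2 = n" "reg s 3 = k" "reg s 5 = S" "reg s 6 = N" "reg s 7 = i"
    and pow: "\<And>j. j \<le> k \<Longrightarrow> arr s 2 j = 2 ^ j" and ad: "adjacency_exp ad A s"
    using prep r' by (simp_all add: prepared_def k)
  define a c u w idx bt where "a = I mod r" and "c = J mod r" and "u = I div r mod n"
    and "w = J div r mod n" and "idx = pair_index a c" and "bt = S div arr s 2 idx"
  define s2 where "s2 = set_reg 9 J (set_reg 8 I s)"
  define s8 where "s8 = set_reg 15 bt (set_reg 14 idx (set_reg 13 w (set_reg 12 u
    (set_reg 11 c (set_reg 10 a s2)))))"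
  define p where "p = k + N + 2 + (I * (I - 1) div 2 + J)"
  define v where "v = ((a - c) + (c - a)) * (bt mod 2) * val s8 ad"
  have small: "x < 2 ^ L" if "x \<le> r * n + r * r + r" for x
    using that L(1) less_exp[of L] by linarith
  have less: "a < r" "c < r" "u < n" "w < n" using pos by (simp_all add: a_def c_def u_def w_def)
  have "n \<le> r * n" using pos by simp
  then have vals_less: "a < 2 ^ L" "c < 2 ^ L" "u < 2 ^ L" "w < 2 ^ L"
    using less by (intro small; linarith)+
  have S_less: "S < 2 ^ L" using b r by (auto simp: bounded_def)
  have I_less: "I < 2 ^ L" using L(2) div_le_dividend[of i N] unfolding I by linarith
  have J_less: "J < 2 ^ L" using L(2) mod_less_eq_dividend[of i N] unfolding J by linarith
  have "idx \<le> r * r + r"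
  proof -
    have "max a c * (max a c - 1) div 2 \<le> max a c * (max a c - 1)" by simp
    also have "\<dots> \<le> r * r" using less by (intro mult_le_mono) auto
    finally show ?thesis using less by (simp add: idx_def pair_index_def)
  qed
  then have idx_less: "idx < 2 ^ L" by (intro small) simp
  have bt_less: "bt < 2 ^ L" using S_less div_le_dividend[of S] unfolding bt_def
    by (metis le_less_trans)
  have adv: "(val s8 ad \<noteq> 0 \<longleftrightarrow> A u w) \<and> val s8 ad \<le> n"
  proof -
    have st: "arr s8 0 = arr s 0" "reg s8 1 = reg s 1" "reg s8 2 = reg s 2" "reg s8 12 = u"
      "reg s8 13 = w"
      by (simp_all add: s8_def s2_def state_simps)
    show ?thesis using ad less unfolding adjacency_exp_def r(2)[symmetric]
      using st by (metis r(2))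
  qed
  have v: "v \<noteq> 0 \<longleftrightarrow> query_edge r n A S I J"
  proof (cases "a = c")
    \<comment> \<open>For equal colours the distance factor of \<open>v\<close> is zero, whatever
      the other factors are; only different colours give an index below \<open>k\<close>.\<close>
    case True
    then show ?thesis by (simp add: v_def query_edge_def a_def c_def)
  next
    case False
    then have "idx < k" using pair_index_less less unfolding idx_def k by blast
    then have "bt mod 2 \<noteq> 0 \<longleftrightarrow> idx \<in> set_decode S"
      by (simp add: bt_def pow set_decode_def odd_iff_mod_2_eq_one)
    then show ?thesis using False adv
      by (auto simp: v_def query_edge_def a_def c_def u_def w_def idx_def)
  qed
  have "v \<le> r * 1 * n" unfolding v_def using less adv by (intro mult_le_mono) auto
  then have v_less: "v < 2 ^ L" by (intro small) simp
  have simple_ad: "exp_size ad \<le> 80" "small_consts ad" using ad by (auto simp: adjacency_exp_def)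
  have Q1: "?Q (set_reg 7 (i + 1) (set_cell 1 p v s8))" if "J < I"
    using v that by (auto simp: state_simps s8_def s2_def p_def intro!: same_intros)
  have Q2: "?Q (set_reg 7 (i + 1) s2)" if "\<not> J < I"
    using that v by (auto simp: state_simps s2_def intro!: same_intros exI[of _ v])
  let ?inc = "Assign 7 (Add (Reg 7) (Const 1))"
  have inc: "runs F Y L ?inc 1 s' ?Q" if "reg s' 7 = i" "?Q (set_reg 7 (i + 1) s')" for s'
    using that L(2) by (intro runs_Assign[where v = "i + 1"]) (simp_all add: simple_simps)
  show "runs F Y L (write_entry ad) 12 s ?Q"
    unfolding write_entry_def
    apply (rule runs_mono)
      apply (rule runs_Assign_Seq[where v = I])
         apply (simp add: simple_simps)
        apply (simp add: r I)
       apply (rule I_less)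
      apply (rule runs_Assign_Seq[where v = J])
         apply (simp add: simple_simps)
        apply (simp add: val_exps state_simps r J)
       apply (rule J_less)
      apply (fold s2_def)
      apply (rule runs_Seq)
      apply (rule runs_If)
        apply (simp add: simple_simps)
       apply (rule runs_Assign_Seq[where v = a])
          apply (simp add: simple_simps)
         apply (simp add: val_exps state_simps s2_def r r(1)[simplified] a_def)
        apply (rule vals_less)
       apply (rule runs_Assign_Seq[where v = c])
          apply (simp add: simple_simps)
         apply (simp add: val_exps state_simps s2_def r r(1)[simplified] c_def)
        apply (rule vals_less)
       apply (rule runs_Assign_Seq[where v = u])
          apply (simp add: simple_simps)
         apply (simp add: val_exps state_simps s2_def r r(1)[simplified] u_def)
        apply (rule vals_less)
       apply (rule runs_Assign_Seq[where v = w])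
          apply (simp add: simple_simps)
         apply (simp add: val_exps state_simps s2_def r r(1)[simplified] w_def)
        apply (rule vals_less)
       apply (rule runs_Assign_Seq[where v = idx])
          apply (simp add: simple_simps)
         apply (simp add: val_exps state_simps s2_def idx_def)
        apply (rule idx_less)
       apply (rule runs_Assign_Seq[where v = bt])
          apply (simp add: simple_simps)
         apply (simp add: val_exps state_simps s2_def r bt_def)
        apply (rule bt_less)
       apply (fold s8_def)
       apply (rule runs_Store[where i = p and v = v])
            apply (simp add: simple_simps)
           apply (use simple_ad in \<open>simp add: simple_simps\<close>)
          apply (simp add: val_exps state_simps s8_def s2_def r p_def)
         apply (simp add: val_exps v_def)
         apply (simp add: state_simps s8_def)
        apply (rule v_less)
       apply (rule inc)
        apply (simp add: state_simps s8_def s2_def r)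
       apply (rule Q1)
       apply (simp add: state_simps s2_def)
      apply (rule runs_Skip)
      apply (rule inc)
       apply (simp add: state_simps s2_def r)
      apply (rule Q2)
      apply (simp add: state_simps s2_def)
     apply simp
    apply assumption
    done
qed

definition write_matrix :: "exp \<Rightarrow> prog" where
  "write_matrix ad = Seq (Assign 7 (Const 0))
    (While (Sub (Mult (Reg 6) (Reg 6)) (Reg 7)) (write_entry ad))"

text \<open>\<open>r\<close>, \<open>n\<close> and \<open>N\<close> are divisors in each entry; a
  graph without vertices is harmless, since the loop is then not entered.\<close>

lemma runs_write_matrix:
  assumes prep: "prepared r n A ad s" and r: "reg s 5 = S" "reg s 6 = N"
    and pos: "N > 0 \<Longrightarrow> r > 0 \<and> n > 0" and k: "k = num_pairs r"
    and L: "r * n + r * r + r \<le> L" "N * N \<le> L"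
  shows "runs F Y L (write_matrix ad) (13 * (N * N) + 2) s (\<lambda>s'. same entry_regs {1} s s' \<and>
    (\<forall>p<k + N + 2. arr s' 1 p = arr s 1 p) \<and>
    (\<forall>I J. J < I \<longrightarrow> I < N \<longrightarrow>
      (arr s' 1 (k + N + 2 + (num_pairs I + J)) \<noteq> 0 \<longleftrightarrow> query_edge r n A S I J)))"
    (is "runs F Y L _ _ s ?Q")
proof -
  let ?pos = "\<lambda>I J. k + N + 2 + (num_pairs I + J)"
  let ?I = "\<lambda>i s'. reg s' 7 = i \<and> same entry_regs {1} s s' \<and>
    (\<forall>p<k + N + 2. arr s' 1 p = arr s 1 p) \<and>
    (\<forall>I J. J < I \<longrightarrow> I < N \<longrightarrow> I * N + J < i \<longrightarrow>
      (arr s' 1 (?pos I J) \<noteq> 0 \<longleftrightarrow> query_edge r n A S I J))"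
  let ?e = "Sub (Mult (Reg 6) (Reg 6)) (Reg 7)"
  have step: "val s' ?e \<noteq> 0 \<and> runs F Y L (write_entry ad) 12 s' (?I (Suc i))"
    if i: "i < N * N" and inv: "?I i s'" for i s'
  proof
    from inv have r7: "reg s' 7 = i" and sm: "same entry_regs {1} s s'"
      and prefix: "\<And>p. p < k + N + 2 \<Longrightarrow> arr s' 1 p = arr s 1 p"
      and cells: "\<And>I J. J < I \<Longrightarrow> I < N \<Longrightarrow> I * N + J < i \<Longrightarrow>
        arr s' 1 (?pos I J) \<noteq> 0 \<longleftrightarrow> query_edge r n A S I J" by blast+
    have r': "reg s' 5 = S" "reg s' 6 = N" using r same_reg[OF sm] by simp_all
    have prep': "prepared r n A ad s'" by (rule prepared_same[OF prep sm]) auto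
    show "val s' ?e \<noteq> 0" using i r' r7 by simp
    have N: "N > 0" using i by (auto intro: gr0I)
    have i_less: "i + 1 < 2 ^ L" using i L(2) less_exp[of L] by linarith
    define I0 J0 where "I0 = i div N" and "J0 = i mod N"
    show "runs F Y L (write_entry ad) 12 s' (?I (Suc i))"
    proof (rule runs_mono[OF runs_write_entry[OF prep' r' r7 _ _ N k L(1) i_less I0_def J0_def]])
      show "r > 0" "n > 0" using pos N by blast+
      fix s'' assume *: "same entry_regs {1} s' s'' \<and> reg s'' 7 = i + 1 \<and>
        (\<exists>v. (v \<noteq> 0 \<longleftrightarrow> query_edge r n A S I0 J0) \<and>
          (\<forall>p. arr s'' 1 p = (if J0 < I0 \<and> p = ?pos I0 J0 then v else arr s' 1 p)))"
      then obtain v where v: "v \<noteq> 0 \<longleftrightarrow> query_edge r n A S I0 J0"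
        and upd: "\<And>p. arr s'' 1 p = (if J0 < I0 \<and> p = ?pos I0 J0 then v else arr s' 1 p)" by blast
      have "arr s'' 1 (?pos I J) \<noteq> 0 \<longleftrightarrow> query_edge r n A S I J"
        if IJ: "J < I" "I < N" "I * N + J < Suc i" for I J
      proof (cases "I * N + J = i")
        case True
        then have "I = I0" "J = J0" using IJ by (auto simp: I0_def J0_def)
        then show ?thesis using v upd IJ by simp
      next
        case False
        then have less: "I * N + J < i" using IJ by simp
        \<comment> \<open>Different entries have different addresses, so an entry written earlier
          survives this round.\<close>
        have ne: "?pos I J \<noteq> ?pos I0 J0" if "J0 < I0"
        proof
          have "i div N < N" using i by (simp add: less_mult_imp_div_less)
          moreover assume "?pos I J = ?pos I0 J0"
          ultimately have "I = I0 \<and> J = J0"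
            using triangle_index_inject[of I N J I0 J0] IJ that by (simp add: I0_def)
          then have "I * N + J = i" using div_mult_mod_eq[of i N] by (simp add: I0_def J0_def)
          then show False using less by simp
        qed
        then show ?thesis using upd[of "?pos I J"] cells[OF IJ(1,2) less] by (cases "J0 < I0") auto
      qed
      moreover have "arr s'' 1 p = arr s 1 p" if "p < k + N + 2" for p
        using upd[of p] prefix[OF that] that by auto
      moreover have "same entry_regs {1} s s''" using same_trans[OF sm, of entry_regs "{1}" s''] *
        by simp
      ultimately show "?I (Suc i) s''" using * by simp
    qed simp_all
  qed
  show ?thesis
    unfolding write_matrix_def
  proof (rule runs_mono[OF runs_Assign_Seq])
    show "val s (Const 0) = 0" by simp
    show "runs F Y L (While ?e (write_entry ad)) (N * N * (12 + 1) + 1) (set_reg 7 0 s) (?I (N * N))"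
    proof (rule runs_While[where I = ?I])
      show "?I 0 (set_reg 7 0 s)" by (simp add: state_simps same_intros)
    next
      fix s' assume I: "?I (N * N) s'"
      then have sm: "same entry_regs {1} s s'" by blast
      have "reg s' 6 = N" using r same_reg[OF sm] by simp
      then show "val s' ?e = 0 \<and> ?I (N * N) s'" using I by simp
    next
      show "simple_exp ?e" by (simp add: simple_simps)
    qed (use step in blast)
  next
    fix s' assume I: "?I (N * N) s'"
    have "I * N + J < N * N" if "J < I" "I < N" for I J
    proof -
      have "I * N + J < Suc I * N" using that by simp
      also have "\<dots> \<le> N * N" using that by (intro mult_le_mono1) simp
      finally show ?thesis .
    qed
    then show "?Q s'" using I by blast
  qed (auto simp: simple_simps)
qed

text \<open>The \<open>N * N\<close> cells after the prefix exceed the triangle;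
  \<open>decode\<close> ignores the surplus, so leftovers of earlier queries there do no
  harm.\<close>

lemma decode_query_string:
  assumes prefix: "\<And>i. i < k + N + 2 \<Longrightarrow> f i \<longleftrightarrow> i \<noteq> k \<and> i \<noteq> k + N + 1"
  shows "decode (map f [0..<k + N + 2 + N * N]) =
    (k, ({..<N}, {{i, j} | i j. j < i \<and> i < N \<and> f (k + N + 2 + (num_pairs i + j))}))"
proof -
  let ?l = "k + N + 2 + N * N"
  let ?x = "map f [0..<?l]"
  have len: "length (takeWhile id (map f [a..<l])) = m"
    if "a + m < l" "\<And>i. i < m \<Longrightarrow> f (a + i)" "\<not> f (a + m)" for a m l
  proof -
    have "takeWhile id (map f [a..<l]) = take m (map f [a..<l])"
      using that by (intro takeWhile_eq_take_P_nth) auto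
    then show ?thesis using that(1) by simp
  qed
  have k: "length (takeWhile id ?x) = k" using prefix by (intro len) auto
  have x': "drop (Suc k) ?x = map f [Suc k..<?l]" by (simp add: drop_map del: upt_Suc)
  have n: "length (takeWhile id (map f [Suc k..<?l])) = N" using prefix by (intro len) auto
  have bits: "drop (Suc N) (map f [Suc k..<?l]) = map f [k + N + 2..<?l]"
    by (simp add: drop_map add.commute del: upt_Suc)
  let ?bits = "map f [k + N + 2..<?l]"
  have "num_pairs i + j < N * N" if "j < i" "i < N" for i j
  proof -
    have "num_pairs i + j < i * (i - 1) + i" using that by (intro add_le_less_mono) auto
    also have "\<dots> = i * i" using that by (cases i) auto
    also have "\<dots> \<le> N * N" using that by (intro mult_le_mono) auto
    finally show ?thesis .
  qed
  moreover have "length ?bits = N * N" by (simp only: length_map length_upt)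
  moreover have "?bits ! p = f (k + N + 2 + p)" if "p < N * N" for p
    using that by (simp del: upt_Suc)
  ultimately have "(j < i \<and> i < N \<and> num_pairs i + j < length ?bits \<and> ?bits ! (num_pairs i + j)) \<longleftrightarrow>
      (j < i \<and> i < N \<and> f (k + N + 2 + (num_pairs i + j)))" for i j by metis
  then show ?thesis unfolding decode_def Let_def k x' n bits by (simp only:)
qed

definition write_query :: "exp \<Rightarrow> prog" where
  "write_query ad = Seq write_prefix (write_matrix ad)"

lemma runs_write_query:
  assumes prep: "prepared r n A ad s" and r: "reg s 5 = S" "reg s 6 = N"
    and k: "k = num_pairs r" and N: "N = r * n * t"
    and L: "r * n + r * r + r \<le> L" "(k + N + 2) * (k + N + 2) \<le> L"
  shows "runs F Y L (write_query ad) (13 * (k + N + 2 + N * N)) s (\<lambda>s'. same entry_regs {1} s s' \<and>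
    decode (query_string s' 1 (k + N + 2 + N * N)) = (k, query_graph r n A t S))"
  unfolding write_query_def
proof (rule runs_mono[OF runs_Seq], rule runs_mono[OF runs_write_prefix[OF _ r(2) L(2)] order_refl])
  show "reg s 3 = k" using prep by (simp add: prepared_def k)
  fix s' assume s': "same {7} {1} s s' \<and> (\<forall>i<k + N + 2. arr s' 1 i \<noteq> 0 \<longleftrightarrow> i \<noteq> k \<and> i \<noteq> k + N + 1)"
  then have sm: "same {7} {1} s s'" by blast
  have r': "reg s' 5 = S" "reg s' 6 = N" using r same_reg[OF sm] by simp_all
  have prep': "prepared r n A ad s'" by (rule prepared_same[OF prep sm]) auto
  have "N * N \<le> (k + N + 2) * (k + N + 2)" by (intro mult_le_mono) auto
  then have NL: "N * N \<le> L" using L(2) by linarith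
  show "runs F Y L (write_matrix ad) (13 * (N * N) + 2) s' (\<lambda>s'. same entry_regs {1} s s' \<and>
    decode (query_string s' 1 (k + N + 2 + N * N)) = (k, query_graph r n A t S))"
  proof (rule runs_mono[OF runs_write_matrix[OF prep' r' _ k L(1) NL] order_refl])
    show "r > 0 \<and> n > 0" if "N > 0" using that N by (auto intro: gr0I)
  next
    fix s'' assume s'': "same entry_regs {1} s' s'' \<and> (\<forall>p<k + N + 2. arr s'' 1 p = arr s' 1 p) \<and>
      (\<forall>I J. J < I \<longrightarrow> I < N \<longrightarrow>
        (arr s'' 1 (k + N + 2 + (num_pairs I + J)) \<noteq> 0 \<longleftrightarrow> query_edge r n A S I J))"
    have "decode (query_string s'' 1 (k + N + 2 + N * N)) = (k, ({..<N}, {{i, j} | i j. j < i \<and>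
      i < N \<and>
        arr s'' 1 (k + N + 2 + (num_pairs i + j)) \<noteq> 0}))"
      unfolding query_string_def using s' s'' by (intro decode_query_string) simp
    also have "{{i, j} | i j. j < i \<and> i < N \<and> arr s'' 1 (k + N + 2 + (num_pairs i + j)) \<noteq> 0} =
        {{i, j} | i j. j < i \<and> i < N \<and> query_edge r n A S i j}"
      using s'' by (intro Collect_cong ex_cong1 conj_cong refl) blast
    also have "({..<N}, \<dots>) = query_graph r n A t S"
      by (simp add: query_graph_def query_edge_def N)
    finally have "decode (query_string s'' 1 (k + N + 2 + N * N)) = (k, query_graph r n A t S)" .
    then show "same entry_regs {1} s s'' \<and>
        decode (query_string s'' 1 (k + N + 2 + N * N)) = (k, query_graph r n A t S)"
      using same_trans[OF sm, of entry_regs "{1}" s'' entry_regs "{1}"] s'' by simp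
  qed
qed (simp_all)

text \<open>A crude count by vertex sets and edge sets, used to bound the length of the oracle's
  answers.\<close>

lemma count_k_trees_le:
  assumes "verts G = {..<N}" "simple_graph G"
  shows "count_k_trees k G \<le> 2 ^ (N + N * N)"
proof -
  have sub: "edges G \<subseteq> (\<lambda>(a, b). {a, b}) ` ({..<N} \<times> {..<N})"
  proof
    fix e assume "e \<in> edges G"
    then obtain a b where "e = {a, b}" "a \<in> verts G" "b \<in> verts G"
      by (rule simple_graph_edgeE[OF assms(2)])
    then show "e \<in> (\<lambda>(a, b). {a, b}) ` ({..<N} \<times> {..<N})"
      using assms(1) by (intro image_eqI[of _ _ "(a, b)"]) auto
  qed
  then have E: "card (edges G) \<le> N * N" "finite (edges G)"
    using surj_card_le[OF _ sub] finite_subset[OF sub] by (simp_all add: card_cartesian_product)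
  have "{H. subgraph H G \<and> (\<exists>T :: nat graph. k_tree k T \<and> isomorphic H T)} \<subseteq>
      Pow (verts G) \<times> Pow (edges G)" by (auto simp: subgraph_def)
  then have "count_k_trees k G \<le> card (Pow (verts G) \<times> Pow (edges G))"
    unfolding count_k_trees_def using E(2) assms(1) by (intro card_mono) auto
  also have "\<dots> = 2 ^ N * 2 ^ card (edges G)"
    using E(2) assms(1) by (simp add: card_cartesian_product card_Pow)
  also have "\<dots> \<le> 2 ^ N * 2 ^ (N * N)" using E(1) by (intro mult_le_mono power_increasing) auto
  finally show ?thesis by (simp add: power_add)
qed

section \<open>The alternating sum over sets of colour pairs\<close>

definition sum_queries :: "exp \<Rightarrow> prog" where
  "sum_queries ad =
    Seq (Assign 23 (Const 0))
   (Seq (Assign 24 (Const 0))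
   (Seq (Assign 5 (Const 0))
   (While (Sub (Cell 2 (Reg 3)) (Reg 5))
     (Seq (write_query ad)
     (Seq (Query 16 1 (Add (Add (Add (Reg 3) (Reg 6)) (Const 2)) (Mult (Reg 6) (Reg 6))))
     (Seq (If (mod_exp (Cell 3 (Reg 5)) (Const 2))
            (Assign 24 (Add (Reg 24) (Reg 16)))
            (Assign 23 (Add (Reg 23) (Reg 16))))
       (Assign 5 (Add (Reg 5) (Const 1)))))))))"

abbreviation sum_regs :: "nat set" where
  "sum_regs \<equiv> entry_regs \<union> {5, 16, 23, 24}"

text \<open>Taking the absolute difference of the two partial sums removes the sign
  \<open>(-1) ^ num_pairs r\<close> left by inclusion-exclusion.\<close>

lemma runs_sum_queries:
  assumes prep: "prepared r n A ad s" and r6: "reg s 6 = N"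
    and k: "k = num_pairs r" and N: "N = r * n * t" and r2: "r \<ge> 2"
    and A_sym: "\<And>u v. A u v \<Longrightarrow> A v u"
    and L: "r * n + r * r + r \<le> L" "(k + N + 2) * (k + N + 2) \<le> L"
    and F: "F = fst kTrees" and Y: "Y = {y. parameter y = k}"
  shows "runs F Y L (sum_queries ad) (20 * 2 ^ k * (k + N + 2 + N * N)) s (\<lambda>s'.
    same sum_regs {1} s s' \<and>
    (reg s' 23 - reg s' 24) + (reg s' 24 - reg s' 23) = num_rainbow_trees r n A t \<and>
    num_rainbow_trees r n A t \<le> 2 ^ (k + (N + N * N)))" (is "runs _ _ _ _ _ _ ?Q")
proof -
  define c where "c S = count_k_trees k (query_graph r n A t S)" for S
  define B where "B = (2 :: nat) ^ (N + N * N)"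
  define X where "X = k + N + 2 + N * N"
  let ?I = "\<lambda>i s'. reg s' 5 = i \<and> same sum_regs {1} s s' \<and>
    int (reg s' 23) - int (reg s' 24) = (\<Sum>S<i. (-1) ^ card (set_decode S) * int (c S)) \<and>
    reg s' 23 \<le> i * B \<and> reg s' 24 \<le> i * B"
  let ?e = "Sub (Cell 2 (Reg 3)) (Reg 5)"
  let ?query = "Query 16 1 (Add (Add (Add (Reg 3) (Reg 6)) (Const 2)) (Mult (Reg 6) (Reg 6)))"
  let ?if = "If (mod_exp (Cell 3 (Reg 5)) (Const 2)) (Assign 24 (Add (Reg 24) (Reg 16)))
    (Assign 23 (Add (Reg 23) (Reg 16)))"
  let ?inc = "Assign 5 (Add (Reg 5) (Const 1))"
  let ?body = "Seq (write_query ad) (Seq ?query (Seq ?if ?inc))"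
  have "k + N + 2 + N * N \<le> (k + N + 2) * (k + N + 2)" by (simp add: algebra_simps)
  then have X_L: "X \<le> L" using L(2) by (simp add: X_def)
  have exps: "k + (N + N * N) < L" using X_L by (simp add: X_def)
  have "2 ^ k * B = 2 ^ (k + (N + N * N))" by (simp add: B_def power_add)
  also have "\<dots> < 2 ^ L" using exps by simp
  finally have kB: "2 ^ k * B < 2 ^ L" .
  have c_le: "c S \<le> B" for S
    unfolding c_def B_def by (rule count_k_trees_le) (auto simp: query_graph_def simple_graph_def N)
  have B_less: "B < 2 ^ L" using exps by (simp add: B_def)
  have step: "val s' ?e \<noteq> 0 \<and> runs F Y L ?body (17 * X) s' (?I (Suc i))"
    if i: "i < 2 ^ k" and inv: "?I i s'" for i s'
  proof
    have r5: "reg s' 5 = i" and sm: "same sum_regs {1} s s'" using inv by blast+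
    have r6': "reg s' 6 = N" using r6 same_reg[OF sm] by simp
    have prep': "prepared r n A ad s'" by (rule prepared_same[OF prep sm]) auto
    then have r3': "reg s' 3 = k" and tab: "arr s' 2 k = 2 ^ k" "arr s' 3 i = card (set_decode i)"
      using i by (simp_all add: prepared_def k)
    show "val s' ?e \<noteq> 0" using i r3' r5 tab by simp
    have inc: "runs F Y L ?inc 1 s'' (?I (Suc i))"
      if "reg s'' 5 = i" "?I (Suc i) (set_reg 5 (Suc i) s'')" for s''
    proof (rule runs_Assign)
      show "Suc i < 2 ^ L" using i exps power_strict_increasing[of k L "2 :: nat"] by linarith
    qed (use that in \<open>simp_all add: simple_simps\<close>)
    have "runs F Y L ?body (13 * X + ((1 + X) + ((1 + (1 + 1)) + 1))) s' (?I (Suc i))"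
    proof (rule runs_Seq, rule runs_mono[OF runs_write_query[OF prep' r5 r6' k N L]])
      show "13 * (k + N + 2 + N * N) \<le> 13 * X" by (simp add: X_def)
      fix s'' assume s'': "same entry_regs {1} s' s'' \<and>
        decode (query_string s'' 1 (k + N + 2 + N * N)) = (k, query_graph r n A t i)"
      then have sm'': "same entry_regs {1} s' s''" by blast
      have r'': "reg s'' 3 = k" "reg s'' 6 = N" "reg s'' 5 = i" "reg s'' 23 = reg s' 23"
        "reg s'' 24 = reg s' 24"
        using r3' r6' r5 same_reg[OF sm''] by simp_all
      have arr3: "arr s'' 3 i = card (set_decode i)" using tab same_arr[OF sm''] by simp
      define s3 where "s3 = set_reg 16 (c i) s''"
      have sm3: "same sum_regs {1} s s3"
        unfolding s3_def using same_trans[OF sm sm'', of sum_regs "{1}"]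
          by (intro same_set_reg) auto
      have bounds: "reg s' 23 + c i \<le> Suc i * B" "reg s' 24 + c i \<le> Suc i * B"
        using inv c_le[of i] by auto
      have "Suc i * B \<le> 2 ^ k * B" using i by (intro mult_le_mono1) simp
      then have sums_less: "reg s' 23 + c i < 2 ^ L" "reg s' 24 + c i < 2 ^ L"
        using bounds kB by linarith+
      have le: "reg s' 23 \<le> Suc i * B" "reg s' 24 \<le> Suc i * B" using inv by auto
      show "runs F Y L (Seq ?query (Seq ?if ?inc)) ((1 + X) + ((1 + (1 + 1)) + 1)) s'' (?I (Suc i))"
      proof (rule runs_Seq, rule runs_Query[where v = "c i"])
        show "simple_exp (Add (Add (Add (Reg 3) (Reg 6)) (Const 2)) (Mult (Reg 6) (Reg 6)))"
          by (simp add: simple_simps)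
        show "val s'' (Add (Add (Add (Reg 3) (Reg 6)) (Const 2)) (Mult (Reg 6) (Reg 6))) = X"
          using r'' by (simp add: X_def)
        show "query_string s'' 1 X \<in> Y" using s'' by (simp add: Y parameter_def X_def)
        show "F (query_string s'' 1 X) = c i" using s'' by (simp add: F kTrees_def c_def X_def)
        show "c i < 2 ^ L" using c_le[of i] B_less by linarith
        show "runs F Y L (Seq ?if ?inc) (1 + (1 + 1) + 1) (set_reg 16 (c i) s'') (?I (Suc i))"
          unfolding s3_def[symmetric]
        proof (rule runs_Seq, rule runs_If)
          show "simple_exp (mod_exp (Cell 3 (Reg 5)) (Const 2))" by (simp add: simple_simps)
          assume odd: "val s3 (mod_exp (Cell 3 (Reg 5)) (Const 2)) \<noteq> 0"
          then have odd': "odd (card (set_decode i))"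
            using r'' arr3 by (simp add: val_exps s3_def state_simps odd_iff_mod_2_eq_one)
          show "runs F Y L (Assign 24 (Add (Reg 24) (Reg 16))) 1 s3 (\<lambda>s'. runs F Y L ?inc 1 s' (?I (Suc i)))"
          proof (rule runs_Assign)
            show "val s3 (Add (Reg 24) (Reg 16)) = reg s' 24 + c i"
              using r'' by (simp add: s3_def state_simps)
            show "runs F Y L ?inc 1 (set_reg 24 (reg s' 24 + c i) s3) (?I (Suc i))"
            proof (rule inc)
              show "?I (Suc i) (set_reg 5 (Suc i) (set_reg 24 (reg s' 24 + c i) s3))"
                using inv r'' odd' bounds le sm3
                by (simp add: state_simps s3_def same_set_reg)
            qed (use r'' in \<open>simp add: s3_def state_simps\<close>)
          qed (use sums_less in \<open>simp_all add: simple_simps\<close>)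
        next
          assume "val s3 (mod_exp (Cell 3 (Reg 5)) (Const 2)) = 0"
          then have even': "even (card (set_decode i))"
            using r'' arr3 by (simp add: val_exps s3_def state_simps even_iff_mod_2_eq_zero)
          show "runs F Y L (Assign 23 (Add (Reg 23) (Reg 16))) 1 s3 (\<lambda>s'. runs F Y L ?inc 1 s' (?I (Suc i)))"
          proof (rule runs_Assign)
            show "val s3 (Add (Reg 23) (Reg 16)) = reg s' 23 + c i"
              using r'' by (simp add: s3_def state_simps)
            show "runs F Y L ?inc 1 (set_reg 23 (reg s' 23 + c i) s3) (?I (Suc i))"
            proof (rule inc)
              show "?I (Suc i) (set_reg 5 (Suc i) (set_reg 23 (reg s' 23 + c i) s3))"
                using inv r'' even' bounds le sm3
                by (simp add: state_simps s3_def same_set_reg)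
            qed (use r'' in \<open>simp add: s3_def state_simps\<close>)
          qed (use sums_less in \<open>simp_all add: simple_simps\<close>)
        qed
      qed
    qed
    then show "runs F Y L ?body (17 * X) s' (?I (Suc i))"
      by (rule runs_mono) (simp_all add: X_def)
  qed
  define s0 where "s0 = set_reg 5 0 (set_reg 24 0 (set_reg 23 0 s))"
  have loop: "runs F Y L (While ?e ?body) (2 ^ k * (17 * X + 1) + 1) s0 (?I (2 ^ k))"
  proof (rule runs_While[where I = ?I])
    show "?I 0 s0" by (simp add: s0_def state_simps same_intros)
  next
    fix s' assume I: "?I (2 ^ k) s'"
    then have sm: "same sum_regs {1} s s'" by blast
    have "prepared r n A ad s'" by (rule prepared_same[OF prep sm]) auto
    then have "reg s' 3 = k" "arr s' 2 k = 2 ^ k" by (simp_all add: prepared_def k)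
    then show "val s' ?e = 0 \<and> ?I (2 ^ k) s'" using I by simp
  next
    show "simple_exp ?e" by (simp add: simple_simps)
  qed (use step in blast)
  have Q: "?Q s'" if I: "?I (2 ^ k) s'" for s'
  proof -
    have "int (reg s' 23) - int (reg s' 24) = (-1) ^ k * int (num_rainbow_trees r n A t)"
      using I inclusion_exclusion_query_graphs[OF r2 A_sym, where n = n and t = t]
        by (simp add: c_def k)
    then have abs: "\<bar>int (reg s' 23) - int (reg s' 24)\<bar> = int (num_rainbow_trees r n A t)"
      by (simp add: abs_mult)
    then have num: "(reg s' 23 - reg s' 24) + (reg s' 24 - reg s' 23) = num_rainbow_trees r n A t"
      by linarith
    have "num_rainbow_trees r n A t \<le> 2 ^ k * B" using I unfolding num[symmetric] by linarith
    then show ?thesis using I num by (simp add: B_def power_add)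
  qed
  have "runs F Y L (sum_queries ad) (1 + (1 + (1 + (2 ^ k * (17 * X + 1) + 1)))) s (?I (2 ^ k))"
    unfolding sum_queries_def
  proof (rule runs_Assign_Seq[where v = 0], simp add: simple_simps, simp, simp,
      rule runs_Assign_Seq[where v = 0], simp add: simple_simps, simp, simp,
      rule runs_Assign_Seq[where v = 0], simp add: simple_simps, simp, simp)
    show "runs F Y L (While ?e ?body) (2 ^ k * (17 * X + 1) + 1)
      (set_reg 5 0 (set_reg 24 0 (set_reg 23 0 s))) (?I (2 ^ k))"
      using loop unfolding s0_def .
  qed
  moreover have "1 + (1 + (1 + (2 ^ k * (17 * X + 1) + 1))) \<le> 20 * 2 ^ k * X"
  proof -
    define P where "P = 2 ^ k * X"
    have "1 * 2 \<le> P" unfolding P_def by (intro mult_le_mono) (auto simp: X_def)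
    moreover have "2 ^ k * 2 \<le> P" unfolding P_def by (intro mult_le_mono2) (simp add: X_def)
    moreover have "2 ^ k * (17 * X + 1) = 17 * P + 2 ^ k" "20 * 2 ^ k * X = 20 * P"
      by (simp_all add: P_def algebra_simps)
    ultimately show ?thesis by linarith
  qed
  ultimately show ?thesis unfolding X_def[symmetric] by (rule runs_mono) (rule Q)
qed

section \<open>Extrapolation to zero copies\<close>

definition power_prog :: prog where
  "power_prog =
    Seq (Assign 17 (Const 1))
   (Seq (Assign 7 (Const 0))
   (While (Sub (Reg 1) (Reg 7))
     (Seq (Assign 17 (Mult (Reg 17) (Reg 4))) (Assign 7 (Add (Reg 7) (Const 1))))))"

lemma runs_power_prog:
  assumes r: "reg s 1 = r" "reg s 4 = t" and L: "t * r < L" "r < L" and t: "t \<ge> 1"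
  shows "runs F Y L power_prog (3 * r + 3) s (\<lambda>s'. same {7, 17} {} s s' \<and> reg s' 17 = t ^ r)"
proof -
  let ?I = "\<lambda>i s'. same {7, 17} {} s s' \<and> reg s' 17 = t ^ i \<and> reg s' 7 = i"
  let ?e = "Sub (Reg 1) (Reg 7)"
  let ?body = "Seq (Assign 17 (Mult (Reg 17) (Reg 4))) (Assign 7 (Add (Reg 7) (Const 1)))"
  have pow_less: "t ^ i < 2 ^ L" if "i \<le> r" for i
  proof -
    \<comment> \<open>The estimate \<open>t \<le> 2 ^ t\<close> reduces the size bound to
      \<open>t * r < L\<close>.\<close>
    have "t ^ i \<le> (2 ^ t) ^ i" using less_exp[of t] by (intro power_mono) auto
    also have "\<dots> = 2 ^ (t * i)" by (simp add: power_mult)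
    also have "\<dots> \<le> 2 ^ (t * r)" using that by (intro power_increasing) auto
    also have "\<dots> < 2 ^ L" using L by simp
    finally show ?thesis .
  qed
  have step: "val s' ?e \<noteq> 0 \<and> runs F Y L ?body 2 s' (?I (Suc i))" if i: "i < r" and inv: "?I i s'"
    for i s'
  proof
    have sm: "same {7, 17} {} s s'" using inv by blast
    have r': "reg s' 1 = r" "reg s' 4 = t" using r same_reg[OF sm] by simp_all
    show "val s' ?e \<noteq> 0" using i inv r' by simp
    have "Suc i < 2 ^ L" using i L less_exp[of L] by linarith
    then show "runs F Y L ?body 2 s' (?I (Suc i))"
      using inv r' pow_less[of "Suc i"] i
      by (intro runs_mono[OF runs_Assign_Seq[where v = "t ^ Suc i"], OF _ _ _ runs_Assign[where v =
        "Suc i"]])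
        (simp_all add: simple_simps state_simps same_set_reg mult.commute)
  qed
  have "runs F Y L (While ?e ?body) (r * (2 + 1) + 1) (set_reg 7 0 (set_reg 17 1 s)) (?I r)"
  proof (rule runs_While[where I = ?I])
    show "?I 0 (set_reg 7 0 (set_reg 17 1 s))" by (simp add: state_simps same_intros)
  next
    fix s' assume I: "?I r s'"
    then have sm: "same {7, 17} {} s s'" by blast
    then show "val s' ?e = 0 \<and> ?I r s'" using I r same_reg[OF sm] by simp
  next
    show "simple_exp ?e" by (simp add: simple_simps)
  qed (use step in blast)
  moreover have "Suc 0 < 2 ^ L" using L(2) one_less_power[of "2 :: nat" L] by simp
  ultimately have "runs F Y L power_prog (1 + (1 + (r * (2 + 1) + 1))) s (?I r)"
    unfolding power_prog_def using L
    by (intro runs_Assign_Seq[where v = 1, OF _ _ _ runs_Assign_Seq[where v = 0]])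
      (simp_all add: simple_simps)
  then show ?thesis by (rule runs_mono) auto
qed

text \<open>Partial sums of the extrapolation; \<open>m = num_pairs r + 1\<close> gives the full
  sum.\<close>

definition clique_signal :: "nat \<Rightarrow> nat \<Rightarrow> (nat \<Rightarrow> nat \<Rightarrow> bool) \<Rightarrow> nat \<Rightarrow> int" where
  "clique_signal r n A m = (\<Sum>j = 1..m. (-1) ^ (j + 1) * int (Suc (num_pairs r) choose j) *
     int (num_rainbow_trees r n A j div j ^ r))"

definition interpolate_step :: "exp \<Rightarrow> prog" where
  "interpolate_step ad =
    Seq (Assign 6 (Mult (Mult (Reg 1) (Reg 2)) (Reg 4)))
   (Seq (sum_queries ad)
   (Seq power_prog
   (Seq (Assign 17 (Div (diff_exp (Reg 23) (Reg 24)) (Reg 17)))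
   (Seq (If (mod_exp (Reg 4) (Const 2))
          (Assign 19 (Add (Reg 19) (Mult (Reg 18) (Reg 17))))
          (Assign 20 (Add (Reg 20) (Mult (Reg 18) (Reg 17)))))
   (Seq (Assign 18 (Div (Mult (Reg 18) (Sub (Add (Reg 3) (Const 1)) (Reg 4))) (Add (Reg 4)
     (Const 1))))
     (Assign 4 (Add (Reg 4) (Const 1))))))))"

definition interpolate :: "exp \<Rightarrow> prog" where
  "interpolate ad =
    Seq (Assign 19 (Const 0))
   (Seq (Assign 20 (Const 0))
   (Seq (Assign 18 (Add (Reg 3) (Const 1)))
   (Seq (Assign 4 (Const 1))
   (Seq (While (Sub (Add (Reg 3) (Const 2)) (Reg 4)) (interpolate_step ad))
     (Assign 16 (diff_exp (Reg 19) (Reg 20)))))))"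

abbreviation interpolate_regs :: "nat set" where
  "interpolate_regs \<equiv> sum_regs \<union> {4, 6, 17, 18, 19, 20}"

text \<open>Absorption makes the product a multiple of \<open>j + 1\<close>; this is how register
  \<open>18\<close> moves to the next coefficient without a table.\<close>

lemma binomial_step: "(n choose j) * (n - j) div (j + 1) = n choose Suc j"
proof -
  have "(n choose j) * (n - j) = (n choose Suc j) * (j + 1)"
    using binomial_absorb_comp[of n j] binomial_absorption[of j n] by (simp add: mult.commute)
  then show ?thesis by (metis nonzero_mult_div_cancel_right add_is_0 one_neq_zero)
qed

lemma binomial_le_pow2: "n choose j \<le> 2 ^ n"
proof (cases "j \<le> n")
  case True
  have "n choose j \<le> (\<Sum>i\<le>n. n choose i)" using True by (intro member_le_sum) auto
  then show ?thesis by (simp add: choose_row_sum)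
qed (simp add: binomial_eq_0)

text \<open>After \<open>i\<close> rounds the next number of copies is \<open>Suc i\<close>;
  \<open>E\<close> bounds what one round can add to an accumulator.\<close>

definition interpolating ::
    "nat \<Rightarrow> nat \<Rightarrow> (nat \<Rightarrow> nat \<Rightarrow> bool) \<Rightarrow> nat \<Rightarrow> nat \<Rightarrow> state \<Rightarrow> bool" where
  "interpolating r n A E i s \<longleftrightarrow> reg s 4 = Suc i \<and> reg s 18 = (num_pairs r + 1) choose Suc i \<and>
    int (reg s 19) - int (reg s 20) = clique_signal r n A i \<and> reg s 19 \<le> i * E \<and> reg s 20 \<le> i * E"

text \<open>\<open>M\<close> is the order of the largest queried graph. \<open>E\<close> is
  \<open>2 ^ (k + 1)\<close>, a bound on the binomial coefficient, times
  \<open>2 ^ (k + (M + M * M))\<close>, a bound on the number of rainbow trees.\<close>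

lemma runs_interpolate_step:
  assumes prep: "prepared r n A ad s"
    and k: "k = num_pairs r" and r2: "r \<ge> 2"
    and A_sym: "\<And>u v. A u v \<Longrightarrow> A v u"
    and M: "M = r * n * (k + 1)"
    and L: "r * n + r * r + r + (k + 2) * (r + 2) + (k + M + 4) * (k + M + 4) \<le> L"
    and F: "F = fst kTrees" and Y: "Y = {y. parameter y = k}"
    and E: "E = 2 ^ (2 * k + 1 + (M + M * M))" and i: "i < k + 1"
      and inv: "interpolating r n A E i s"
  shows "runs F Y L (interpolate_step ad) (20 * 2 ^ k * (k + M + 2 + M * M) + 3 * r + 12) s (\<lambda>s'.
    same interpolate_regs {1} s s' \<and> interpolating r n A E (Suc i) s')"
    (is "runs _ _ _ _ ?T _ ?Q")
proof (rule runs_bounded)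
  assume b: "bounded L s"
  have r: "reg s 1 = r" "reg s 2 = n" "reg s 3 = k" using prep by (simp_all add: prepared_def k)
  have acc: "reg s 4 = Suc i" "reg s 18 = (k + 1) choose Suc i"
    "int (reg s 19) - int (reg s 20) = clique_signal r n A i" "reg s 19 \<le> i * E" "reg s 20 \<le> i * E"
    using inv by (simp_all add: interpolating_def k)
  define t where "t = Suc i"
  define N where "N = r * n * t"
  define R where "R = num_rainbow_trees r n A t"
  define q where "q = R div t ^ r"
  define C where "C = (k + 1) choose t"
  have reg4: "reg s 4 = t" using acc by (simp add: t_def)
  have NM: "N \<le> M" unfolding N_def M t_def using i by (intro mult_le_mono2) simp
  have N_L: "(k + N + 2) * (k + N + 2) \<le> L"
  proof -
    have "(k + N + 2) * (k + N + 2) \<le> (k + M + 4) * (k + M + 4)" using NM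
      by (intro mult_le_mono) auto
    then show ?thesis using L by linarith
  qed
  have L1: "r * n + r * r + r \<le> L" using L by linarith
  have small: "x < 2 ^ L" if "x \<le> L" for x using that less_exp[of L] by linarith
  have kr: "k + 2 \<le> (k + 2) * (r + 2)" "r + 2 \<le> (k + 2) * (r + 2)" "t * r \<le> (k + 2) * (r + 2)"
  proof -
    show "t * r \<le> (k + 2) * (r + 2)" using i unfolding t_def by (intro mult_le_mono) auto
  qed simp_all
  have N_less: "N < 2 ^ L"
  proof (rule small)
    have "k + N + 2 \<le> (k + N + 2) * (k + N + 2)" by simp
    then show "N \<le> L" using N_L by linarith
  qed
  \<comment> \<open>The square in the bound on \<open>L\<close> supplies \<open>M * M\<close>, so
    that \<open>k + 1\<close> rounds of size \<open>E\<close> still fit into \<open>L\<close>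
    digits.\<close>
  have "(k + M + 4) * (k + M + 4) = k * k + 8 * k + 16 + 2 * k * M + 8 * M + M * M"
    by (simp add: algebra_simps)
  then have expo: "3 * k + 2 + (M + M * M) < L" using L by linarith
  have E_less: "2 ^ (k + 1) * E < 2 ^ L"
  proof -
    have "2 ^ (k + 1) * E = 2 ^ (3 * k + 2 + (M + M * M))"
      unfolding E power_add[symmetric] by (rule arg_cong[of _ _ "(^) 2"]) simp
    also have "\<dots> < 2 ^ L" by (rule power_strict_increasing[OF expo]) simp
    finally show ?thesis .
  qed
  have "1 \<le> (k + M + 4) * (k + M + 4)" by simp
  then have kr_L: "(k + 2) * (r + 2) < L" using L by linarith
  have "t * r < L" using kr(3) kr_L by (rule le_less_trans)
  have "r < L" using kr(2) kr_L by linarith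
  define s1 where "s1 = set_reg 6 N s"
  have sm1: "same {6} {} s s1" by (simp add: s1_def same_intros)
  have prep1: "prepared r n A ad s1" by (rule prepared_same[OF prep sm1]) auto
  have r1: "reg s1 1 = r" "reg s1 2 = n" "reg s1 3 = k" "reg s1 6 = N"
    using r by (simp_all add: s1_def state_simps)
  have time: "20 * 2 ^ k * (k + N + 2 + N * N) \<le> 20 * 2 ^ k * (k + M + 2 + M * M)"
    using NM by (intro mult_le_mono2 add_mono mult_le_mono) auto
  let ?div = "Assign 17 (Div (diff_exp (Reg 23) (Reg 24)) (Reg 17))"
  let ?if = "If (mod_exp (Reg 4) (Const 2)) (Assign 19 (Add (Reg 19) (Mult (Reg 18) (Reg 17))))
    (Assign 20 (Add (Reg 20) (Mult (Reg 18) (Reg 17))))"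
  let ?binom = "Assign 18 (Div (Mult (Reg 18) (Sub (Add (Reg 3) (Const 1)) (Reg 4))) (Add (Reg 4) (Const 1)))"
  let ?inc = "Assign 4 (Add (Reg 4) (Const 1))"
  have signal: "clique_signal r n A (Suc i) = clique_signal r n A i + (-1) ^ (t + 1) * int C * int q"
    by (simp add: clique_signal_def t_def C_def q_def R_def k)
  have final: "runs F Y L (Seq ?binom ?inc) (1 + 1) s' ?Q"
    if sm: "same interpolate_regs {1} s s'" and s': "reg s' 3 = k" "reg s' 4 = t" "reg s' 18 = C"
      "int (reg s' 19) - int (reg s' 20) = clique_signal r n A (Suc i)"
      "reg s' 19 \<le> Suc i * E" "reg s' 20 \<le> Suc i * E" for s'
  proof (rule runs_Assign_Seq)
    show "val s' (Div (Mult (Reg 18) (Sub (Add (Reg 3) (Const 1)) (Reg 4))) (Add (Reg 4) (Const 1))) = (k + 1) choose Suc t"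
      using s' binomial_step[of "k + 1" t] by (simp add: C_def)
    have "(k + 1) choose Suc t \<le> 2 ^ (k + 1)" by (rule binomial_le_pow2)
    also have "\<dots> < 2 ^ L" by (rule power_strict_increasing) (use expo in auto)
    finally show "(k + 1) choose Suc t < 2 ^ L" .
    show "runs F Y L ?inc 1 (set_reg 18 ((k + 1) choose Suc t) s') ?Q"
    proof (rule runs_Assign)
      show "val (set_reg 18 ((k + 1) choose Suc t) s') (Add (Reg 4) (Const 1)) = Suc t"
        using s' by (simp add: state_simps)
      show "Suc t < 2 ^ L" using i kr(1) kr_L by (intro small) (simp add: t_def)
      show "?Q (set_reg 4 (Suc t) (set_reg 18 ((k + 1) choose Suc t) s'))"
        using s' sm by (simp add: interpolating_def k state_simps t_def same_set_reg)
    qed (simp add: simple_simps)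
  qed (simp add: simple_simps)
  have "runs F Y L (interpolate_step ad) (1 + (20 * 2 ^ k * (k + M + 2 + M * M) + (3 * r + 3 +
      (1 + ((1 + (1 + 1)) + (1 + 1)))))) s ?Q"
    unfolding interpolate_step_def
  proof (rule runs_Assign_Seq)
    show "val s (Mult (Mult (Reg 1) (Reg 2)) (Reg 4)) = N" using r reg4 by (simp add: N_def)
    show "runs F Y L (Seq (sum_queries ad) (Seq power_prog (Seq ?div (Seq ?if (Seq ?binom ?inc)))))
      (20 * 2 ^ k * (k + M + 2 + M * M) + (3 * r + 3 + (1 + ((1 + (1 + 1)) + (1 + 1)))))
        (set_reg 6 N s) ?Q"
      unfolding s1_def[symmetric]
    proof (rule runs_Seq, rule runs_mono[OF runs_sum_queries[OF prep1 r1(4) k N_def r2 A_sym L1 N_L F Y] time])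
      fix s2 assume s2: "same sum_regs {1} s1 s2 \<and>
        (reg s2 23 - reg s2 24) + (reg s2 24 - reg s2 23) = num_rainbow_trees r n A t \<and>
        num_rainbow_trees r n A t \<le> 2 ^ (k + (N + N * N))"
      then have sm2: "same sum_regs {1} s1 s2" by blast
      have r2: "reg s2 1 = r" "reg s2 4 = t" "reg s2 3 = k" "reg s2 18 = C" "reg s2 19 = reg s 19"
        "reg s2 20 = reg s 20"
        using same_reg[OF sm2] r1 reg4 acc(2) by (simp_all add: s1_def state_simps C_def t_def)
      have "R \<le> 2 ^ (k + (N + N * N))" using s2 by (simp add: R_def)
      also have "\<dots> \<le> 2 ^ (k + (M + M * M))" using NM
        by (intro power_increasing add_mono mult_le_mono) auto
      finally have R: "R \<le> 2 ^ (k + (M + M * M))" .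
      have q: "q \<le> 2 ^ (k + (M + M * M))" using R div_le_dividend[of R "t ^ r"] unfolding q_def
        by linarith
      have "C \<le> 2 ^ (k + 1)" unfolding C_def by (rule binomial_le_pow2)
      then have "C * q \<le> 2 ^ (k + 1) * 2 ^ (k + (M + M * M))" using q by (intro mult_le_mono)
      also have "\<dots> = E" unfolding E power_add[symmetric] by (rule arg_cong[of _ _ "(^) 2"]) simp
      finally have Cq: "C * q \<le> E" .
      have "Suc i \<le> 2 ^ (k + 1)" using i less_exp[of "k + 1"] by linarith
      then have "Suc i * E \<le> 2 ^ (k + 1) * E" by (rule mult_le_mono1)
      then have acc_less: "Suc i * E < 2 ^ L" using E_less by linarith
      have acc': "reg s 19 + C * q \<le> Suc i * E" "reg s 20 + C * q \<le> Suc i * E"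
        "reg s 19 \<le> Suc i * E" "reg s 20 \<le> Suc i * E"
        using acc(4,5) Cq by simp_all
      show "runs F Y L (Seq power_prog (Seq ?div (Seq ?if (Seq ?binom ?inc))))
        (3 * r + 3 + (1 + ((1 + (1 + 1)) + (1 + 1)))) s2 ?Q"
      proof (rule runs_Seq, rule runs_mono[OF runs_power_prog[OF r2(1,2) \<open>t * r < L\<close> \<open>r < L\<close>] order_refl])
        show "1 \<le> t" by (simp add: t_def)
        fix s3 assume s3: "same {7, 17} {} s2 s3 \<and> reg s3 17 = t ^ r"
        then have sm3: "same {7, 17} {} s2 s3" by blast
        have r3: "reg s3 3 = k" "reg s3 4 = t" "reg s3 18 = C" "reg s3 19 = reg s 19"
          "reg s3 20 = reg s 20"
          "reg s3 23 = reg s2 23" "reg s3 24 = reg s2 24"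
          using same_reg[OF sm3] r2 by simp_all
        have "same interpolate_regs {1} s s1" by (simp add: s1_def same_intros)
        from same_trans[OF this sm2, of interpolate_regs "{1}"]
        have "same interpolate_regs {1} s s2" by simp
        from same_trans[OF this sm3, of interpolate_regs "{1}"]
        have sm: "same interpolate_regs {1} s s3" by simp
        show "runs F Y L (Seq ?div (Seq ?if (Seq ?binom ?inc))) (1 + ((1 + (1 + 1)) + (1 + 1))) s3 ?Q"
        proof (rule runs_Assign_Seq)
          show "val s3 (Div (diff_exp (Reg 23) (Reg 24)) (Reg 17)) = q"
            using s2 s3 r3 by (simp add: val_exps q_def R_def)
          show "q < 2 ^ L"
          proof (rule le_less_trans[OF q])
            show "2 ^ (k + (M + M * M)) < (2 :: nat) ^ L"
              by (rule power_strict_increasing) (use expo in auto)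
          qed
          define s4 where "s4 = set_reg 17 q s3"
          have sm4: "same interpolate_regs {1} s s4" using sm by (simp add: s4_def same_set_reg)
          have r4: "reg s4 3 = k" "reg s4 4 = t" "reg s4 18 = C" "reg s4 19 = reg s 19"
            "reg s4 20 = reg s 20"
            "reg s4 17 = q"
            using r3 by (simp_all add: s4_def state_simps)
          show "runs F Y L (Seq ?if (Seq ?binom ?inc)) ((1 + (1 + 1)) + (1 + 1)) (set_reg 17 q s3) ?Q"
            unfolding s4_def[symmetric]
          proof (rule runs_Seq, rule runs_If)
            assume "val s4 (mod_exp (Reg 4) (Const 2)) \<noteq> 0"
            then have odd: "odd t" using r4 by (simp add: val_exps odd_iff_mod_2_eq_one)
            show "runs F Y L (Assign 19 (Add (Reg 19) (Mult (Reg 18) (Reg 17)))) 1 s4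
              (\<lambda>s'. runs F Y L (Seq ?binom ?inc) (1 + 1) s' ?Q)"
            proof (rule runs_Assign)
              show "val s4 (Add (Reg 19) (Mult (Reg 18) (Reg 17))) = reg s 19 + C * q" using r4
                by simp
              show "reg s 19 + C * q < 2 ^ L" using acc' acc_less by linarith
              show "runs F Y L (Seq ?binom ?inc) (1 + 1) (set_reg 19 (reg s 19 + C * q) s4) ?Q"
                by (rule final) (use r4 acc' acc(3) odd sm4 in \<open>simp_all add: state_simps same_set_reg signal\<close>)
            qed (simp add: simple_simps)
          next
            assume "val s4 (mod_exp (Reg 4) (Const 2)) = 0"
            then have even: "even t" using r4 by (simp add: val_exps even_iff_mod_2_eq_zero)
            show "runs F Y L (Assign 20 (Add (Reg 20) (Mult (Reg 18) (Reg 17)))) 1 s4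
              (\<lambda>s'. runs F Y L (Seq ?binom ?inc) (1 + 1) s' ?Q)"
            proof (rule runs_Assign)
              show "val s4 (Add (Reg 20) (Mult (Reg 18) (Reg 17))) = reg s 20 + C * q" using r4
                by simp
              show "reg s 20 + C * q < 2 ^ L" using acc' acc_less by linarith
              show "runs F Y L (Seq ?binom ?inc) (1 + 1) (set_reg 20 (reg s 20 + C * q) s4) ?Q"
                by (rule final) (use r4 acc' acc(3) even sm4 in \<open>simp_all add: state_simps same_set_reg signal\<close>)
            qed (simp add: simple_simps)
          qed (simp add: simple_simps)
        qed (simp add: simple_simps)
      qed
    qed
  qed (use N_less in \<open>simp_all add: simple_simps\<close>)
  then show "runs F Y L (interpolate_step ad) ?T s ?Q" by (rule runs_mono) simp_all
qed

text \<open>The absolute value suffices: the sign belongs to the normalising factor, which the final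
  division cancels.\<close>

lemma runs_interpolate:
  assumes prep: "prepared r n A ad s"
    and k: "k = num_pairs r" and r2: "r \<ge> 2"
    and A_sym: "\<And>u v. A u v \<Longrightarrow> A v u"
    and M: "M = r * n * (k + 1)"
    and L: "r * n + r * r + r + (k + 2) * (r + 2) + (k + M + 4) * (k + M + 4) \<le> L"
    and F: "F = fst kTrees" and Y: "Y = {y. parameter y = k}"
  shows "runs F Y L (interpolate ad) ((k + 1) * (20 * 2 ^ k * (k + M + 2 + M * M) + 3 * r + 13) + 6) s (\<lambda>s'.
    same interpolate_regs {1} s s' \<and> int (reg s' 16) = \<bar>clique_signal r n A (k + 1)\<bar>)"
    (is "runs _ _ _ _ ?T _ ?Q")
proof -
  define E where "E = (2 :: nat) ^ (2 * k + 1 + (M + M * M))"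
  let ?body_time = "20 * 2 ^ k * (k + M + 2 + M * M) + 3 * r + 12"
  let ?I = "\<lambda>i s'. same interpolate_regs {1} s s' \<and> interpolating r n A E i s'"
  have r: "reg s 3 = k" using prep by (simp add: prepared_def k)
  let ?e = "Sub (Add (Reg 3) (Const 2)) (Reg 4)"
  let ?out = "Assign 16 (diff_exp (Reg 19) (Reg 20))"
  have small: "x < 2 ^ L" if "x \<le> L" for x using that less_exp[of L] by linarith
  have k_less: "k + 1 < 2 ^ L"
  proof (rule small)
    have "k + 2 \<le> (k + 2) * (r + 2)" by simp
    then show "k + 1 \<le> L" using L by linarith
  qed
  then have one_less: "1 < (2 :: nat) ^ L" using r2 k by linarith
  have "(k + M + 4) * (k + M + 4) = k * k + 8 * k + 16 + 2 * k * M + 8 * M + M * M"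
    by (simp add: algebra_simps)
  then have expo: "3 * k + 3 + (M + M * M) < L" using L by linarith
  have step: "val s' ?e \<noteq> 0 \<and> runs F Y L (interpolate_step ad) ?body_time s' (?I (Suc i))"
    if i: "i < k + 1" and inv: "?I i s'" for i s'
  proof
    have sm: "same interpolate_regs {1} s s'" using inv by blast
    have prep': "prepared r n A ad s'" by (rule prepared_same[OF prep sm]) auto
    have "reg s' 3 = k" using r same_reg[OF sm] by simp
    then show "val s' ?e \<noteq> 0" using i inv by (simp add: interpolating_def)
    show "runs F Y L (interpolate_step ad) ?body_time s' (?I (Suc i))"
    proof (rule runs_mono[OF runs_interpolate_step[OF prep' k r2 A_sym M L F Y E_def i] order_refl])
      show "interpolating r n A E i s'" using inv by blast
      fix s'' assume "same interpolate_regs {1} s' s'' \<and> interpolating r n A E (Suc i) s''"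
      then show "?I (Suc i) s''"
        using same_trans[OF sm, of interpolate_regs "{1}" s'' interpolate_regs "{1}"] by simp
    qed
  qed
  define s0 where "s0 = set_reg 4 1 (set_reg 18 (k + 1) (set_reg 20 0 (set_reg 19 0 s)))"
  have loop: "runs F Y L (While ?e (interpolate_step ad)) ((k + 1) * (?body_time + 1) + 1) s0 (\<lambda>s'. runs F Y L ?out 1 s' ?Q)"
  proof (rule runs_While[where I = ?I])
    show "?I 0 s0" by (simp add: s0_def state_simps same_intros clique_signal_def interpolating_def k)
  next
    fix s' assume I: "?I (k + 1) s'"
    then have sm: "same interpolate_regs {1} s s'" by blast
    have "reg s' 3 = k" using r same_reg[OF sm] by simp
    moreover have "runs F Y L ?out 1 s' ?Q"
    proof (rule runs_bounded)
      assume b: "bounded L s'"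
      define v where "v = (reg s' 19 - reg s' 20) + (reg s' 20 - reg s' 19)"
      have "reg s' 19 < 2 ^ L" "reg s' 20 < 2 ^ L" using b by (auto simp: bounded_def)
      then have v_less: "v < 2 ^ L" unfolding v_def by linarith
      have v: "int v = \<bar>clique_signal r n A (k + 1)\<bar>" using I unfolding v_def interpolating_def
        by linarith
      show "runs F Y L ?out 1 s' ?Q"
        by (rule runs_Assign[where v = v])
          (use v v_less sm in \<open>simp_all add: simple_simps v_def state_simps same_set_reg\<close>)
    qed
    ultimately show "val s' ?e = 0 \<and> runs F Y L ?out 1 s' ?Q" using I
      by (simp add: interpolating_def)
  next
    show "simple_exp ?e" by (simp add: simple_simps)
  qed (use step in blast)
  have "runs F Y L (interpolate ad) (1 + (1 + (1 + (1 + ((k + 1) * (?body_time + 1) + 1 + 1))))) s ?Q"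
    unfolding interpolate_def
  proof (rule runs_Assign_Seq[where v = 0], simp add: simple_simps, simp, simp,
      rule runs_Assign_Seq[where v = 0], simp add: simple_simps, simp, simp,
      rule runs_Assign_Seq[where v =
        "k + 1"], simp add: simple_simps, simp add: r state_simps, rule k_less,
      rule runs_Assign_Seq[where v = 1], simp add: simple_simps, simp, rule one_less)
    show "runs F Y L (Seq (While ?e (interpolate_step ad)) ?out) ((k + 1) * (?body_time + 1) + 1 + 1)
      (set_reg 4 1 (set_reg 18 (k + 1) (set_reg 20 0 (set_reg 19 0 s)))) ?Q"
      unfolding s0_def[symmetric] by (rule runs_Seq[OF loop])
  qed
  then show ?thesis by (rule runs_mono) simp_all
qed

section \<open>The reduction\<close>

text \<open>Total access to bits: cells beyond the input are \<open>0\<close>, just as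
  \<open>decode\<close> counts missing bits as \<open>0\<close>.\<close>

definition set_bit :: "bool list \<Rightarrow> nat \<Rightarrow> bool" where
  "set_bit x p \<longleftrightarrow> p < length x \<and> x ! p"

lemma arr_init_string: "arr (init_string x) 0 p = (if set_bit x p then 1 else 0)"
  by (simp add: init_string_def set_bit_def)

lemma set_bit_takeWhile:
  "i < length (takeWhile id (drop a x)) \<Longrightarrow> set_bit x (a + i)"
  "\<not> set_bit x (a + length (takeWhile id (drop a x)))"
proof -
  show "set_bit x (a + i)" if i: "i < length (takeWhile id (drop a x))"
  proof -
    have "takeWhile id (drop a x) ! i" using set_takeWhileD[OF nth_mem[OF i]] by simp
    moreover have "a + i < length x" using i length_takeWhile_le[of id "drop a x"] by simp
    ultimately show ?thesis using i by (simp add: set_bit_def takeWhile_nth)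
  qed
  show "\<not> set_bit x (a + length (takeWhile id (drop a x)))"
    using nth_length_takeWhile[of id "drop a x"] by (auto simp: set_bit_def)
qed

text \<open>Reads a unary number; the zero cells behind the input stop the loop even when the
  separator is missing.\<close>

definition scan :: "exp \<Rightarrow> nat \<Rightarrow> prog" where
  "scan e q = While (Cell 0 e) (Assign q (Add (Reg q) (Const 1)))"

lemma runs_scan:
  assumes q: "reg s q = 0" and e: "simple_exp (Cell 0 e)"
    and val: "\<And>s' i. same {q} {} s s' \<Longrightarrow> reg s' q = i \<Longrightarrow> val s' e = a + i"
    and arr: "\<And>p. arr s 0 p = (if set_bit x p then 1 else 0)"
    and m: "m = length (takeWhile id (drop a x))" and L: "m < L"
  shows "runs F Y L (scan e q) (2 * m + 1) s (\<lambda>s'. same {q} {} s s' \<and> reg s' q = m)"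
proof -
  let ?I = "\<lambda>i s'. same {q} {} s s' \<and> reg s' q = i"
  have "runs F Y L (scan e q) (m * (1 + 1) + 1) s (?I m)"
    unfolding scan_def
  proof (rule runs_While[where I = ?I])
    show "?I 0 s" using q by (simp add: same_refl)
  next
    fix i s' assume i: "i < m" and I: "?I i s'"
    have "val s' (Cell 0 e) \<noteq> 0"
      using I val arr same_arr[of "{q}" "{}" s s' 0] set_bit_takeWhile(1)[of i a x] i m by simp
    moreover have "Suc i < 2 ^ L" using i L less_exp[of L] by linarith
    then have "runs F Y L (Assign q (Add (Reg q) (Const 1))) 1 s' (?I (Suc i))"
      using I by (intro runs_Assign[where v = "Suc i"])
        (simp_all add: simple_simps state_simps same_set_reg)
    ultimately show "val s' (Cell 0 e) \<noteq> 0 \<and>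
      runs F Y L (Assign q (Add (Reg q) (Const 1))) 1 s' (?I (Suc i))"
      by blast
  next
    fix s' assume I: "?I m s'"
    then show "val s' (Cell 0 e) = 0 \<and> ?I m s'"
      using val arr same_arr[of "{q}" "{}" s s' 0] set_bit_takeWhile(2)[of x a] m by simp
  qed (rule e)
  then show ?thesis by (rule runs_mono) simp_all
qed

text \<open>Splitting off the lowest binary digit gives the recurrence by which
  \<open>tables\<close> counts ones.\<close>

lemma card_set_decode: "card (set_decode S) = card (set_decode (S div 2)) + S mod 2"
proof -
  have eq: "set_decode S = (if odd S then {0} else {}) \<union> Suc ` set_decode (S div 2)"
  proof (rule set_eqI)
    fix i show "i \<in> set_decode S \<longleftrightarrow> i \<in> (if odd S then {0} else {}) \<union> Suc ` set_decode (S div 2)"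
      by (cases i) auto
  qed
  have "card (set_decode S) = card (if odd S then {0 :: nat} else {}) + card (Suc ` set_decode (S div 2))"
    unfolding eq by (rule card_Un_disjoint) auto
  then show ?thesis by (auto simp: card_image odd_iff_mod_2_eq_one)
qed

definition tables :: prog where
  "tables =
    Seq (Store 2 (Const 0) (Const 1))
   (Seq (Assign 7 (Const 0))
   (Seq (While (Sub (Reg 3) (Reg 7))
     (Seq (Store 2 (Add (Reg 7) (Const 1)) (Mult (Const 2) (Cell 2 (Reg 7))))
       (Assign 7 (Add (Reg 7) (Const 1)))))
   (Seq (Assign 7 (Const 0))
   (While (Sub (Cell 2 (Reg 3)) (Reg 7))
     (Seq (Store 3 (Reg 7) (Add (Cell 3 (Div (Reg 7) (Const 2))) (mod_exp (Reg 7) (Const 2))))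
       (Assign 7 (Add (Reg 7) (Const 1))))))))"

lemma runs_tables:
  assumes k: "reg s 3 = k" and z: "arr s 3 0 = 0" and L: "k + 2 \<le> L"
  shows "runs F Y L tables (3 * k + 3 * 2 ^ k + 5) s (\<lambda>s'. same {7} {2, 3} s s' \<and>
    (\<forall>j\<le>k. arr s' 2 j = 2 ^ j) \<and> (\<forall>S<2 ^ k. arr s' 3 S = card (set_decode S)))"
proof -
  let ?I = "\<lambda>i s'. same {7} {2} s s' \<and> reg s' 7 = i \<and> (\<forall>j\<le>i. arr s' 2 j = 2 ^ j)"
  let ?J = "\<lambda>i s'. same {7} {2, 3} s s' \<and> reg s' 7 = i \<and> (\<forall>j\<le>k. arr s' 2 j = 2 ^ j) \<and>
    (\<forall>S<i. arr s' 3 S = card (set_decode S)) \<and> arr s' 3 0 = 0"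
  let ?e = "Sub (Reg 3) (Reg 7)" and ?e' = "Sub (Cell 2 (Reg 3)) (Reg 7)"
  let ?inc = "Assign 7 (Add (Reg 7) (Const 1))"
  let ?body = "Seq (Store 2 (Add (Reg 7) (Const 1)) (Mult (Const 2) (Cell 2 (Reg 7)))) ?inc"
  let ?body' = "Seq (Store 3 (Reg 7) (Add (Cell 3 (Div (Reg 7) (Const 2))) (mod_exp (Reg 7) (Const 2)))) ?inc"
  have pow_less: "2 ^ j < (2 :: nat) ^ L" if "j \<le> Suc k" for j
    using that L by (intro power_strict_increasing) auto
  have pow_le: "2 ^ j \<le> (2 :: nat) ^ k" if "j \<le> k" for j
    using that by (intro power_increasing) auto
  have one: "1 < (2 :: nat) ^ L" using pow_less[of 0] by simp
  have step: "val s' ?e \<noteq> 0 \<and> runs F Y L ?body (1 + 1) s' (?I (Suc i))"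
    if i: "i < k" and inv: "?I i s'" for i s'
  proof
    have sm: "same {7} {2} s s'" using inv by blast
    have "reg s' 3 = k" using k same_reg[OF sm] by simp
    then show "val s' ?e \<noteq> 0" using i inv by simp
    show "runs F Y L ?body (1 + 1) s' (?I (Suc i))"
    proof (rule runs_Store_Seq)
      show "val s' (Add (Reg 7) (Const 1)) = Suc i" using inv by simp
      show "val s' (Mult (Const 2) (Cell 2 (Reg 7))) = 2 ^ Suc i" using inv by simp
      show "2 ^ Suc i < (2 :: nat) ^ L" using i by (intro pow_less) simp
      show "runs F Y L ?inc 1 (set_cell 2 (Suc i) (2 ^ Suc i) s') (?I (Suc i))"
      proof (rule runs_Assign)
        show "val (set_cell 2 (Suc i) (2 ^ Suc i) s') (Add (Reg 7) (Const 1)) = Suc i"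
          using inv by (simp add: state_simps)
        show "Suc i < 2 ^ L" using i L less_exp[of L] by linarith
        show "?I (Suc i) (set_reg 7 (Suc i) (set_cell 2 (Suc i) (2 ^ Suc i) s'))"
          using inv by (auto simp: state_simps same_intros le_Suc_eq)
      qed (simp add: simple_simps)
    qed (simp_all add: simple_simps)
  qed
  have step': "val s' ?e' \<noteq> 0 \<and> runs F Y L ?body' (1 + 1) s' (?J (Suc i))"
    if i: "i < 2 ^ k" and inv: "?J i s'" for i s'
  proof
    have sm: "same {7} {2, 3} s s'" using inv by blast
    have r3: "reg s' 3 = k" using k same_reg[OF sm] by simp
    then show "val s' ?e' \<noteq> 0" using i inv by simp
    \<comment> \<open>The entry for \<open>i = 0\<close> reads its own cell before writing it; this
      is right because that cell is initially \<open>0\<close>.\<close>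
    have cell: "arr s' 3 (i div 2) = card (set_decode (i div 2))"
    proof (cases "i = 0")
      case True
      then show ?thesis using inv by simp
    next
      case False
      then have "i div 2 < i" by simp
      then show ?thesis using inv by blast
    qed
    show "runs F Y L ?body' (1 + 1) s' (?J (Suc i))"
    proof (rule runs_Store_Seq)
      show "val s' (Reg 7) = i" using inv by simp
      show "val s' (Add (Cell 3 (Div (Reg 7) (Const 2))) (mod_exp (Reg 7) (Const 2))) = card (set_decode i)"
        using inv cell card_set_decode[of i] by (simp add: val_exps)
      have "card (set_decode i) \<le> card {..<k}"
        using i set_decode_subset_iff by (intro card_mono) auto
      then have "card (set_decode i) \<le> k" by simp
      then show "card (set_decode i) < 2 ^ L" using L less_exp[of L] by linarith
      show "runs F Y L ?inc 1 (set_cell 3 i (card (set_decode i)) s') (?J (Suc i))"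
      proof (rule runs_Assign)
        show "val (set_cell 3 i (card (set_decode i)) s') (Add (Reg 7) (Const 1)) = Suc i"
          using inv by (simp add: state_simps)
        have "2 ^ k < (2 :: nat) ^ L" by (rule pow_less) simp
        then show "Suc i < 2 ^ L" using i by linarith
        show "?J (Suc i) (set_reg 7 (Suc i) (set_cell 3 i (card (set_decode i)) s'))"
          using inv by (auto simp: state_simps same_intros less_Suc_eq)
      qed (simp add: simple_simps)
    qed (simp_all add: simple_simps)
  qed
  define s1 where "s1 = set_reg 7 0 (set_cell 2 0 1 s)"
  have snd: "runs F Y L (Seq (Assign 7 (Const 0)) (While ?e' ?body')) (1 + (2 ^ k * ((1 + 1) + 1) + 1)) s' (?J (2 ^ k))"
    if I: "?I k s'" for s'
  proof (rule runs_Assign_Seq[where v = 0])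
    show "runs F Y L (While ?e' ?body') (2 ^ k * (1 + 1 + 1) + 1) (set_reg 7 0 s') (?J (2 ^ k))"
    proof (rule runs_While[where I = ?J])
      have "same {7} {2} s s'" using I by blast
      from same_arr[OF this, of 3] z have "arr s' 3 0 = 0" by simp
      moreover have "same {7} {2, 3} s s'" using I by (auto simp: same_def)
      ultimately show "?J 0 (set_reg 7 0 s')" using I by (simp add: state_simps same_set_reg)
    next
      fix s'' assume J: "?J (2 ^ k) s''"
      then have "same {7} {2, 3} s s''" by blast
      then have "reg s'' 3 = k" using k same_reg[of "{7}" "{2, 3}" s s'' 3] by simp
      then show "val s'' ?e' = 0 \<and> ?J (2 ^ k) s''" using J by simp
    next
      show "simple_exp ?e'" by (simp add: simple_simps)
    qed (use step' in blast)
  qed (simp_all add: simple_simps)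
  have fst: "runs F Y L (While ?e ?body) (k * ((1 + 1) + 1) + 1) s1
    (\<lambda>s'. runs F Y L (Seq (Assign 7 (Const 0)) (While ?e' ?body')) (1 + (2 ^ k *
      ((1 + 1) + 1) + 1)) s' (?J (2 ^ k)))"
  proof (rule runs_While[where I = ?I])
    show "?I 0 s1" by (simp add: s1_def state_simps same_intros)
  next
    fix s' assume I: "?I k s'"
    then have "same {7} {2} s s'" by blast
    then have "reg s' 3 = k" using k same_reg[of "{7}" "{2}" s s' 3] by simp
    then show "val s' ?e = 0 \<and> runs F Y L (Seq (Assign 7 (Const 0)) (While ?e' ?body'))
        (1 + (2 ^ k * ((1 + 1) + 1) + 1)) s' (?J (2 ^ k))"
      using I snd[OF I] by simp
  next
    show "simple_exp ?e" by (simp add: simple_simps)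
  qed (use step in blast)
  have "runs F Y L tables (1 + (1 + ((k * ((1 + 1) + 1) + 1) + (1 + (2 ^ k * ((1 + 1) + 1) + 1))))) s (?J (2 ^ k))"
    unfolding tables_def
  proof (rule runs_Store_Seq[where i = 0
    and v = 1], simp add: simple_simps, simp add: simple_simps, simp, simp,
      rule one, rule runs_Assign_Seq[where v = 0], simp add: simple_simps, simp, simp)
    show "runs F Y L (Seq (While ?e ?body) (Seq (Assign 7 (Const 0)) (While ?e' ?body')))
      ((k * ((1 + 1) + 1) + 1) + (1 + (2 ^ k * ((1 + 1) + 1) + 1))) (set_reg 7 0 (set_cell 2 0 1 s))
        (?J (2 ^ k))"
      unfolding s1_def[symmetric] by (rule runs_Seq[OF fst])
  qed
  then show ?thesis by (rule runs_mono) simp_all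
qed

text \<open>The distance factor is essential on the diagonal: \<open>pair_index u u\<close> equals
  \<open>pair_index (u + 1) 0\<close>, the position of a genuine pair.\<close>

definition input_adjacency :: exp where
  "input_adjacency = Mult (diff_exp (Reg 12) (Reg 13))
    (Cell 0 (Add (Add (Add (Reg 1) (Reg 2)) (Const 2)) (pair_index_exp (Reg 12) (Reg 13))))"

definition complete_adjacency :: exp where
  "complete_adjacency = diff_exp (Reg 12) (Reg 13)"

definition bit_graph :: "bool list \<Rightarrow> nat \<Rightarrow> nat \<Rightarrow> nat \<Rightarrow> nat \<Rightarrow> bool" where
  "bit_graph x r n u v \<longleftrightarrow> u \<noteq> v \<and> set_bit x (r + n + 2 + pair_index u v)"

lemma adjacency_input:
  assumes "reg s 1 = r" "reg s 2 = n" "\<And>p. arr s 0 p = (if set_bit x p then 1 else 0)"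
  shows "adjacency_exp input_adjacency (bit_graph x r n) s"
  unfolding adjacency_exp_def
proof (intro conjI allI impI)
  show "exp_size input_adjacency \<le> 80" "small_consts input_adjacency"
    by (simp_all add: input_adjacency_def exp_defs)
  fix s' :: state
  assume s': "arr s' 0 = arr s 0" "reg s' 1 = reg s 1" "reg s' 2 = reg s 2"
    "reg s' 12 < reg s 2" "reg s' 13 < reg s 2"
  define u v where "u = reg s' 12" and "v = reg s' 13"
  have val: "val s' input_adjacency =
      (u - v + (v - u)) * (if set_bit x (r + n + 2 + pair_index u v) then 1 else 0)"
    using s'(1-3) assms unfolding input_adjacency_def by (simp only: val.simps val_exps u_def v_def)
  show "val s' input_adjacency \<noteq> 0 \<longleftrightarrow> bit_graph x r n (reg s' 12) (reg s' 13)"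
    unfolding val bit_graph_def u_def[symmetric] v_def[symmetric] by auto
  show "val s' input_adjacency \<le> reg s 2"
    using s'(4,5) unfolding val u_def[symmetric] v_def[symmetric] by auto
qed

lemma adjacency_complete: "adjacency_exp complete_adjacency (\<noteq>) s"
  by (auto simp: adjacency_exp_def complete_adjacency_def exp_defs)

lemma card_cliques_decode:
  assumes "r = length (takeWhile id x)" "n = length (takeWhile id (drop (Suc r) x))"
  shows "case_prod count_k_cliques (decode x) = card (cliques r n (bit_graph x r n))"
proof -
  let ?E = "{{i, j} | i j. j < i \<and> i < n \<and>
    num_pairs i + j < length (drop (Suc n) (drop (Suc r) x)) \<and>
    drop (Suc n) (drop (Suc r) x) ! (num_pairs i + j)}"
  have dec: "decode x = (r, ({..<n}, ?E))"
    unfolding decode_def Let_def assms by simp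
  have bit: "num_pairs i + j < length (drop (Suc n) (drop (Suc r) x)) \<and>
      drop (Suc n) (drop (Suc r) x) ! (num_pairs i + j) \<longleftrightarrow> bit_graph x r n i j" if "j < i" for i j
  proof -
    have "pair_index i j = num_pairs i + j" using that by (simp add: pair_index_def max_def min_def)
    then show ?thesis using that
      by (auto simp: bit_graph_def set_bit_def less_diff_conv add_ac)
  qed
  have "{u, v} \<in> ?E \<longleftrightarrow> bit_graph x r n u v" if "u < n" "v < n" "u \<noteq> v" for u v
  proof
    assume "{u, v} \<in> ?E"
    then obtain i j where ij: "{u, v} = {i, j}" "j < i" "bit_graph x r n i j" using bit by blast
    then show "bit_graph x r n u v"
      by (auto simp: doubleton_eq_iff bit_graph_def pair_index_commute)
  next
    assume A: "bit_graph x r n u v"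
    then have A': "bit_graph x r n v u" by (simp add: bit_graph_def pair_index_commute)
    show "{u, v} \<in> ?E"
    proof (cases "v < u")
      case True
      then show ?thesis using A bit[OF True] that by blast
    next
      case False
      then have "u < v" using that by simp
      then show ?thesis using A' bit[OF \<open>u < v\<close>] that by (blast intro: insert_commute)
    qed
  qed
  then have "{S. k_clique r ({..<n}, ?E) S} = cliques r n (bit_graph x r n)"
    unfolding k_clique_def cliques_def by (intro Collect_cong) (auto simp: subset_iff)
  then show ?thesis by (simp add: dec count_k_cliques_def)
qed

lemma card_cliques_complete: "card (cliques r r (\<noteq>)) = 1"
proof -
  have "cliques r r (\<noteq>) = {{..<r}}" using card_subset_eq[of "{..<r}"] by (auto simp: cliques_def)
  then show ?thesis by simp
qed

text \<open>This is \<open>1\<close> for \<open>r = 0\<close>, the empty clique, and the number of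
  vertices for \<open>r = 1\<close>.\<close>

definition small_case :: prog where
  "small_case = Assign 0 (Add (Sub (Const 1) (Reg 1)) (Mult (Reg 1) (Reg 2)))"

text \<open>The tables depend on \<open>r\<close> only and are shared by both runs. Copying
  \<open>r\<close> into the register of \<open>n\<close> and switching the adjacency test turns the
  second run to the complete graph.\<close>

definition large_case :: prog where
  "large_case =
    Seq (Assign 3 (triangle_exp (Reg 1)))
   (Seq tables
   (Seq (interpolate input_adjacency)
   (Seq (Assign 21 (Reg 16))
   (Seq (Assign 2 (Reg 1))
   (Seq (interpolate complete_adjacency)
     (Assign 0 (Div (Reg 21) (Reg 16))))))))"

definition reduction :: prog where
  "reduction =
    Seq (scan (Reg 1) 1)
   (Seq (scan (Add (Add (Reg 1) (Const 1)) (Reg 2)) 2)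
   (If (Sub (Reg 1) (Const 1)) large_case small_case))"

lemma clique_signal_ratio:
  assumes "r \<ge> 2"
  obtains w :: int where "w \<noteq> 0"
    "\<And>n A. (\<And>u. \<not> A u u) \<Longrightarrow> clique_signal r n A (Suc (num_pairs r)) = w * int (card (cliques r n A))"
proof -
  obtain w :: int where "w \<noteq> 0" "\<forall>n A. (\<forall>u. \<not> A u u) \<longrightarrow>
      clique_signal r n A (Suc (num_pairs r)) = w * int (card (cliques r n A))"
    using cliques_from_rainbow_trees[OF assms] unfolding clique_signal_def by blast
  then show thesis using that by blast
qed

text \<open>The offset \<open>10\<close> in the base lets a constant up to \<open>10\<close> be
  absorbed by one more power: the final square is at most a tenth power, and the whole sum costs one
  power more.\<close>

lemma size_bound:
  assumes "r \<le> m" "n \<le> m" "M = r * n * (num_pairs r + 1)"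
  shows "r * n + r * r + r + (num_pairs r + 2) * (r + 2) + (num_pairs r + M + 4) * (num_pairs r + M + 4)
    \<le> (m + 10) ^ 11"
proof -
  define z where "z = m + 10"
  have z: "r \<le> z" "n \<le> z" "r + 2 \<le> z" "10 \<le> z" using assms by (simp_all add: z_def)
  have "num_pairs r \<le> r * (r - 1)" by simp
  also have "\<dots> \<le> m * m" using assms by (intro mult_le_mono) auto
  finally have k: "num_pairs r + 4 \<le> z ^ 2" by (simp add: z_def power2_eq_square algebra_simps)
  have zp: "10 * z ^ i \<le> z ^ Suc i" for i using z by simp
  have rn: "r * n \<le> z ^ 2" "r * r \<le> z ^ 2" "r \<le> z ^ 2"
    using z mult_le_mono[of r z n z] mult_le_mono[of r z r z] mult_le_mono[of r z 1 z]
      by (simp_all add: power2_eq_square)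
  have "M \<le> z ^ 2 * z ^ 2" unfolding assms(3) using rn k by (intro mult_le_mono) auto
  then have M: "M \<le> z ^ 4" by (simp flip: power_add)
  have "z ^ 2 \<le> z ^ 4" using z by (intro power_increasing) auto
  then have "num_pairs r + M + 4 \<le> z ^ 5" using M k zp[of 4] by simp
  then have sq: "(num_pairs r + M + 4) * (num_pairs r + M + 4) \<le> z ^ 5 * z ^ 5"
    by (intro mult_le_mono)
  have "(num_pairs r + 2) * (r + 2) \<le> z ^ 2 * z" using k z by (intro mult_le_mono) auto
  then have kr: "(num_pairs r + 2) * (r + 2) \<le> z ^ 3" by (simp add: power2_eq_square power3_eq_cube)
  have "z ^ 2 \<le> z ^ 10" "z ^ 3 \<le> z ^ 10" using z by (intro power_increasing; simp)+
  moreover have "z ^ 5 * z ^ 5 = z ^ 10" by (simp flip: power_add)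
  ultimately show ?thesis using rn kr sq zp[of 10] unfolding z_def[symmetric] by simp
qed

text \<open>The exponent is made up of \<open>2\<close> for the \<open>k + 1\<close> rounds,
  \<open>11\<close> for the query size, \<open>2\<close> to absorb the constant \<open>25\<close>,
  and \<open>1\<close> for the last summand.\<close>

lemma interpolate_time:
  assumes "r \<le> m" "n \<le> m" "M = r * n * (num_pairs r + 1)" "k = num_pairs r"
  shows "(k + 1) * (20 * 2 ^ k * (k + M + 2 + M * M) + 3 * r + 13) + 6 \<le> 2 ^ k * (m + 10) ^ 16"
proof -
  define z where "z = m + 10"
  have z: "r \<le> z" "10 \<le> z" "1 \<le> z" using assms by (simp_all add: z_def)
  note b = size_bound[OF assms(1-3), folded assms(4) z_def]
  have "k + M + 2 + M * M \<le> (k + M + 4) * (k + M + 4)" by (simp add: algebra_simps)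
  then have X: "k + M + 2 + M * M \<le> z ^ 11" using b by linarith
  have "k + 2 \<le> (k + 2) * (r + 2)" by simp
  moreover have "num_pairs r \<le> r * (r - 1)" by simp
  then have "k \<le> m * m" unfolding assms(4) using assms(1) mult_le_mono[of r m "r - 1" m] by linarith
  then have k: "k + 1 \<le> z ^ 2" by (simp add: z_def power2_eq_square algebra_simps)
  have p: "1 \<le> (2 :: nat) ^ k" by simp
  have "20 * 2 ^ k * (k + M + 2 + M * M) \<le> 20 * 2 ^ k * z ^ 11" using X by (rule mult_le_mono2)
  moreover have "3 * r + 13 \<le> 2 ^ k * (5 * z ^ 11)"
  proof -
    have "z \<le> z ^ 11" using z by (intro self_le_power) auto
    then have "3 * r + 13 \<le> 5 * z ^ 11" using z by linarith
    also have "1 * (5 * z ^ 11) \<le> 2 ^ k * (5 * z ^ 11)" using p by (rule mult_le_mono1)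
    finally show ?thesis by simp
  qed
  ultimately have "20 * 2 ^ k * (k + M + 2 + M * M) + 3 * r + 13 \<le> 2 ^ k * (25 * z ^ 11)" by simp
  also have "\<dots> \<le> 2 ^ k * (z * z * z ^ 11)" using z mult_le_mono[of 10 z 10 z]
    by (intro mult_le_mono2 mult_le_mono1) simp
  finally have "(k + 1) * (20 * 2 ^ k * (k + M + 2 + M * M) + 3 * r + 13) \<le> z ^ 2 * (2 ^ k * (z * z * z ^ 11))"
    using k by (intro mult_le_mono)
  also have "\<dots> = 2 ^ k * z ^ 15" by (simp add: eval_nat_numeral)
  finally have "(k + 1) * (20 * 2 ^ k * (k + M + 2 + M * M) + 3 * r + 13) \<le> 2 ^ k * z ^ 15" .
  moreover have "1 * 1 \<le> 2 ^ k * z ^ 15" using p z by (intro mult_le_mono) auto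
  moreover have "2 ^ k * z ^ 15 * 10 \<le> 2 ^ k * z ^ 15 * z" using z by (intro mult_le_mono2) simp
  moreover have "2 ^ k * z ^ 15 * z = 2 ^ k * z ^ 16"
    by (subst power_eq_if[of _ 16]) simp
  ultimately show ?thesis unfolding z_def[symmetric] by linarith
qed

lemma card_cliques_small:
  assumes "r < 2"
  shows "card (cliques r n A) = 1 - r + r * n"
proof (cases "r = 0")
  case True
  have "cliques 0 n A = {{}}" by (auto simp: cliques_def dest: finite_subset)
  then show ?thesis using True by simp
next
  case False
  have "cliques 1 n A = (\<lambda>u. {u}) ` {..<n}" by (auto simp: cliques_def card_1_singleton_iff)
  then have "card (cliques 1 n A) = n" by (simp add: card_image)
  then show ?thesis using False assms by (cases "r = 1") auto
qed

lemma runs_large_case: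
  assumes r: "reg s 1 = r" "reg s 2 = n" and r2: "r \<ge> 2" and m: "r \<le> m" "n \<le> m"
    and arr: "\<And>p. arr s 0 p = (if set_bit x p then 1 else 0)" "arr s 3 0 = 0"
    and F: "F = fst kTrees" and Y: "Y = {y. parameter y = num_pairs r}" and L: "L = (m + 10) ^ 11"
  shows "runs F Y L large_case (2 ^ (num_pairs r) * (m + 10) ^ 17) s
    (\<lambda>s'. reg s' 0 = card (cliques r n (bit_graph x r n)))" (is "runs _ _ _ _ _ _ ?Q")
proof -
  define k where "k = num_pairs r"
  define A where "A = bit_graph x r n"
  define M where "M = r * n * (k + 1)"
  define M' where "M' = r * r * (k + 1)"
  define T where "T = (k + 1) * (20 * 2 ^ k * (k + M + 2 + M * M) + 3 * r + 13) + 6"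
  define T' where "T' = (k + 1) * (20 * 2 ^ k * (k + M' + 2 + M' * M') + 3 * r + 13) + 6"
  have Yk: "Y = {y. parameter y = k}" by (simp add: Y k_def)
  have LM: "r * n + r * r + r + (k + 2) * (r + 2) + (k + M + 4) * (k + M + 4) \<le> L"
    using size_bound[OF m] unfolding L M_def k_def by blast
  have LM': "r * r + r * r + r + (k + 2) * (r + 2) + (k + M' + 4) * (k + M' + 4) \<le> L"
    using size_bound[OF m(1) m(1)] unfolding L M'_def k_def by blast
  have "k + 2 \<le> (k + 2) * (r + 2)" "r + 2 \<le> (k + 2) * (r + 2)" by simp_all
  then have kL: "k + 2 \<le> L" "r + 2 \<le> L" using LM by linarith+
  then have less: "k < 2 ^ L" "r < 2 ^ L" using less_exp[of L] by linarith+
  obtain w :: int where w: "w \<noteq> 0"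
    "\<And>n A. (\<And>u. \<not> A u u) \<Longrightarrow> clique_signal r n A (k + 1) = w * int (card (cliques r n A))"
    using clique_signal_ratio[OF r2] unfolding k_def by (metis Suc_eq_plus1)
  have A_sym: "A u v \<Longrightarrow> A v u" for u v by (simp add: A_def bit_graph_def pair_index_commute)
  have signal: "clique_signal r n A (k + 1) = w * int (card (cliques r n A))"
    by (rule w(2)) (simp add: A_def bit_graph_def)
  \<comment> \<open>The complete graph on \<open>r\<close> vertices has a single
    \<open>r\<close>-clique, so its signal is \<open>w\<close> itself.\<close>
  have signal': "clique_signal r r (\<noteq>) (k + 1) = w"
    using w(2)[of "(\<noteq>)" r] card_cliques_complete[of r] by simp
  let ?rest4 = "Seq (interpolate complete_adjacency) (Assign 0 (Div (Reg 21) (Reg 16)))"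
  let ?rest3 = "Seq (Assign 21 (Reg 16)) (Seq (Assign 2 (Reg 1)) ?rest4)"
  define s1 where "s1 = set_reg 3 k s"
  have r1: "reg s1 1 = r" "reg s1 2 = n" "reg s1 3 = k" using r
    by (simp_all add: s1_def state_simps)
  have "runs F Y L large_case (1 + ((3 * k + 3 * 2 ^ k + 5) + (T + (1 + (1 + (T' + 1)))))) s ?Q"
    unfolding large_case_def
  proof (rule runs_Assign_Seq)
    show "val s (triangle_exp (Reg 1)) = k" using r by (simp add: val_exps k_def)
    show "runs F Y L (Seq tables (Seq (interpolate input_adjacency) ?rest3))
      ((3 * k + 3 * 2 ^ k + 5) + (T + (1 + (1 + (T' + 1))))) (set_reg 3 k s) ?Q"
      unfolding s1_def[symmetric]
    proof (rule runs_Seq, rule runs_mono[OF runs_tables[OF r1(3) _ kL(1)] order_refl])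
      show "arr s1 3 0 = 0" using arr by (simp add: s1_def state_simps)
      fix s2 assume s2: "same {7} {2, 3} s1 s2 \<and> (\<forall>j\<le>k. arr s2 2 j = 2 ^ j) \<and>
        (\<forall>S<2 ^ k. arr s2 3 S = card (set_decode S))"
      then have sm2: "same {7} {2, 3} s1 s2" by blast
      have r2': "reg s2 1 = r" "reg s2 2 = n" "reg s2 3 = k" using same_reg[OF sm2] r1 by simp_all
      have ad: "adjacency_exp input_adjacency A s2"
        unfolding A_def using same_arr[OF sm2, of 0] arr
        by (intro adjacency_input r2') (simp add: s1_def state_simps)
      then have prep: "prepared r n A input_adjacency s2" using s2 r2'
        by (simp add: prepared_def k_def)
      show "runs F Y L (Seq (interpolate input_adjacency) ?rest3) (T + (1 + (1 + (T' + 1)))) s2 ?Q"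
      proof (rule runs_Seq, rule runs_mono[OF runs_interpolate[OF prep k_def r2 A_sym M_def LM F Yk]])
        fix s3 assume s3: "same interpolate_regs {1} s2 s3 \<and>
          int (reg s3 16) = \<bar>clique_signal r n A (k + 1)\<bar>"
        then have sm3: "same interpolate_regs {1} s2 s3" by blast
        define a where "a = reg s3 16"
        define s4 where "s4 = set_reg 2 r (set_reg 21 a s3)"
        have "prepared r n A input_adjacency s3" by (rule prepared_same[OF prep sm3]) auto
        then have prep4: "prepared r r (\<noteq>) complete_adjacency s4"
          using adjacency_complete by (simp add: s4_def state_simps prepared_def)
        show "runs F Y L ?rest3 (1 + (1 + (T' + 1))) s3 ?Q"
        proof (rule runs_bounded)
          assume "bounded L s3"
          then have a_less: "a < 2 ^ L" by (simp add: a_def bounded_def)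
          show "runs F Y L ?rest3 (1 + (1 + (T' + 1))) s3 ?Q"
          proof (rule runs_Assign_Seq[where v = a])
            show "runs F Y L (Seq (Assign 2 (Reg 1)) ?rest4) (1 + (T' + 1)) (set_reg 21 a s3) ?Q"
            proof (rule runs_Assign_Seq[where v = r])
              show "val (set_reg 21 a s3) (Reg 1) = r" using same_reg[OF sm3] r2'
                by (simp add: state_simps)
              show "runs F Y L ?rest4 (T' + 1) (set_reg 2 r (set_reg 21 a s3)) ?Q"
                unfolding s4_def[symmetric]
              proof (rule runs_Seq, rule runs_mono[OF runs_interpolate[OF prep4 k_def r2 _ M'_def LM' F Yk]])
                fix s5 assume s5: "same interpolate_regs {1} s4 s5 \<and>
                  int (reg s5 16) = \<bar>clique_signal r r (\<noteq>) (k + 1)\<bar>"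
                then have sm5: "same interpolate_regs {1} s4 s5" by blast
                have "reg s5 21 = a" using same_reg[OF sm5] by (simp add: s4_def state_simps)
                moreover have "int a = int (reg s5 16) * int (card (cliques r n A))"
                  using s3 s5 signal signal' by (simp add: a_def abs_mult)
                then have a: "a = reg s5 16 * card (cliques r n A)"
                  by (metis of_nat_eq_iff of_nat_mult)
                moreover have "reg s5 16 \<noteq> 0" using s5 signal' w(1) by auto
                ultimately have v: "val s5 (Div (Reg 21) (Reg 16)) = card (cliques r n A)" by simp
                have "card (cliques r n A) \<le> a"
                  using a \<open>reg s5 16 \<noteq> 0\<close> by simp
                then have "card (cliques r n A) < 2 ^ L" using a_less by linarith
                then show "runs F Y L (Assign 0 (Div (Reg 21) (Reg 16))) 1 s5 ?Q"
                  using v by (intro runs_Assign[where v = "card (cliques r n A)"])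
                    (simp_all add: simple_simps state_simps A_def)
              qed (simp_all add: T'_def)
            qed (use less in \<open>simp_all add: simple_simps\<close>)
          qed (use a_less in \<open>simp_all add: simple_simps a_def\<close>)
        qed
      qed (simp_all add: T_def)
    qed
  qed (use less in \<open>simp_all add: simple_simps\<close>)
  moreover have "1 + ((3 * k + 3 * 2 ^ k + 5) + (T + (1 + (1 + (T' + 1))))) \<le> 2 ^ k * (m + 10) ^ 17"
  proof -
    define B where "B = 2 ^ k * (m + 10) ^ 16"
    have T: "T \<le> B" "T' \<le> B"
      using interpolate_time[OF m M_def[unfolded k_def] k_def] interpolate_time[OF m(1) m(1) M'_def[unfolded k_def] k_def]
      by (simp_all add: T_def T'_def B_def k_def M_def M'_def)
    have "m + 10 \<le> (m + 10) ^ 16" by (rule self_le_power) auto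
    then have "2 ^ k * 10 \<le> B" unfolding B_def by (intro mult_le_mono2) linarith
    moreover have "k < 2 ^ k" by (rule less_exp)
    moreover have "10 * B \<le> (m + 10) * B" by (intro mult_le_mono1) simp
    moreover have "(m + 10) * B = 2 ^ k * (m + 10) ^ 17"
      unfolding B_def by (subst power_eq_if[of _ 17]) simp
    ultimately show ?thesis using T by linarith
  qed
  ultimately show ?thesis unfolding k_def[symmetric] by (rule runs_mono)
qed

text \<open>One more power of \<open>length x + 10\<close> than in \<open>runs_large_case\<close>
  pays for the two scans and the case distinction.\<close>

lemma runs_reduction:
  assumes r: "r = length (takeWhile id x)" and n: "n = length (takeWhile id (drop (Suc r) x))"
    and F: "F = fst kTrees" and Y: "Y = {y. parameter y = num_pairs r}"
      and L: "L = (length x + 10) ^ 11"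
  shows "runs F Y L reduction (2 ^ num_pairs r * (length x + 10) ^ 18) (init_string x)
    (\<lambda>s'. reg s' 0 = card (cliques r n (bit_graph x r n)))" (is "runs _ _ _ _ _ _ ?Q")
proof -
  define m where "m = length x"
  let ?s = "init_string x"
  let ?T = "2 ^ num_pairs r * (m + 10) ^ 17"
  have rn: "r \<le> m" "n \<le> m"
    using length_takeWhile_le[of id x] length_takeWhile_le[of id "drop (Suc r) x"]
      by (simp_all add: r n m_def)
  have "m + 10 \<le> L" unfolding L m_def[symmetric] by (rule self_le_power) auto
  then have less: "r < L" "n < L" using rn by linarith+
  let ?rest = "If (Sub (Reg 1) (Const 1)) large_case small_case"
  have "runs F Y L reduction ((2 * r + 1) + ((2 * n + 1) + (1 + (?T + 1)))) ?s ?Q"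
    unfolding reduction_def
  proof (rule runs_Seq, rule runs_mono[OF runs_scan[where a = 0 and m = r and x = x]])
    show "reg ?s 1 = 0" by (simp add: init_string_def)
    show "simple_exp (Cell 0 (Reg 1))" by (simp add: simple_simps)
    show "r = length (takeWhile id (drop 0 x))" by (simp add: r)
    fix s1 assume s1: "same {1} {} ?s s1 \<and> reg s1 1 = r"
    then have sm1: "same {1} {} ?s s1" by blast
    have arr1: "arr s1 a = arr ?s a" for a using same_arr[OF sm1] by simp
    show "runs F Y L (Seq (scan (Add (Add (Reg 1) (Const 1)) (Reg 2)) 2) ?rest) ((2 * n + 1) + (1 + (?T + 1))) s1 ?Q"
    proof (rule runs_Seq, rule runs_mono[OF runs_scan[where a = "Suc r" and m = n and x = x]])
      show "reg s1 2 = 0" using same_reg[OF sm1] by (simp add: init_string_def)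
      show "simple_exp (Cell 0 (Add (Add (Reg 1) (Const 1)) (Reg 2)))" by (simp add: simple_simps)
      show "val s' (Add (Add (Reg 1) (Const 1)) (Reg 2)) = Suc r + i"
        if "same {2} {} s1 s'" "reg s' 2 = i" for s' i
        using that s1 same_reg[OF that(1), of 1] by simp
      fix s2 assume s2: "same {2} {} s1 s2 \<and> reg s2 2 = n"
      then have sm2: "same {2} {} s1 s2" by blast
      have r2: "reg s2 1 = r" "reg s2 2 = n" using s1 s2 same_reg[OF sm2, of 1] by simp_all
      have arr2: "arr s2 a = arr ?s a" for a using same_arr[OF sm2] arr1 by simp
      show "runs F Y L ?rest (1 + (?T + 1)) s2 ?Q"
      proof (rule runs_If)
        show "simple_exp (Sub (Reg 1) (Const 1))" by (simp add: simple_simps)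
        assume "val s2 (Sub (Reg 1) (Const 1)) \<noteq> 0"
        then have "r \<ge> 2" using r2 by simp
        then show "runs F Y L large_case ?T s2 ?Q"
          using rn L Y F r2 arr2
          by (intro runs_large_case)
            (simp_all add: arr_init_string m_def, simp add: init_string_def)
      next
        assume "val s2 (Sub (Reg 1) (Const 1)) = 0"
        then have small: "r < 2" using r2 by simp
        define c where "c = card (cliques r n (bit_graph x r n))"
        have "c = 1 - r + r * n" unfolding c_def by (rule card_cliques_small[OF small])
        moreover from this have "c \<le> n + 1" using small by (cases r) auto
        then have "c < 2 ^ L" using less less_exp[of L] by linarith
        ultimately show "runs F Y L small_case 1 s2 ?Q"
          unfolding small_case_def using r2
          by (intro runs_Assign[where v = c]) (simp_all add: simple_simps state_simps c_def)
      qed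
    qed (use arr1 less n in \<open>simp_all add: arr_init_string\<close>)
  qed (use less in \<open>simp_all add: arr_init_string\<close>)
  moreover have "(2 * r + 1) + ((2 * n + 1) + (1 + (?T + 1))) \<le> 2 ^ num_pairs r * (length x + 10) ^ 18"
  proof -
    have "m + 10 \<le> (m + 10) ^ 17" by (rule self_le_power) auto
    moreover have "1 * (m + 10) ^ 17 \<le> ?T" by (rule mult_le_mono1) simp
    moreover have "10 * ?T \<le> (m + 10) * ?T" by (intro mult_le_mono1) simp
    moreover have "(m + 10) * ?T = 2 ^ num_pairs r * (m + 10) ^ 18"
      by (subst power_eq_if[of _ 18]) simp
    ultimately show ?thesis using rn unfolding m_def[symmetric] by linarith
  qed
  ultimately show ?thesis by (rule runs_mono)
qed

section \<open>Computability and the fpt bounds\<close>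

lemma bounded_init_string:
  assumes "length x + 10 \<le> L"
  shows "bounded L (init_string x)"
proof -
  have "length x < 2 ^ L" "1 < (2 :: nat) ^ L" "0 < (2 :: nat) ^ L" using assms less_exp[of L]
    by linarith+
  then show ?thesis by (simp add: bounded_def init_string_def)
qed

lemma poly_time_computable_parameter: "poly_time_computable parameter"
proof -
  let ?p = "Seq (scan (Reg 1) 1) (Assign 0 (Reg 1))"
  have "\<exists>t Q s. exec (\<lambda>_. 0) ?p (init_string x) t Q s \<and> reg s 0 = parameter x \<and>
    t \<le> 1320000 * max 1 (length x) ^ 2" for x :: "bool list"
  proof -
    define m where "m = length x"
    define r where "r = length (takeWhile id x)"
    have par: "parameter x = r" by (simp add: parameter_def decode_def Let_def r_def)
    have rm: "r \<le> m" using length_takeWhile_le[of id x] by (simp add: r_def m_def)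
    have "runs (\<lambda>_. 0) {} (m + 10) ?p ((2 * r + 1) + 1) (init_string x) (\<lambda>s'. reg s' 0 = r)"
    proof (rule runs_Seq, rule runs_mono[OF runs_scan[where a = 0 and m = r and x = x] order_refl])
      show "reg (init_string x) 1 = 0" by (simp add: init_string_def)
      show "simple_exp (Cell 0 (Reg 1))" by (simp add: simple_simps)
      show "r = length (takeWhile id (drop 0 x))" by (simp add: r_def)
      have "r < 2 ^ (m + 10)" using rm less_exp[of "m + 10"] by linarith
      then show "runs (\<lambda>_. 0) {} (m + 10) (Assign 0 (Reg 1)) 1 s' (\<lambda>s'. reg s' 0 = r)"
        if "same {1} {} (init_string x) s' \<and> reg s' 1 = r" for s'
        using that by (intro runs_Assign[where v = r]) (simp_all add: simple_simps state_simps)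
    qed (use rm in \<open>simp_all add: arr_init_string\<close>)
    then obtain t Z s where t: "exec (\<lambda>_. 0) ?p (init_string x) t Z s" "reg s 0 = r"
      "t \<le> ((2 * r + 1) + 1) * (30000 * (m + 10))"
      unfolding runs_def using bounded_init_string[of x "m + 10"] by (auto simp: m_def)
    have "t \<le> ((2 * r + 1) + 1) * (30000 * (m + 10))" by (rule t(3))
    \<comment> \<open>Uses \<open>m + 10 \<le> 11 * max 1 m\<close>; the constant is
      \<open>4 * 30000 * 11 = 1320000\<close>.\<close>
    also have "\<dots> \<le> (4 * max 1 m) * (30000 * (11 * max 1 m))" using rm by (intro mult_le_mono) auto
    also have "\<dots> = 1320000 * max 1 (length x) ^ 2" by (simp add: power2_eq_square m_def)
    finally show ?thesis unfolding par using t(1,2) by blast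
  qed
  moreover have "query_free ?p" by (simp add: scan_def)
  ultimately show ?thesis unfolding poly_time_computable_def by blast
qed

text \<open>Bound for the parameters of queries, since
  \<open>num_pairs r \<le> r * r\<close>.\<close>

lemma computable_square: "computable (\<lambda>n. n * n)"
  unfolding computable_def
proof (intro exI conjI allI)
  let ?e = "Mult (Reg 0) (Reg 0)"
  show "query_free (Assign 0 ?e)" by simp
  fix n
  show "exec (\<lambda>_. 0) (Assign 0 ?e) (init_number n) (1 + cost (init_number n) ?e) {}
      (set_reg 0 (val (init_number n) ?e) (init_number n))" by (rule exec.Assign)
  show "reg (set_reg 0 (val (init_number n) ?e) (init_number n)) 0 = n * n"
    by (simp add: state_simps init_number_def)
qed

text \<open>Parameter-dependent factor of the running time; the exponent \<open>n * n\<close>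
  dominates \<open>num_pairs n\<close> and is computed by one multiplication.\<close>

lemma computable_power_square: "computable (\<lambda>n. c * 2 ^ (n * n))"
proof -
  let ?e = "Mult (Reg 0) (Reg 0)"
  let ?b1 = "Assign 0 (Mult (Const 2) (Reg 0))" and ?b2 = "Assign 1 (Sub (Reg 1) (Const 1))"
  let ?w = "While (Reg 1) (Seq ?b1 ?b2)"
  let ?p = "Seq (Assign 1 ?e) (Seq (Assign 0 (Const c)) ?w)"
  have loop: "\<exists>t Q s'. exec (\<lambda>_. 0) ?w s t Q s' \<and> reg s' 0 = reg s 0 * 2 ^ i" if "reg s 1 = i"
    for s i
    using that
  proof (induction i arbitrary: s)
    case 0
    then have "exec (\<lambda>_. 0) ?w s (1 + cost s (Reg 1)) {} s" by (intro exec.WhileFalse) simp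
    then show ?case by auto
  next
    case (Suc i)
    define s1 where "s1 = set_reg 0 (val s (Mult (Const 2) (Reg 0))) s"
    define s2 where "s2 = set_reg 1 (val s1 (Sub (Reg 1) (Const 1))) s1"
    have s2: "reg s2 1 = i" "reg s2 0 = 2 * reg s 0"
      using Suc.prems by (simp_all add: s2_def s1_def state_simps)
    obtain t Q s' where t: "exec (\<lambda>_. 0) ?w s2 t Q s'" "reg s' 0 = reg s2 0 * 2 ^ i"
      using Suc.IH[OF s2(1)] by blast
    have "exec (\<lambda>_. 0) ?b1 s (1 + cost s (Mult (Const 2) (Reg 0))) {} s1"
      "exec (\<lambda>_. 0) ?b2 s1 (1 + cost s1 (Sub (Reg 1) (Const 1))) {} s2"
      unfolding s1_def s2_def by (rule exec.Assign)+
    from exec.WhileTrue[where e = "Reg 1", OF _ exec.Seq[OF this] t(1)] Suc.prems show ?case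
      using t(2) s2 by fastforce
  qed
  have "\<exists>t Q s. exec (\<lambda>_. 0) ?p (init_number n) t Q s \<and> reg s 0 = c * 2 ^ (n * n)" for n
  proof -
    define s1 where "s1 = set_reg 1 (val (init_number n) ?e) (init_number n)"
    define s2 where "s2 = set_reg 0 (val s1 (Const c)) s1"
    have "reg s2 1 = n * n" "reg s2 0 = c"
      by (simp_all add: s2_def s1_def state_simps init_number_def)
    then obtain t Q s' where t: "exec (\<lambda>_. 0) ?w s2 t Q s'" "reg s' 0 = c * 2 ^ (n * n)"
      using loop by metis
    have "exec (\<lambda>_. 0) (Assign 1 ?e) (init_number n) (1 + cost (init_number n) ?e) {} s1"
      "exec (\<lambda>_. 0) (Assign 0 (Const c)) s1 (1 + cost s1 (Const c)) {} s2"
      unfolding s1_def s2_def by (rule exec.Assign)+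
    from exec.Seq[OF this(1) exec.Seq[OF this(2) t(1)]] show ?thesis using t(2) by blast
  qed
  moreover have "query_free ?p" by simp
  ultimately show ?thesis unfolding computable_def by blast
qed

lemma fpt_turing_reduction_kClique: "fpt_turing_reduction reduction kClique kTrees"
proof -
  \<comment> \<open>\<open>30000\<close> is the time unit of \<open>runs\<close>;
    \<open>29 = 18 + 11\<close> adds the exponents of the number of units and of \<open>L\<close>;
    the base \<open>11\<close> comes from \<open>m + 10 \<le> 11 * max 1 m\<close>.\<close>
  define c :: nat where "c = 30000 * 11 ^ 29"
  have "\<exists>t Q s. exec (fst kTrees) reduction (init_string x) t Q s \<and> reg s 0 = fst kClique x \<and>
      t \<le> c * 2 ^ (parameter x * parameter x) * max 1 (length x) ^ 29 \<and>
      (\<forall>y\<in>Q. parameter y \<le> parameter x * parameter x)" for x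
  proof -
    define m where "m = length x"
    define r where "r = length (takeWhile id x)"
    define n where "n = length (takeWhile id (drop (Suc r) x))"
    define L where "L = (length x + 10) ^ 11"
    have par: "parameter x = r" by (simp add: parameter_def decode_def Let_def r_def)
    have "length x + 10 \<le> L" unfolding L_def by (rule self_le_power) auto
    then have "bounded L (init_string x)" "L \<ge> 2" using bounded_init_string[of x L] by simp_all
    with runs_reduction[OF r_def n_def refl refl L_def] obtain t Z s where
      t: "exec (fst kTrees) reduction (init_string x) t Z s"
      "t \<le> 2 ^ num_pairs r * (length x + 10) ^ 18 * (30000 * L)"
      "Z \<subseteq> {y. parameter y = num_pairs r}" "reg s 0 = card (cliques r n (bit_graph x r n))"
      unfolding runs_def by blast
    have k: "num_pairs r \<le> r * r"
    proof -
      have "num_pairs r \<le> r * (r - 1)" by simp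
      also have "\<dots> \<le> r * r" by (intro mult_le_mono2) simp
      finally show ?thesis .
    qed
    have "reg s 0 = fst kClique x"
      using t(4) card_cliques_decode[OF r_def n_def] by (simp add: kClique_def case_prod_beta)
    moreover have "\<forall>y\<in>Z. parameter y \<le> parameter x * parameter x" using t(3) k par by auto
    moreover have "t \<le> c * 2 ^ (parameter x * parameter x) * max 1 (length x) ^ 29"
    proof -
      have "2 ^ num_pairs r \<le> (2 :: nat) ^ (r * r)" using k by (intro power_increasing) auto
      moreover have "(m + 10) ^ 29 \<le> (11 * max 1 m) ^ 29" by (intro power_mono) auto
      ultimately have "2 ^ num_pairs r * (m + 10) ^ 29 * 30000 \<le> 2 ^ (r * r) * (11 * max 1 m) ^ 29 * 30000"
        by (intro mult_le_mono) auto
      also have "\<dots> = c * 2 ^ (r * r) * max 1 m ^ 29"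
        by (simp only: c_def power_mult_distrib mult_ac)
      also have "2 ^ num_pairs r * (m + 10) ^ 29 * 30000 = 2 ^ num_pairs r * (m + 10) ^ 18 * (30000 * (m + 10) ^ 11)"
      proof -
        have "(m + 10) ^ 29 = (m + 10) ^ 18 * (m + 10) ^ 11" by (simp flip: power_add)
        then show ?thesis by (simp only: mult_ac)
      qed
      finally show ?thesis using t(2) unfolding par L_def m_def by (rule order_trans[rotated])
    qed
    ultimately show ?thesis using t(1) by blast
  qed
  then show ?thesis
    using computable_power_square[of c] computable_square
    unfolding fpt_turing_reduction_def kClique_def kTrees_def
    by auto
qed

theorem theorem1:
  shows "sharp_W1_hard kTrees"
  using fpt_turing_reduction_kClique poly_time_computable_parameter
  by (auto simp: sharp_W1_hard_def fpt_turing_reducible_def parameterized_counting_problem_def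
      kClique_def kTrees_def)

end
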